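(* Let $H$ be a Krull monoid with class group $G$ such that every class of $G$ contains a prime divisor. Then $\daleth^*(H)$ is an interval (a set of consecutive integers, possibly empty or infinite) and $\daleth^*(H) \subset \mathcal R(H)$. Moreover, if $G$ is finite and $\mathsf D(G) = \mathsf D^*(G) \ge 4$, then \[ \mathcal R(H) = \daleth^*(H) \cup \{2\} = \big(2 + \Delta(H)\big) \cup \{2\} = [2, \mathsf c(H)] \,. \] In detail: (1) If $|G|=1$, then $\mathcal R(H)=\emptyset$; if $|G|=2$, then $\mathcal R(H)=\{2\}$; if $G$ is infinite, then $\mathcal R(H) = \mathbb N_{\ge 2}$. (2) If $\mathsf D(G)=3$ and every nonzero class of $G$ contains precisely one prime divisor, then $\mathcal R(H) = \daleth^*(H) = \{3\}$. (3) If either ($\mathsf D(G)=3$ and there is a nonzero class containing at least two distinct prime divisors) or $\mathsf D(G) \ge 4$, then $\min \mathcal R(H) = 2$ and $\min \daleth^*(H) = 3$.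
   Context: A monoid is a commutative cancellative semigroup with identity, written multiplicatively; $H^\times$ is its unit group, $H_{\mathrm{red}} = H/H^\times$, and $\mathcal A(H)$ its set of atoms. For $a \in H$, a factorization of $a$ is an element $z = u_1\cdots u_k$ of the free abelian monoid $\mathsf Z(H)$ on $\mathcal A(H_{\mathrm{red}})$ whose product is $aH^\times$; $\mathsf Z(a)$ is the set of factorizations, $|z|=k$ is the length, and $\mathsf L(a)=\{|z| : z \in \mathsf Z(a)\}$. For a finite set $L=\{a_1<\dots<a_k\}\subset\mathbb Z$, $\Delta(L)=\{a_{i+1}-a_i\}$; $\Delta(H)=\bigcup_{a\in H}\Delta(\mathsf L(a))$, and $2+\Delta(H)=\{2+d : d \in \Delta(H)\}$. $[a,b]$ denotes $\{c\in\mathbb Z : a\le c\le b\}$. Define $\daleth^*(H) = \{\min(\mathsf L(uv)\setminus\{2\}) : u,v \in \mathcal A(H),\ |\mathsf L(uv)|>1\}$. For factorizations $z,z'$, write $z = u_1\cdots u_k v_1\cdots v_\ell$, $z'=u_1\cdots u_k w_1\cdots w_m$ with $\{v_i\}\cap\{w_j\}=\emptyset$; the distance is $\mathsf d(z,z')=\max\{\ell,m\}$. For $N\in\mathbb N_0$, an $N$-chain from $z$ to $z'$ in $\mathsf Z(a)$ is a sequence $z=z_0,z_1,\dots,z_n=z'$ in $\mathsf Z(a)$ with $\mathsf d(z_{i-1},z_i)\le N$ for all $i$. The catenary degree $\mathsf c(a)$ is the least $N\in\mathbb N_0\cup\{\infty\}$ such that any two factorizations of $a$ are connected by an $N$-chain,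 and $\mathsf c(H)=\sup_{a\in H}\mathsf c(a)$. $\mathcal R(H)$ is the set of all $d\in\mathbb N_{\ge 2}$ such that there exist $a\in H$ and distinct $z,z'\in\mathsf Z(a)$ with $\mathsf d(z,z')=d$ that cannot be connected by a $(d-1)$-chain. A monoid $H$ is a Krull monoid if there is a divisor theory $H_{\mathrm{red}}\hookrightarrow F=\mathcal F(P)$: $F$ is free abelian with basis $P$, the embedding is a divisor homomorphism ($a \mid b$ in $F$ implies $a\mid b$ in $H_{\mathrm{red}}$), and every element of $F$ is the gcd of finitely many elements of $H_{\mathrm{red}}$. The elements of $P$ are the prime divisors; the class group is $G=\mathsf q(F)/\mathsf q(H_{\mathrm{red}})$ (quotient groups), and the class of $p\in P$ is $p\,\mathsf q(H_{\mathrm{red}})$. For a finite abelian group $G$, the Davenport constant $\mathsf D(G)$ is the maximal length of a minimal zero-sum sequence over $G$ (a nonempty sequence of elements of $G$ summing to $0$ with no proper nonempty zero-sum subsequence). If $G\cong C_{n_1}\oplus\dots\oplus C_{n_r}$ with $1<n_1\mid\dots\mid n_r$, then $\mathsf D^*(G)=1+\sum_{i=1}^r(n_i-1)$. *)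

theory Defs
  imports "HOL-Algebra.Algebra" "HOL-Library.Multiset" "HOL-Library.Extended_Nat"
begin

definition cancel_comm_monoid :: "'a monoid \<Rightarrow> bool" where
  "cancel_comm_monoid H \<longleftrightarrow> comm_monoid H \<and>
     (\<forall>a\<in>carrier H. \<forall>b\<in>carrier H. \<forall>c\<in>carrier H. a \<otimes>\<^bsub>H\<^esub> c = b \<otimes>\<^bsub>H\<^esub> c \<longrightarrow> a = b)"

definition atoms :: "'a monoid \<Rightarrow> 'a set" where
  "atoms H = {u \<in> carrier H. irreducible H u}"

definition red_class :: "'a monoid \<Rightarrow> 'a \<Rightarrow> 'a set" where
  "red_class H a = {b \<in> carrier H. b \<sim>\<^bsub>H\<^esub> a}"

text \<open>Factorizations: elements of the free abelian monoid on A(H_red), i.e. multisets of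
  associate classes of atoms, whose product is a H^x.\<close>
definition factorizations :: "'a monoid \<Rightarrow> 'a \<Rightarrow> 'a set multiset set" where
  "factorizations H a = {z. \<exists>us. set us \<subseteq> atoms H \<and> mset (map (red_class H) us) = z
       \<and> foldr (\<otimes>\<^bsub>H\<^esub>) us \<one>\<^bsub>H\<^esub> \<sim>\<^bsub>H\<^esub> a}"

definition lengths :: "'a monoid \<Rightarrow> 'a \<Rightarrow> nat set" where
  "lengths H a = size ` factorizations H a"

definition fdist :: "'b multiset \<Rightarrow> 'b multiset \<Rightarrow> nat" where
  "fdist z z' = max (size (z - z')) (size (z' - z))"

definition delta_set :: "nat set \<Rightarrow> nat set" where
  "delta_set L = {b - a | a b. a \<in> L \<and> b \<in> L \<and> a < b \<and> \<not> (\<exists>c\<in>L. a < c \<and> c < b)}"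

definition Delta :: "'a monoid \<Rightarrow> nat set" where
  "Delta H = (\<Union>a\<in>carrier H. delta_set (lengths H a))"

definition daleth_star :: "'a monoid \<Rightarrow> nat set" where
  "daleth_star H = {(LEAST k. k \<in> lengths H (u \<otimes>\<^bsub>H\<^esub> v) - {2}) | u v.
       u \<in> atoms H \<and> v \<in> atoms H \<and>
       (\<exists>k l. k \<in> lengths H (u \<otimes>\<^bsub>H\<^esub> v) \<and> l \<in> lengths H (u \<otimes>\<^bsub>H\<^esub> v) \<and> k \<noteq> l)}"

definition has_chain :: "'a monoid \<Rightarrow> 'a \<Rightarrow> enat \<Rightarrow> 'a set multiset \<Rightarrow> 'a set multiset \<Rightarrow> bool" where
  "has_chain H a N z z' \<longleftrightarrow> (\<exists>zs. zs \<noteq> [] \<and> hd zs = z \<and> last zs = z' \<and>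
       set zs \<subseteq> factorizations H a \<and>
       (\<forall>i. Suc i < length zs \<longrightarrow> enat (fdist (zs ! i) (zs ! Suc i)) \<le> N))"

definition catenary_elem :: "'a monoid \<Rightarrow> 'a \<Rightarrow> enat" where
  "catenary_elem H a = Inf {N. \<forall>z\<in>factorizations H a. \<forall>z'\<in>factorizations H a. has_chain H a N z z'}"

definition catenary :: "'a monoid \<Rightarrow> enat" where
  "catenary H = (SUP a\<in>carrier H. catenary_elem H a)"

definition R_set :: "'a monoid \<Rightarrow> nat set" where
  "R_set H = {d. 2 \<le> d \<and> (\<exists>a\<in>carrier H. \<exists>z\<in>factorizations H a. \<exists>z'\<in>factorizations H a.
       z \<noteq> z' \<and> fdist z z' = d \<and> \<not> has_chain H a (enat (d - 1)) z z')}"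

definition interval_nat :: "nat set \<Rightarrow> bool" where
  "interval_nat S \<longleftrightarrow> (\<forall>a b c. a \<in> S \<longrightarrow> c \<in> S \<longrightarrow> a \<le> b \<longrightarrow> b \<le> c \<longrightarrow> b \<in> S)"

definition is_min :: "nat set \<Rightarrow> nat \<Rightarrow> bool" where
  "is_min S m \<longleftrightarrow> m \<in> S \<and> (\<forall>x\<in>S. m \<le> x)"

definition is_gcd_mset :: "'p multiset set \<Rightarrow> 'p multiset \<Rightarrow> bool" where
  "is_gcd_mset S m \<longleftrightarrow> (\<forall>x\<in>S. m \<subseteq># x) \<and> (\<forall>y. (\<forall>x\<in>S. y \<subseteq># x) \<longrightarrow> y \<subseteq># m)"

text \<open>phi induces a divisor theory H_red -> F(P) with P = UNIV :: 'p set.\<close>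
definition divisor_theory :: "'a monoid \<Rightarrow> ('a \<Rightarrow> 'p multiset) \<Rightarrow> bool" where
  "divisor_theory H \<phi> \<longleftrightarrow>
     \<phi> \<one>\<^bsub>H\<^esub> = {#} \<and>
     (\<forall>a\<in>carrier H. \<forall>b\<in>carrier H. \<phi> (a \<otimes>\<^bsub>H\<^esub> b) = \<phi> a + \<phi> b) \<and>
     (\<forall>a\<in>carrier H. \<forall>b\<in>carrier H. \<phi> a = \<phi> b \<longleftrightarrow> a \<sim>\<^bsub>H\<^esub> b) \<and>
     (\<forall>a\<in>carrier H. \<forall>b\<in>carrier H. \<phi> a \<subseteq># \<phi> b \<longrightarrow> a divides\<^bsub>H\<^esub> b) \<and>
     (\<forall>m. \<exists>S. finite S \<and> S \<noteq> {} \<and> S \<subseteq> \<phi> ` carrier H \<and> is_gcd_mset S m)"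

definition mclass :: "'g monoid \<Rightarrow> ('p \<Rightarrow> 'g) \<Rightarrow> 'p multiset \<Rightarrow> 'g" where
  "mclass G cls m = finprod G (\<lambda>p. cls p [^]\<^bsub>G\<^esub> count m p) (set_mset m)"

text \<open>G (with class map cls) is the class group q(F)/q(H_red): the homomorphism
  q(F) -> G, m1 - m2 \<mapsto> [m1] [m2]^-1, is surjective with kernel q(H_red) = {phi a - phi b}.\<close>
definition is_class_group :: "'a monoid \<Rightarrow> ('a \<Rightarrow> 'p multiset) \<Rightarrow> 'g monoid \<Rightarrow> ('p \<Rightarrow> 'g) \<Rightarrow> bool" where
  "is_class_group H \<phi> G cls \<longleftrightarrow> comm_group G \<and> (\<forall>p. cls p \<in> carrier G) \<and>
     (\<forall>g\<in>carrier G. \<exists>m1 m2. mclass G cls m1 \<otimes>\<^bsub>G\<^esub> inv\<^bsub>G\<^esub> (mclass G cls m2) = g) \<and>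
     (\<forall>m1 m2. mclass G cls m1 \<otimes>\<^bsub>G\<^esub> inv\<^bsub>G\<^esub> (mclass G cls m2) = \<one>\<^bsub>G\<^esub> \<longleftrightarrow>
        (\<exists>a\<in>carrier H. \<exists>b\<in>carrier H. m1 + \<phi> b = m2 + \<phi> a))"

definition krull_with_class_group :: "'a monoid \<Rightarrow> ('a \<Rightarrow> 'p multiset) \<Rightarrow> 'g monoid \<Rightarrow> ('p \<Rightarrow> 'g) \<Rightarrow> bool" where
  "krull_with_class_group H \<phi> G cls \<longleftrightarrow> cancel_comm_monoid H \<and> divisor_theory H \<phi> \<and> is_class_group H \<phi> G cls"

definition seq_prod :: "'g monoid \<Rightarrow> 'g multiset \<Rightarrow> 'g" where
  "seq_prod G S = finprod G (\<lambda>g. g [^]\<^bsub>G\<^esub> count S g) (set_mset S)"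

definition minimal_zero_sum :: "'g monoid \<Rightarrow> 'g multiset \<Rightarrow> bool" where
  "minimal_zero_sum G S \<longleftrightarrow> S \<noteq> {#} \<and> set_mset S \<subseteq> carrier G \<and> seq_prod G S = \<one>\<^bsub>G\<^esub> \<and>
     (\<forall>T. T \<subseteq># S \<and> T \<noteq> {#} \<and> T \<noteq> S \<longrightarrow> seq_prod G T \<noteq> \<one>\<^bsub>G\<^esub>)"

text \<open>Davenport constant as an extended natural (infinite for infinite G).\<close>
definition davenport :: "'g monoid \<Rightarrow> enat" where
  "davenport G = (SUP S\<in>{S. minimal_zero_sum G S}. enat (size S))"

definition davenport_star :: "'g monoid \<Rightarrow> nat" where
  "davenport_star G = (SOME d. \<exists>ns::nat list.
      (\<forall>i<length ns. 1 < ns ! i) \<and> (\<forall>i. Suc i < length ns \<longrightarrow> ns ! i dvd ns ! Suc i) \<and>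
      G \<cong> product_group {..<length ns} (\<lambda>i. integer_mod_group (ns ! i)) \<and>
      d = 1 + (\<Sum>i<length ns. ns ! i - 1))"

end

theory Submission
  imports Defs
begin

text \<open>
  Factorizations in \<open>H\<close> correspond to factorizations in the monoid of multisets of prime divisors
  of trivial class, where atoms are the minimal zero-sum multisets.

  Interval property: let \<open>U V\<close> have minimal length \<open>k \<ge> 4\<close> above two. Merging two
  primes of \<open>U\<close> into one prime of the product class gives an atom \<open>U'\<close>, and a
  factorization of \<open>U' V\<close> lifts to one of \<open>U V\<close> with at most one additional factor. So the
  minimal length of \<open>U' V\<close> is \<open>k\<close> or \<open>k - 1\<close>, and one inducts on the size of \<open>U V\<close>.
  The factorizations of length two of \<open>U V\<close> are at distance at least \<open>k\<close> from all others, which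
  puts \<open>k\<close> into \<open>R_set H\<close>.

  Upper bound: two factorizations are connected by steps of distance at most \<open>N\<close> as soon as \<open>N\<close>
  bounds \<open>daleth_star H\<close> and twice \<open>N\<close> is at least the Davenport constant. One inducts on the size of the
  element. If one factorization has more than \<open>N\<close> factors, two factors of the other one, after removal of
  their share in one factor of the long factorization, still contain an atom, and this gives an
  intermediate factorization having a factor in common with both.

  Lower bound: if every relation among the members of a zero-sum multiset with coefficients bounded
  by the multiplicities is trivial or extremal, then the product with the negative multiset has factorization
  lengths two and \<open>n\<close> only, where \<open>n\<close> is the size. Infinite groups contain such multisets of every size
  at least three, and in \<open>C\<^sub>n\<^sub>1 \<oplus> \<dots> \<oplus> C\<^sub>n\<^sub>r\<close> the basis elements with multiplicities \<open>n\<^sub>i div 2\<close>,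
  together with minus their sum, form one of size at least half of \<open>davenport_star G\<close>.
\<close>

section \<open>Zero-sum multisets and their factorizations\<close>

lemma sum_mset_image_ge:
  fixes f :: "'b \<Rightarrow> nat"
  assumes "\<And>x. x \<in># z \<Longrightarrow> c \<le> f x"
  shows "c * size z \<le> (\<Sum>x\<in>#z. f x)"
  using assms by (induction z) (auto intro: add_mono)

lemma size_sum_mset: "size (\<Sum>\<^sub># z :: 'b multiset) = (\<Sum>u\<in>#z. size u)"
  by (induction z) auto

lemma subset_sum_mset: "u \<in># z \<Longrightarrow> u \<subseteq># \<Sum>\<^sub># z"
  by (induction z) (auto intro: subset_mset.add_increasing subset_mset.add_increasing2)

text \<open>Each member of \<open>z\<close> greedily takes what it can from \<open>U\<close>, then
  from \<open>V\<close>, and the rest from \<open>R\<close>. The shares form a multiset of triples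
  because equal members of \<open>z\<close> may be cut differently.\<close>

lemma sum_mset_allocate3:
  fixes U V R :: "'p multiset"
  assumes "\<Sum>\<^sub># z = U + V + R"
  shows "\<exists>zz. image_mset (\<lambda>(x, y, w). x + y + w) zz = z \<and> (\<Sum>t\<in>#zz. fst t) = U
    \<and> (\<Sum>t\<in>#zz. fst (snd t)) = V \<and> (\<Sum>t\<in>#zz. snd (snd t)) = R"
  using assms
proof (induction z arbitrary: U V R)
  case empty
  then have "U = {#}" "V = {#}" "R = {#}" by auto
  then show ?case by (intro exI[of _ "{#}"]) auto
next
  case (add v z)
  define x y w where "x = v \<inter># U" and "y = (v - x) \<inter># V" and "w = v - x - y"
  have 1: "v \<subseteq># U + V + R" using add.prems[symmetric] by simp
  have x: "x \<subseteq># U" and y: "y \<subseteq># V" by (auto simp: x_def y_def)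
  have count_le: "count v a \<le> count U a + count V a + count R a" for a
    using 1 by (simp add: subseteq_mset_def)
  have w: "w \<subseteq># R"
    unfolding subseteq_mset_def
  proof
    fix a show "count w a \<le> count R a"
      using count_le[of a] by (simp add: w_def x_def y_def)
  qed
  have v: "v = x + y + w"
  proof (rule multiset_eqI)
    fix a show "count v a = count (x + y + w) a"
      by (simp add: w_def x_def y_def)
  qed
  obtain U' V' R' where d: "U = x + U'" "V = y + V'" "R = w + R'"
    using x y w by (auto simp: subset_mset.le_iff_add)
  have "v + \<Sum>\<^sub># z = v + (U' + V' + R')"
    using add.prems by (simp add: d v ac_simps)
  then have "\<Sum>\<^sub># z = U' + V' + R'" by simp
  from add.IH[OF this] obtain zz where "image_mset (\<lambda>(x, y, w). x + y + w) zz = z"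
    "(\<Sum>t\<in>#zz. fst t) = U'" "(\<Sum>t\<in>#zz. fst (snd t)) = V'" "(\<Sum>t\<in>#zz. snd (snd t)) = R'" by auto
  then show ?case by (intro exI[of _ "add_mset (x, y, w) zz"]) (auto simp: d v)
qed

lemma sum_mset_allocate:
  fixes U V :: "'p multiset"
  assumes "\<Sum>\<^sub># z = U + V"
  shows "\<exists>zz. image_mset (\<lambda>(x, y). x + y) zz = z \<and> (\<Sum>t\<in>#zz. fst t) = U
    \<and> (\<Sum>t\<in>#zz. snd t) = V"
proof -
  have "\<Sum>\<^sub># z = U + V + {#}" using assms by simp
  from sum_mset_allocate3[OF this] obtain zz where
    zz: "image_mset (\<lambda>(x, y, w). x + y + w) zz = z" "(\<Sum>t\<in>#zz. fst t) = U"
    "(\<Sum>t\<in>#zz. fst (snd t)) = V" "(\<Sum>t\<in>#zz. snd (snd t)) = {#}" by blast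
  from zz(4) have e: "snd (snd t) = {#}" if "t \<in># zz" for t
    using that by (auto simp: sum_mset_0_iff)
  let ?yy = "image_mset (\<lambda>(x, y, w). (x, y)) zz"
  have "image_mset (\<lambda>(x, y). x + y) ?yy = image_mset (\<lambda>(x, y, w). x + y + w) zz"
    unfolding multiset.map_comp by (intro image_mset_cong) (use e in auto)
  with zz show ?thesis
    by (intro exI[of _ ?yy]) (simp add: multiset.map_comp comp_def case_prod_beta)
qed

text \<open>Multisets are taken over prime divisors and not over classes, since several primes in
  one class give factorizations that sequences of classes cannot tell apart.\<close>

locale block_monoid = comm_group G for G :: "'g monoid" (structure) +
  fixes cls :: "'p \<Rightarrow> 'g"
  assumes cls_closed [simp]: "cls p \<in> carrier G"
    and cls_surj: "g \<in> carrier G \<Longrightarrow> \<exists>p. cls p = g"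
begin

lemma mclass_superset:
  assumes "finite A" "set_mset m \<subseteq> A"
  shows "mclass G cls m = finprod G (\<lambda>p. cls p [^] count m p) A"
  unfolding mclass_def
  by (rule finprod_mono_neutral_cong_left) (use assms in \<open>auto simp: not_in_iff\<close>)

lemma mclass_union:
  "mclass G cls (m + n) = mclass G cls m \<otimes> mclass G cls n"
proof -
  let ?A = "set_mset m \<union> set_mset n"
  have "mclass G cls (m + n) = finprod G (\<lambda>p. cls p [^] count m p \<otimes> cls p [^] count n p) ?A"
    by (subst mclass_superset[where A = ?A]) (auto simp: nat_pow_mult)
  also have "\<dots> = mclass G cls m \<otimes> mclass G cls n"
    by (simp add: mclass_superset[where A = ?A])
  finally show ?thesis .
qed

abbreviation sg :: "'p multiset \<Rightarrow> 'g" where "sg \<equiv> mclass G cls"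

lemma sg_closed [simp]: "sg m \<in> carrier G"
  unfolding mclass_def by (rule finprod_closed) auto

lemma sg_empty [simp]: "sg {#} = \<one>"
  by (simp add: mclass_def)

lemma sg_union [simp]: "sg (m + n) = sg m \<otimes> sg n"
  by (rule mclass_union)

lemma sg_single: "sg {#p#} = cls p"
  by (simp add: mclass_def)

lemma sg_add_mset [simp]: "sg (add_mset p m) = cls p \<otimes> sg m"
  using sg_union[of "{#p#}" m] sg_single by simp

definition zs :: "'p multiset \<Rightarrow> bool" where "zs m \<longleftrightarrow> sg m = \<one>"

lemma zs_empty [simp]: "zs {#}" by (simp add: zs_def)

lemma zs_union_left: "zs m \<Longrightarrow> zs (m + n) \<longleftrightarrow> zs n"
  by (simp add: zs_def)

lemma zs_union: "zs m \<Longrightarrow> zs n \<Longrightarrow> zs (m + n)"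
  by (simp add: zs_def)

lemma zs_diff: "zs m \<Longrightarrow> zs n \<Longrightarrow> n \<subseteq># m \<Longrightarrow> zs (m - n)"
  by (metis subset_mset.add_diff_inverse zs_union_left)

lemma zs_sum_mset: "(\<And>u. u \<in># z \<Longrightarrow> zs u) \<Longrightarrow> zs (\<Sum>\<^sub># z)"
  by (induction z) (auto intro: zs_union)

text \<open>Minimality among zero-sum parts is irreducibility, because the complement of a zero-sum
  part is again zero-sum.\<close>

definition batom :: "'p multiset \<Rightarrow> bool" where
  "batom u \<longleftrightarrow> u \<noteq> {#} \<and> zs u \<and> (\<forall>t. t \<subseteq># u \<longrightarrow> zs t \<longrightarrow> t = {#} \<or> t = u)"

definition facs :: "'p multiset \<Rightarrow> 'p multiset multiset set" where
  "facs m = {z. (\<forall>u\<in>#z. batom u) \<and> \<Sum>\<^sub># z = m}"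

lemma batom_zs: "batom u \<Longrightarrow> zs u" and batom_nonempty: "batom u \<Longrightarrow> u \<noteq> {#}"
  by (auto simp: batom_def)

lemma batom_minimal: "batom u \<Longrightarrow> t \<subseteq># u \<Longrightarrow> zs t \<Longrightarrow> t \<noteq> {#} \<Longrightarrow> t = u"
  by (auto simp: batom_def)

lemma facsI: "(\<And>u. u \<in># z \<Longrightarrow> batom u) \<Longrightarrow> \<Sum>\<^sub># z = m \<Longrightarrow> z \<in> facs m"
  by (auto simp: facs_def)

lemma facs_batom: "z \<in> facs m \<Longrightarrow> u \<in># z \<Longrightarrow> batom u"
  and facs_sum: "z \<in> facs m \<Longrightarrow> \<Sum>\<^sub># z = m"
  by (auto simp: facs_def)

lemma facs_zs: "z \<in> facs m \<Longrightarrow> zs m"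
  using zs_sum_mset batom_zs by (auto simp: facs_def)

lemma facs_union: "z \<in> facs m \<Longrightarrow> w \<in> facs n \<Longrightarrow> z + w \<in> facs (m + n)"
  by (auto simp: facs_def)

lemma facs_add_mset: "batom u \<Longrightarrow> w \<in> facs n \<Longrightarrow> add_mset u w \<in> facs (u + n)"
  by (auto simp: facs_def)

lemma facs_single: "batom u \<Longrightarrow> {#u#} \<in> facs u"
  by (auto simp: facs_def)

lemma facs_remove: "z \<in> facs m \<Longrightarrow> u \<in># z \<Longrightarrow> z - {#u#} \<in> facs (m - u)"
  by (auto simp: facs_def sum_mset_diff dest: in_diffD)

lemma facs_subset: "z \<in> facs m \<Longrightarrow> u \<in># z \<Longrightarrow> u \<subseteq># m"
  using subset_sum_mset facs_sum by blast

lemma facs_size_le: "z \<in> facs m \<Longrightarrow> size z \<le> size m"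
proof -
  assume z: "z \<in> facs m"
  have "1 \<le> size u" if "u \<in># z" for u
    using facs_batom[OF z that] batom_nonempty by (metis One_nat_def Suc_leI nonempty_has_size)
  from sum_mset_image_ge[of z 1 size, OF this] show ?thesis
    using facs_sum[OF z] by (auto simp: size_sum_mset)
qed

lemma facs_nonempty: "zs m \<Longrightarrow> \<exists>z. z \<in> facs m"
proof (induction "size m" arbitrary: m rule: less_induct)
  case less
  show ?case
  proof (cases "m = {#} \<or> batom m")
    case True
    then show ?thesis
    proof
      assume "m = {#}"
      then have "{#} \<in> facs m" by (simp add: facs_def)
      then show ?thesis by blast
    qed (use facs_single in blast)
  next
    case False
    then obtain t where t: "t \<subseteq># m" "zs t" "t \<noteq> {#}" "t \<noteq> m"
      using less.prems by (auto simp: batom_def)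
    then have t': "t \<subset># m" by (simp add: subset_mset.le_neq_trans)
    have "zs (m - t)" using zs_diff less.prems t by blast
    moreover have "size (m - t) < size m"
      using t mset_subset_size[OF t'] by (simp add: size_Diff_submset nonempty_has_size)
    ultimately obtain z w where "z \<in> facs t" "w \<in> facs (m - t)"
      using less.hyps mset_subset_size[OF t'] t(2) by blast
    from facs_union[OF this] show ?thesis using t(1) by auto
  qed
qed

lemma zs_contains_batom:
  assumes "zs m" "m \<noteq> {#}" obtains u where "batom u" "u \<subseteq># m"
proof -
  obtain z where z: "z \<in> facs m" using facs_nonempty assms by blast
  then have "z \<noteq> {#}" using assms(2) facs_sum by force
  then obtain u where "u \<in># z" by auto
  then show ?thesis using that z facs_batom facs_subset by blast
qed

lemma batom_facs_unique:
  assumes "batom u" "z \<in> facs u" shows "z = {#u#}"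
proof -
  have "z \<noteq> {#}" using assms batom_nonempty facs_sum by force
  then obtain v where v: "v \<in># z" by auto
  then have "v = u" using assms batom_minimal facs_batom batom_zs batom_nonempty facs_subset by metis
  then have "z - {#u#} \<in> facs {#}" using facs_remove[OF assms(2) v] by simp
  then have "z - {#u#} = {#}" using facs_size_le by fastforce
  then show ?thesis using v \<open>v = u\<close> by (metis insert_DiffM)
qed

lemma two_batoms_size_ge:
  assumes "batom U" "batom V" "z \<in> facs (U + V)" shows "2 \<le> size z"
proof (rule ccontr)
  assume "\<not> 2 \<le> size z"
  then consider "size z = 0" | "size z = 1" by linarith
  then show False
  proof cases
    case 1 then show False using assms batom_nonempty facs_sum by force
  next
    case 2
    then obtain w where "z = {#w#}" by (metis One_nat_def size_1_singleton_mset)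
    then have "batom (U + V)" using assms by (auto simp: facs_def)
    then have "U = U + V" using assms batom_minimal batom_zs batom_nonempty by (meson mset_subset_eq_add_left)
    then show False using assms batom_nonempty by auto
  qed
qed

section \<open>Modifying zero-sum multisets by single primes\<close>

definition inv_prime :: "'p multiset \<Rightarrow> 'p" where "inv_prime m = (SOME p. cls p = inv (sg m))"

lemma cls_inv_prime [simp]: "cls (inv_prime m) = inv (sg m)"
  unfolding inv_prime_def by (rule someI_ex) (simp add: cls_surj)

lemma zs_add_inv_prime: "zs (add_mset (inv_prime m) m)"
  by (simp add: zs_def)

text \<open>Replacing \<open>p\<close> by \<open>p1, p2\<close> in the factor containing it gives at most two atoms, since each of
  them must use \<open>p1\<close> or \<open>p2\<close>.\<close>
lemma facs_lift:
  assumes p: "cls p = cls p1 \<otimes> cls p2" and z: "z \<in> facs (add_mset p m)"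
  shows "\<exists>z'\<in>facs (m + {#p1, p2#}). size z' = size z \<or> size z' = Suc (size z)"
proof -
  have "p \<in># \<Sum>\<^sub># z" using facs_sum[OF z] by simp
  then obtain w where w: "w \<in># z" "p \<in># w" by auto
  define w' where "w' = w - {#p#}"
  have ww: "w = add_mset p w'" using w by (simp add: w'_def)
  have wb: "batom w" using facs_batom[OF z w(1)] .
  let ?W = "w' + {#p1, p2#}"
  have zsW: "zs ?W"
    using batom_zs[OF wb] by (auto simp: zs_def ww p) (metis cls_closed m_assoc m_comm sg_closed m_closed)
  \<comment> \<open>An atom inside \<open>w'\<close> would lie inside the atom \<open>w\<close> and
    hence equal \<open>w\<close>, which has one prime more than \<open>w'\<close>.\<close>
  have no: "\<not> s \<subseteq># w'" if "batom s" for s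
  proof
    assume s: "s \<subseteq># w'"
    then have "s \<subseteq># w" by (rule subset_mset.order_trans) (simp add: ww)
    then have "s = w" using batom_minimal[OF wb] that batom_zs batom_nonempty by blast
    then show False using size_mset_mono[OF s] by (simp add: ww)
  qed
  obtain y where y: "y \<in> facs ?W" using facs_nonempty[OF zsW] by auto
  have "y \<noteq> {#}" using facs_sum[OF y] by auto
  have "size y \<le> 2"
  proof -
    obtain yy where yy: "image_mset (\<lambda>(x, y). x + y) yy = y" "(\<Sum>t\<in>#yy. fst t) = w'"
      "(\<Sum>t\<in>#yy. snd t) = {#p1, p2#}"
      using sum_mset_allocate[OF facs_sum[OF y]] by blast
    have "1 \<le> size (snd t)" if t: "t \<in># yy" for t
    proof (rule ccontr)
      assume "\<not> 1 \<le> size (snd t)"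
      then have "snd t = {#}" by (simp add: not_le)
      then have "fst t \<in># y" using t yy(1) by (force simp: case_prod_beta)
      moreover have "fst t \<subseteq># w'" using t yy(2) subset_sum_mset[of "fst t" "image_mset fst yy"] by auto
      ultimately show False using no facs_batom[OF y] by blast
    qed
    from sum_mset_image_ge[of yy 1 "\<lambda>t. size (snd t)", OF this]
    have "size yy \<le> size (\<Sum>t\<in>#yy. snd t)" by (simp add: size_sum_mset multiset.map_comp comp_def)
    then have "size yy \<le> 2" unfolding yy(3) by simp
    then show ?thesis using yy(1) by (metis size_image_mset)
  qed
  moreover have "size y \<ge> 1" using \<open>y \<noteq> {#}\<close> by (metis One_nat_def Suc_leI nonempty_has_size)
  moreover have "(z - {#w#}) + y \<in> facs (m + {#p1, p2#})"
  proof -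
    have "(z - {#w#}) + y \<in> facs ((add_mset p m - w) + ?W)"
      using facs_union[OF facs_remove[OF z w(1)] y] .
    moreover have "(add_mset p m - w) + ?W = m + {#p1, p2#}"
      using facs_subset[OF z w(1)] by (simp add: ww)
    ultimately show ?thesis by simp
  qed
  moreover have "size z = Suc (size (z - {#w#}))" using w(1) by (metis insert_DiffM size_add_mset)
  ultimately show ?thesis
    by (intro bexI[of _ "(z - {#w#}) + y"]) auto
qed

text \<open>A zero-sum part that uses the merged prime becomes a zero-sum part of the original atom
  once \<open>p\<close> is expanded into \<open>p1\<close>, \<open>p2\<close>; so it is
  everything.\<close>

lemma batom_merge:
  assumes p: "cls p = cls p1 \<otimes> cls p2" and U: "batom (m + {#p1, p2#})"
  shows "batom (add_mset p m)"
  unfolding batom_def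
proof (intro conjI allI impI)
  have eq: "zs (add_mset p s) \<longleftrightarrow> zs (s + {#p1, p2#})" for s
    by (auto simp: zs_def p) (metis cls_closed m_assoc m_comm sg_closed m_closed)+
  show "zs (add_mset p m)" using eq batom_zs[OF U] by blast
  fix t assume t: "t \<subseteq># add_mset p m" "zs t"
  show "t = {#} \<or> t = add_mset p m"
  \<comment> \<open>The prime \<open>p\<close> may also occur in \<open>m\<close>, so the question
    is whether \<open>t\<close> needs the additional copy, not whether it contains
    \<open>p\<close>.\<close>
  proof (cases "t \<subseteq># m")
    case True
    then have "t \<subseteq># m + {#p1, p2#}" by (rule subset_mset.add_increasing2[rotated]) simp
    then have "t = {#} \<or> t = m + {#p1, p2#}" using U t(2) by (auto simp: batom_def)
    then show ?thesis using True
      using size_mset_mono by fastforce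
  next
    case False
    then have pt: "p \<in># t" using t(1)
      by (metis add_mset_add_single subset_eq_diff_conv diff_single_trivial)
    then obtain s where s: "t = add_mset p s" by (metis insert_DiffM)
    then have "s \<subseteq># m" using t(1) by simp
    then have "s + {#p1, p2#} \<subseteq># m + {#p1, p2#}" by simp
    moreover have "zs (s + {#p1, p2#})" using eq t(2) s by blast
    ultimately have "s + {#p1, p2#} = m + {#p1, p2#}" 
      by (intro batom_minimal[OF U]) auto
    then show ?thesis using s by simp
  qed
qed simp

text \<open>Completed by one prime to a zero-sum multiset, \<open>S\<close> becomes too long for an
  atom. It therefore splits into two nonempty zero-sum parts, and one of them avoids the added copy
  of the prime.\<close>

lemma ex_batom_in_long:
  assumes D: "\<And>u. batom u \<Longrightarrow> size u \<le> D" and S: "D \<le> size S"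
  obtains Y where "batom Y" "Y \<subseteq># S"
proof -
  let ?q = "inv_prime S"
  have "\<not> batom (add_mset ?q S)" using D[of "add_mset ?q S"] S by auto
  then obtain t where t: "t \<subseteq># add_mset ?q S" "zs t" "t \<noteq> {#}" "t \<noteq> add_mset ?q S"
    using zs_add_inv_prime[of S] by (auto simp: batom_def)
  have "\<exists>s. s \<subseteq># S \<and> zs s \<and> s \<noteq> {#}"
  proof (cases "t \<subseteq># S")
    case True then show ?thesis using t by blast
  next
    case False
    then have "?q \<in># t" using t(1)
      by (metis add_mset_add_single subset_eq_diff_conv diff_single_trivial)
    then obtain s where s: "t = add_mset ?q s" by (metis insert_DiffM)
    then have "add_mset ?q S - t \<subseteq># S" by simp
    moreover have "add_mset ?q S - t \<noteq> {#}" using t(1,4) by (auto simp: Diff_eq_empty_iff_mset intro: subset_mset.antisym)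
    ultimately show ?thesis using zs_diff[OF zs_add_inv_prime t(2) t(1)] by blast
  qed
  then obtain s where s: "s \<subseteq># S" "zs s" "s \<noteq> {#}" by blast
  obtain Y where "batom Y" "Y \<subseteq># s" by (rule zs_contains_batom[OF s(2,3)])
  then show ?thesis using that s(1) by (blast intro: subset_mset.order_trans)
qed

section \<open>Minimal lengths of products of two atoms\<close>

definition min_long :: "'p multiset \<Rightarrow> nat \<Rightarrow> bool" where
  "min_long M k \<longleftrightarrow> k \<in> size ` facs M \<and> k \<noteq> 2 \<and> (\<forall>j\<in>size ` facs M. j \<noteq> 2 \<longrightarrow> k \<le> j)"

text \<open>The counterpart of \<open>daleth_star\<close>. Two is always a length of
  \<open>U + V\<close>, so a length other than two already means that there are several
  lengths.\<close>

definition dal :: "nat set" where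
  "dal = {k. \<exists>U V. batom U \<and> batom V \<and> min_long (U + V) k}"

lemma dalI: "batom U \<Longrightarrow> batom V \<Longrightarrow> min_long (U + V) k \<Longrightarrow> k \<in> dal"
  by (auto simp: dal_def)

lemma min_long_exists:
  assumes "j \<in> size ` facs M" "j \<noteq> 2"
  obtains k where "min_long M k" "k \<le> j"
proof -
  let ?P = "\<lambda>k. k \<in> size ` facs M \<and> k \<noteq> 2"
  have "min_long M (LEAST k. ?P k)"
    unfolding min_long_def using LeastI[of ?P j] Least_le[of ?P] assms by blast
  then show ?thesis using that Least_le[of ?P j] assms by blast
qed

lemma long_ge_3:
  assumes "batom U" "batom V" "k \<in> size ` facs (U + V)" "k \<noteq> 2" shows "3 \<le> k"
  using assms two_batoms_size_ge by force

lemma dal_ge_3: "k \<in> dal \<Longrightarrow> 3 \<le> k"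
  using long_ge_3 by (fastforce simp: dal_def min_long_def)

text \<open>A factor inside \<open>U\<close> equals \<open>U\<close>; the remaining factors then
  multiply to the atom \<open>V\<close>, so the length would be two.\<close>

lemma long_factors_split:
  assumes U: "batom U" and V: "batom V" and z: "z \<in> facs (U + V)" "size z \<noteq> 2"
    and w: "w \<in># z"
  shows "\<not> w \<subseteq># U" "\<not> w \<subseteq># V"
proof -
  have *: False if A: "batom A" and B: "batom B" and z: "z \<in> facs (A + B)" "size z \<noteq> 2"
    and w: "w \<in># z" "w \<subseteq># A" for A B
  proof -
    have "w = A" using that facs_batom batom_minimal batom_zs batom_nonempty by metis
    then have "z - {#w#} \<in> facs B" using facs_remove[OF z(1) w(1)] by simp
    then have "z - {#w#} = {#B#}" using batom_facs_unique[OF B] by blast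
    then have "z = {#w, B#}" using w(1) by (metis insert_DiffM)
    then show False using z(2) by simp
  qed
  show "\<not> w \<subseteq># U" using *[OF U V z w] by blast
  show "\<not> w \<subseteq># V" using *[OF V U _ z(2) w] z(1) by (auto simp: add.commute)
qed

lemma long_allocate:
  assumes U: "batom U" and V: "batom V" and z: "z \<in> facs (U + V)" "size z \<noteq> 2"
  obtains zz where "image_mset (\<lambda>(x, y). x + y) zz = z" "(\<Sum>t\<in>#zz. fst t) = U"
    "(\<Sum>t\<in>#zz. snd t) = V" "\<And>t. t \<in># zz \<Longrightarrow> fst t \<noteq> {#} \<and> snd t \<noteq> {#}"
proof -
  obtain zz where zz: "image_mset (\<lambda>(x, y). x + y) zz = z" "(\<Sum>t\<in>#zz. fst t) = U"
    "(\<Sum>t\<in>#zz. snd t) = V"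
    using sum_mset_allocate[OF facs_sum[OF z(1)]] by blast
  have "fst t \<noteq> {#} \<and> snd t \<noteq> {#}" if t: "t \<in># zz" for t
  proof -
    have m: "fst t + snd t \<in># z" using t zz(1) by (force simp: case_prod_beta)
    have "fst t \<subseteq># U" "snd t \<subseteq># V"
      using t zz(2,3) subset_sum_mset[of "fst t" "image_mset fst zz"]
        subset_sum_mset[of "snd t" "image_mset snd zz"] by auto
    then show ?thesis using long_factors_split[OF U V z m] by auto
  qed
  then show ?thesis using that zz by blast
qed

text \<open>Every factor takes at least one prime from each of \<open>U\<close> and
  \<open>V\<close>, hence has size at least two.\<close>

lemma long_double_size_le:
  assumes U: "batom U" and V: "batom V" and z: "z \<in> facs (U + V)" "size z \<noteq> 2"
  shows "2 * size z \<le> size U + size V"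
proof -
  obtain zz where zz: "image_mset (\<lambda>(x, y). x + y) zz = z"
    "\<And>t. t \<in># zz \<Longrightarrow> fst t \<noteq> {#} \<and> snd t \<noteq> {#}"
    using long_allocate[OF assms] by metis
  have "2 \<le> size u" if "u \<in># z" for u
  proof -
    obtain t where t: "t \<in># zz" "u = fst t + snd t" using \<open>u \<in># z\<close> zz(1) by (auto simp: case_prod_beta)
    then have "0 < size (fst t)" "0 < size (snd t)" using zz(2) by (auto simp: nonempty_has_size)
    then show ?thesis using t(2) by simp
  qed
  from sum_mset_image_ge[of z 2 size, OF this] show ?thesis
    using facs_sum[OF z(1)] by (simp add: size_sum_mset[symmetric])
qed

lemma dal_le_bound:
  assumes "\<And>u. batom u \<Longrightarrow> size u \<le> D" "k \<in> dal" shows "k \<le> D"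
proof -
  obtain U V where UV: "batom U" "batom V" "min_long (U + V) k" using assms(2) by (auto simp: dal_def)
  then obtain z where z: "z \<in> facs (U + V)" "size z = k" "k \<noteq> 2" by (auto simp: min_long_def)
  have "2 * k \<le> size U + size V" using long_double_size_le[OF UV(1,2) z(1)] z(2,3) by simp
  then show ?thesis using assms(1)[OF UV(1)] assms(1)[OF UV(2)] by linarith
qed

text \<open>The shortest factorization of length \<open>k'\<close> above two of the merged product
  lifts to one of length \<open>k'\<close> or \<open>k' + 1\<close> of the original product. That
  length exceeds two, hence is at least \<open>k\<close>; the known length \<open>j\<close> bounds
  \<open>k'\<close> from above.\<close>

lemma dal_merge:
  assumes U: "batom (m + {#p1, p2#})" and V: "batom V" and k: "min_long (m + {#p1, p2#} + V) k" "4 \<le> k"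
    and p: "cls p = cls p1 \<otimes> cls p2"
    and j: "j \<in> size ` facs (add_mset p m + V)" "k - 1 \<le> j" "j \<le> k"
  shows "k - 1 \<in> dal \<or> min_long (add_mset p m + V) k"
proof -
  have U': "batom (add_mset p m)" using batom_merge[OF p U] .
  have "j \<noteq> 2" using j k by linarith
  then obtain k' where k': "min_long (add_mset p m + V) k'" "k' \<le> j"
    using min_long_exists j(1) by blast
  then have k3: "3 \<le> k'" using long_ge_3[OF U' V] by (auto simp: min_long_def)
  obtain z where z: "z \<in> facs (add_mset p (m + V))" "size z = k'"
    using k'(1) by (auto simp: min_long_def)
  obtain z' where z': "z' \<in> facs (m + V + {#p1, p2#})" "size z' = k' \<or> size z' = Suc k'"
    using facs_lift[OF p z(1)] z(2) by blast
  have "z' \<in> facs (m + {#p1, p2#} + V)" using z'(1) by (simp add: ac_simps)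
  then have "k \<le> size z'" using k(1) k3 z'(2) by (auto simp: min_long_def)
  then have "k' = k - 1 \<or> k' = k" using z'(2) k'(2) j(3) by linarith
  then show ?thesis using k'(1) dalI[OF U' V] by blast
qed

lemma two_le_sizeE:
  assumes "2 \<le> size (M :: 'b multiset)" obtains a b N where "M = N + {#a, b#}"
proof -
  have "M \<noteq> {#}" using assms by auto
  then obtain a M' where M: "M = add_mset a M'" by (meson multiset_cases)
  then have "M' \<noteq> {#}" using assms by auto
  then obtain b N where "M' = add_mset b N" by (meson multiset_cases)
  then show ?thesis using that[of N a b] M by simp
qed

text \<open>Two primes of \<open>U\<close> or of \<open>V\<close> are merged. If they lie in the
  same factor of a factorization of length \<open>k\<close>, this length is kept and the induction
  continues with a smaller product; if they lie in different factors, the two factors fuse and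
  length \<open>k - 1\<close> appears.\<close>

lemma dal_pred:
  assumes "batom U" "batom V" "min_long (U + V) k" "4 \<le> k"
  shows "k - 1 \<in> dal"
  using assms
proof (induction "size U + size V" arbitrary: U V rule: less_induct)
  case less
  note U = less.prems(1) and V = less.prems(2) and k = less.prems(3,4)
  obtain z where z: "z \<in> facs (U + V)" "size z = k" "size z \<noteq> 2"
    using k by (auto simp: min_long_def)
  obtain zz where zz: "image_mset (\<lambda>(x, y). x + y) zz = z" "(\<Sum>t\<in>#zz. fst t) = U"
    "(\<Sum>t\<in>#zz. snd t) = V" "\<And>t. t \<in># zz \<Longrightarrow> fst t \<noteq> {#} \<and> snd t \<noteq> {#}"
    using long_allocate[OF U V z(1,3)] by metis
  \<comment> \<open>Stated for \<open>A\<close>, \<open>B\<close> so that it serves with the two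
    atoms in either order: \<open>x\<close> is the share in \<open>A\<close> of a factor of
    \<open>z\<close>, and two primes of this share are merged.\<close>
  have main: "k - 1 \<in> dal"
    if A: "batom A" and B: "batom B" and AB: "A + B = U + V"
      and t: "x + y \<in># z" "x \<subseteq># A" "2 \<le> size x" for A B x y
  proof -
    obtain p1 p2 x' where x: "x = x' + {#p1, p2#}" using two_le_sizeE[OF t(3)] .
    obtain m where m: "A = m + {#p1, p2#}"
    proof -
      have "{#p1, p2#} \<subseteq># A" using t(2) unfolding x
        by (rule subset_mset.order_trans[rotated]) simp
      then show ?thesis using that by (metis subset_mset.diff_add)
    qed
    obtain p where p: "cls p = cls p1 \<otimes> cls p2" using cls_surj by (meson cls_closed m_closed)
    have xy: "batom (x + y)" using facs_batom[OF z(1) t(1)] .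
    have W: "batom (add_mset p (x' + y))"
      by (rule batom_merge[OF p]) (use xy in \<open>simp add: x ac_simps\<close>)
    have "z - {#x + y#} \<in> facs (A + B - (x + y))" using facs_remove[OF z(1) t(1)] AB by simp
    from facs_add_mset[OF W this]
    have f: "add_mset (add_mset p (x' + y)) (z - {#x + y#})
       \<in> facs (add_mset p (x' + y) + (A + B - (x + y)))" .
    have "x + y \<subseteq># A + B" using facs_subset[OF z(1) t(1)] AB by simp
    then obtain c where c: "A + B = x + y + c" by (metis subset_mset.add_diff_inverse)
    have c': "m + B = x' + y + c"
    proof -
      have "(m + B) + {#p1, p2#} = (x' + y + c) + {#p1, p2#}" using c by (simp add: m x)
      then show ?thesis by (simp only: add_right_cancel)
    qed
    have "add_mset p (x' + y) + (A + B - (x + y)) = add_mset p m + B"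
      using c c' by simp
    then have kin: "k \<in> size ` facs (add_mset p m + B)"
      using f z(2) t(1) by (metis image_eqI insert_DiffM size_add_mset)
    have kAB: "min_long (m + {#p1, p2#} + B) k" using k(1) AB m by simp
    \<comment> \<open>The merged product still has a factorization of length \<open>k\<close>, so
      the bound in \<open>dal_merge\<close> is met with \<open>j = k\<close>.\<close>
    from dal_merge[OF A[unfolded m] B kAB k(2) p kin] 
    consider "k - 1 \<in> dal" | "min_long (add_mset p m + B) k" by auto
    then show ?thesis
    proof cases
      case 2
      have "size (add_mset p m) + size B < size U + size V"
        using arg_cong[OF AB, of size] by (simp add: m)
      then show ?thesis using less.hyps batom_merge[OF p A[unfolded m]] B 2 k(2) by blast
    qed
  qed
  show ?case
  proof (cases "\<exists>t\<in>#zz. 2 \<le> size (fst t) \<or> 2 \<le> size (snd t)")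
    case True
    then obtain t where t: "t \<in># zz" "2 \<le> size (fst t) \<or> 2 \<le> size (snd t)" by blast
    have m: "fst t + snd t \<in># z" using t zz(1) by (force simp: case_prod_beta)
    have s: "fst t \<subseteq># U" "snd t \<subseteq># V"
      using t(1) zz(2,3) subset_sum_mset[of "fst t" "image_mset fst zz"]
        subset_sum_mset[of "snd t" "image_mset snd zz"] by auto
    from t(2) show ?thesis
    proof
      assume "2 \<le> size (fst t)"
      then show ?thesis using main[OF U V _ m s(1)] by simp
    next
      assume "2 \<le> size (snd t)"
      then show ?thesis using main[OF V U, of "snd t" "fst t"] m s(2) by (simp add: add.commute)
    qed
  next
    case False
    \<comment> \<open>Now every factor of \<open>z\<close> is one prime of \<open>U\<close> times
      one prime of \<open>V\<close>, so the merged primes have to come from two different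
      factors.\<close>
    have single: "\<exists>p q. t = ({#p#}, {#q#})" if "t \<in># zz" for t
    proof -
      have "size (fst t) = 1" "size (snd t) = 1"
        using False zz(4)[OF that] that by (force simp: nonempty_has_size)+
      then show ?thesis by (metis One_nat_def size_1_singleton_mset prod.collapse)
    qed
    have "size zz = k" using zz(1) z(2) by (metis size_image_mset)
    then have "2 \<le> size zz" using k(2) by simp
    then obtain t1 t2 yy where zz2: "zz = yy + {#t1, t2#}" by (rule two_le_sizeE)
    obtain p1 q1 where t1: "t1 = ({#p1#}, {#q1#})" using single[of t1] zz2 by auto
    obtain p2 q2 where t2: "t2 = ({#p2#}, {#q2#})" using single[of t2] zz2 by auto
    define m where "m = (\<Sum>t\<in>#yy. fst t)"
    define n where "n = (\<Sum>t\<in>#yy. snd t)"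
    have Um: "U = m + {#p1, p2#}" using zz(2) by (auto simp: zz2 m_def t1 t2)
    have Vn: "V = n + {#q1, q2#}" using zz(3) by (auto simp: zz2 n_def t1 t2)
    let ?y = "image_mset (\<lambda>(x, y). x + y) yy"
    have zy: "z = ?y + {#{#p1, q1#}, {#p2, q2#}#}" unfolding zz(1)[symmetric] by (simp add: zz2 t1 t2 add_mset_commute)
    obtain p where p: "cls p = cls p1 \<otimes> cls p2" using cls_surj by (meson cls_closed m_closed)
    have y: "?y \<in> facs (m + n)"
    proof (rule facsI)
      show "batom u" if "u \<in># ?y" for u using that facs_batom[OF z(1)] by (auto simp: zy)
      show "\<Sum>\<^sub># ?y = m + n" unfolding m_def n_def
        by (simp add: case_prod_unfold sum_mset.distrib)
    qed
    have "zs {#p1, q1#}" "zs {#p2, q2#}" using batom_zs facs_batom[OF z(1)] by (auto simp: zy)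
    from zs_union[OF this] have zsW: "zs {#p, q1, q2#}"
      by (simp add: zs_def p m_ac)
    obtain w where w: "w \<in> facs {#p, q1, q2#}" using facs_nonempty[OF zsW] by blast
    have yw: "?y + w \<in> facs (add_mset p m + V)"
      using facs_union[OF y w] by (simp add: Vn add_mset_commute)
    \<comment> \<open>A factor of \<open>w\<close> that avoids the share \<open>p\<close> lies in
      \<open>{#q1, q2#}\<close> and so in \<open>V\<close>, hence equals \<open>V\<close>. But
      \<open>V\<close> has at least one prime for each of the \<open>k\<close> factors, and
      \<open>k\<close> is at least four.\<close>
    have sw: "size w = 1"
    proof -
      obtain ww where ww: "image_mset (\<lambda>(x, y). x + y) ww = w" "(\<Sum>t\<in>#ww. fst t) = {#p#}"
        "(\<Sum>t\<in>#ww. snd t) = {#q1, q2#}"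
        using sum_mset_allocate[of w "{#p#}" "{#q1, q2#}"] facs_sum[OF w] by auto
      have "1 \<le> size (fst t)" if t: "t \<in># ww" for t
      proof (rule ccontr)
        assume "\<not> 1 \<le> size (fst t)"
        then have "fst t = {#}" by (simp add: not_le)
        then have "snd t \<in># w" using t ww(1) by (force simp: case_prod_beta)
        moreover have s: "snd t \<subseteq># {#q1, q2#}"
          using t ww(3) subset_sum_mset[of "snd t" "image_mset snd ww"] by auto
        moreover have "{#q1, q2#} \<subseteq># V" using Vn by simp
        ultimately have "snd t = V"
          using facs_batom[OF w] batom_minimal[OF V] batom_zs batom_nonempty
          by (meson subset_mset.order_trans)
        then have "size V \<le> 2" using size_mset_mono[OF s] by simp
        moreover have "1 \<le> size (snd t)" if "t \<in># yy" for t
          using zz(4)[of t] that zz2 by (simp add: Suc_le_eq nonempty_has_size)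
        then have "size yy \<le> size n"
          using sum_mset_image_ge[of yy 1 "\<lambda>t. size (snd t)"]
          by (simp add: n_def size_sum_mset multiset.map_comp comp_def)
        ultimately show False using \<open>size zz = k\<close> k(2) by (simp add: zz2 Vn)
      qed
      from sum_mset_image_ge[of ww 1 "\<lambda>t. size (fst t)", OF this]
      have "size ww \<le> size (\<Sum>t\<in>#ww. fst t)"
        by (simp add: size_sum_mset multiset.map_comp comp_def)
      then have "size w \<le> 1" using ww(1,2) by (metis size_image_mset size_single)
      moreover have "w \<noteq> {#}" using facs_sum[OF w] by auto
      ultimately show ?thesis by (simp add: le_Suc_eq)
    qed
    have "size ?y = k - 2" using \<open>size zz = k\<close> by (simp add: zz2)
    then have "size (?y + w) = k - 1" using sw k(2) by simp
    then have "k - 1 \<in> size ` facs (add_mset p m + V)" using yw by (metis image_eqI)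
    from dal_merge[OF U[unfolded Um] V k(1)[unfolded Um] k(2) p this]
    consider "k - 1 \<in> dal" | "min_long (add_mset p m + V) k" by auto
    then show ?thesis
    proof cases
      \<comment> \<open>This case cannot occur: the merged product has the length
        \<open>k - 1\<close>, which is smaller than \<open>k\<close> and not two.\<close>
      case 2
      then have "k \<le> k - 1" using \<open>k - 1 \<in> size ` facs (add_mset p m + V)\<close> k(2)
        by (auto simp: min_long_def)
      then show ?thesis using k(2) by simp
    qed
  qed
qed

lemma dal_interval: "interval_nat dal"
proof -
  have "b \<in> dal" if "c \<in> dal" "3 \<le> b" "b \<le> c" for b c
    using that
  proof (induction "c - b" arbitrary: c)
    case (Suc n)
    then have "4 \<le> c" by linarith
    then have "c - 1 \<in> dal" using Suc.prems(1) dal_pred by (auto simp: dal_def)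
    then show ?case using Suc.hyps(1)[of "c - 1"] Suc.hyps(2) Suc.prems by simp
  qed auto
  then show ?thesis unfolding interval_nat_def using dal_ge_3 order_trans by blast
qed

end

section \<open>Distances and chains\<close>

lemma fdist_commute: "fdist x y = fdist y x"
  by (simp add: fdist_def max.commute)

lemma fdist_union_left [simp]: "fdist (w + x) (w + y) = fdist x y"
  by (simp add: fdist_def)

lemma fdist_add_mset [simp]: "fdist (add_mset w x) (add_mset w y) = fdist x y"
  by (simp add: fdist_def)

lemma fdist_le_size: "fdist x y \<le> max (size x) (size y)"
  using size_mset_mono[OF diff_subset_eq_self[of x y]] size_mset_mono[OF diff_subset_eq_self[of y x]]
  by (auto simp: fdist_def)

lemma fdist_disjoint: "x \<inter># y = {#} \<Longrightarrow> fdist x y = max (size x) (size y)"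
  by (simp add: fdist_def) (metis diff_intersect_left_idem diff_intersect_right_idem diff_zero)

context block_monoid
begin

text \<open>The element \<open>m\<close> is determined by either factorization as its sum. The
  closure \<open>conn\<close> is reflexive on arbitrary multisets, so membership in
  \<open>facs\<close> is tracked separately.\<close>

definition chain_step :: "nat \<Rightarrow> ('p multiset multiset \<times> 'p multiset multiset) set" where
  "chain_step N = {(x, y). \<exists>m. x \<in> facs m \<and> y \<in> facs m \<and> fdist x y \<le> N}"

abbreviation conn :: "nat \<Rightarrow> 'p multiset multiset \<Rightarrow> 'p multiset multiset \<Rightarrow> bool" where
  "conn N x y \<equiv> (x, y) \<in> (chain_step N)\<^sup>*"

lemma conn_step: "x \<in> facs m \<Longrightarrow> y \<in> facs m \<Longrightarrow> fdist x y \<le> N \<Longrightarrow> conn N x y"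
  by (auto simp: chain_step_def)

lemma conn_sym: "conn N x y \<Longrightarrow> conn N y x"
proof -
  have "sym (chain_step N)" by (auto simp: chain_step_def sym_def fdist_commute)
  then show "conn N x y \<Longrightarrow> conn N y x" using sym_rtrancl symD by metis
qed

lemma conn_facs: "conn N x y \<Longrightarrow> x \<in> facs m \<Longrightarrow> y \<in> facs m"
  by (induction rule: rtrancl_induct) (auto simp: chain_step_def facs_def)

lemma conn_add_mset:
  assumes u: "batom u" and c: "conn N x y" shows "conn N (add_mset u x) (add_mset u y)"
  using c
proof (induction rule: rtrancl_induct)
  case (step y z)
  then have "(add_mset u y, add_mset u z) \<in> chain_step N"
    using facs_add_mset[OF u] by (auto simp: chain_step_def)
  then show ?case using step.IH by (meson rtrancl.rtrancl_into_rtrancl)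
qed auto

lemma conn_mono: "N \<le> N' \<Longrightarrow> conn N x y \<Longrightarrow> conn N' x y"
proof -
  assume "N \<le> N'"
  then have "chain_step N \<subseteq> chain_step N'" by (auto simp: chain_step_def)
  from rtrancl_mono[OF this] show "conn N x y \<Longrightarrow> conn N' x y" by blast
qed

text \<open>The bound on \<open>dal\<close> serves factorizations of length two; the inequality
  \<open>D \<le> 2 * N\<close> produces an atom inside the product of two factors when the other
  factorization is long.\<close>

lemma catenary_bound:
  assumes N: "2 \<le> N" "\<And>k. k \<in> dal \<Longrightarrow> k \<le> N"
    and D: "\<And>u. batom u \<Longrightarrow> size u \<le> D" "D \<le> 2 * N"
    and "z \<in> facs A" "z' \<in> facs A"
  shows "conn N z z'"
  using assms(5,6)
proof (induction "size A" arbitrary: A z z' rule: less_induct)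
  case less
  \<comment> \<open>A common factor can be removed, connected by induction and put back.\<close>
  have shared: "conn N x y" if x: "x \<in> facs A" and y: "y \<in> facs A" and u: "u \<in># x" "u \<in># y" for x y u
  proof -
    have ub: "batom u" using facs_batom x u(1) by blast
    have "u \<subseteq># A" using facs_subset x u(1) by blast
    then have "size (A - u) < size A"
      using batom_nonempty[OF ub] size_mset_mono[of u A] by (simp add: size_Diff_submset nonempty_has_size)
    from less.hyps[OF this facs_remove[OF x u(1)] facs_remove[OF y u(2)]]
    have "conn N (x - {#u#}) (y - {#u#})" .
    from conn_add_mset[OF ub this] show ?thesis using u by simp
  qed
  \<comment> \<open>If \<open>u + v\<close> divides \<open>A\<close>, a factorization containing
    both \<open>u\<close> and \<open>v\<close> shares a factor with \<open>x\<close> and one with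
    \<open>y\<close>.\<close>
  have avoid: "conn N x y" if x: "x \<in> facs A" and y: "y \<in> facs A" and u: "u \<in># x" and v: "v \<in># y"
    and uv: "v \<subseteq># A - u" for x y u v
  proof -
    have ub: "batom u" and vb: "batom v" using facs_batom x y u v by blast+
    have uA: "u \<subseteq># A" using facs_subset x u by blast
    have "zs (A - u - v)" using zs_diff facs_zs x batom_zs ub vb uA uv by blast
    then obtain f where "f \<in> facs (A - u - v)" using facs_nonempty by blast
    then have "add_mset u (add_mset v f) \<in> facs (u + (v + (A - u - v)))"
      using facs_add_mset ub vb by blast
    moreover have "u + (v + (A - u - v)) = A" using uA uv by (metis subset_mset.add_diff_inverse)
    ultimately have f: "add_mset u (add_mset v f) \<in> facs A" by simp
    have "conn N x (add_mset u (add_mset v f))" using shared[OF x f u] by simp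
    moreover have "conn N (add_mset u (add_mset v f)) y" using shared[OF f y _ v] by simp
    ultimately show ?thesis by (rule rtrancl_trans)
  qed
  have long: "conn N x y" if x: "x \<in> facs A" and y: "y \<in> facs A" and sx: "3 \<le> size x" and sy: "N < size y" for x y
  proof -
    have "2 \<le> size x" using sx by simp
    then obtain u1 u2 x0 where x0: "x = x0 + {#u1, u2#}" by (rule two_le_sizeE)
    define R where "R = \<Sum>\<^sub># x0"
    have A: "A = u1 + u2 + R" using facs_sum[OF x] by (auto simp: x0 R_def ac_simps)
    obtain yy where yy: "image_mset (\<lambda>(x, y, w). x + y + w) yy = y" "(\<Sum>t\<in>#yy. fst t) = u1"
      "(\<Sum>t\<in>#yy. fst (snd t)) = u2" "(\<Sum>t\<in>#yy. snd (snd t)) = R"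
      using sum_mset_allocate3[OF facs_sum[OF y, unfolded A]] by blast
    have parts: "fst t \<subseteq># u1" "fst (snd t) \<subseteq># u2" "snd (snd t) \<subseteq># R"
       "fst t + fst (snd t) + snd (snd t) \<in># y" if "t \<in># yy" for t
    proof -
      show "fst t \<subseteq># u1" "fst (snd t) \<subseteq># u2" "snd (snd t) \<subseteq># R"
        using that yy(2,3,4) subset_sum_mset[of "fst t" "image_mset fst yy"]
          subset_sum_mset[of "fst (snd t)" "image_mset (\<lambda>t. fst (snd t)) yy"]
          subset_sum_mset[of "snd (snd t)" "image_mset (\<lambda>t. snd (snd t)) yy"] by auto
      show "fst t + fst (snd t) + snd (snd t) \<in># y" using that yy(1) by (force simp: case_prod_beta)
    qed
    show ?thesis
    \<comment> \<open>A factor of \<open>y\<close> that takes nothing from \<open>u1\<close> or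
      nothing from \<open>u2\<close> is covered by \<open>avoid\<close>.\<close>
    proof (cases "\<exists>t\<in>#yy. fst t = {#} \<or> fst (snd t) = {#}")
      case True
      then obtain t where t: "t \<in># yy" "fst t = {#} \<or> fst (snd t) = {#}" by blast
      from t(2) show ?thesis
      proof
        assume "fst t = {#}"
        moreover have "fst (snd t) + snd (snd t) \<subseteq># A - u1"
          using parts(2,3)[OF t(1)] by (simp add: A subset_mset.add_mono)
        ultimately show ?thesis using avoid[OF x y _ parts(4)[OF t(1)], of u1] by (simp add: x0)
      next
        assume "fst (snd t) = {#}"
        moreover have "fst t + snd (snd t) \<subseteq># A - u2"
          using parts(1,3)[OF t(1)] by (simp add: A subset_mset.add_mono)
        ultimately show ?thesis using avoid[OF x y _ parts(4)[OF t(1)], of u2] by (simp add: x0)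
      qed
    next
      case False
      have "yy \<noteq> {#}" using yy(1) sy by auto
      then obtain t1 yy0 where t1: "yy = add_mset t1 yy0" by (meson multiset_cases)
      obtain a b c where abc: "t1 = (a, b, c)" by (cases t1)
      \<comment> \<open>What remains of \<open>u1 + u2\<close> without the share of one factor of
        \<open>y\<close>, which will be called \<open>v\<close>. Each of the other factors, at least
        \<open>N\<close> in number, contributes at least two primes, so \<open>S\<close> has at
        least \<open>2 * N\<close> primes and contains an atom \<open>Y\<close>.\<close>
      define S where "S = (\<Sum>t\<in>#yy0. fst t + fst (snd t))"
      have "2 \<le> size (fst t + fst (snd t))" if "t \<in># yy0" for t
      proof -
        have "fst t \<noteq> {#}" "fst (snd t) \<noteq> {#}" using that False t1 by auto
        then have "0 < size (fst t)" "0 < size (fst (snd t))" by (auto simp: nonempty_has_size)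
        then show ?thesis by simp
      qed
      from sum_mset_image_ge[of yy0 2 "\<lambda>t. size (fst t + fst (snd t))", OF this]
      have "2 * size yy0 \<le> size S" unfolding S_def size_sum_mset by (simp add: multiset.map_comp comp_def)
      moreover have "size y = Suc (size yy0)" using yy(1) t1 by (metis size_image_mset size_add_mset)
      ultimately have "D \<le> size S" using sy D(2) by linarith
      then obtain Y where Y: "batom Y" "Y \<subseteq># S" using ex_batom_in_long[OF D(1)] by metis
      have uS: "u1 + u2 = S + (a + b)"
        using yy(2,3) by (auto simp: t1 abc S_def sum_mset.distrib ac_simps)
      define v where "v = a + b + c"
      have v: "v \<in># y" using parts(4)[of t1] by (simp add: t1 abc v_def)
      have cR: "c \<subseteq># R" using parts(3)[of t1] by (simp add: t1 abc)
      have u12: "batom u1" "batom u2" "x0 \<in> facs R"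
        using x by (auto simp: facs_def x0 R_def)
      have vb: "batom v" using facs_batom[OF y v] .
      have YU: "Y \<subseteq># u1 + u2" using Y(2) uS by (simp add: subset_mset.add_increasing2)
      have "zs (u1 + u2 - Y)" using zs_diff zs_union u12 batom_zs Y(1) YU by blast
      then obtain f where f: "f \<in> facs (u1 + u2 - Y)" using facs_nonempty by blast
      obtain S' where S': "S = Y + S'" using Y(2) by (metis subset_mset.add_diff_inverse)
      obtain R' where R': "R = c + R'" using cR by (metis subset_mset.add_diff_inverse)
      have AY: "A = Y + (v + (S' + R'))" by (simp add: A uS S' R' v_def)
      have "zs (S' + R')"
        using facs_zs[OF x] zs_union_left batom_zs Y(1) vb unfolding AY by blast
      then obtain g where g: "g \<in> facs (S' + R')" using facs_nonempty by blast
      \<comment> \<open>The route from \<open>x\<close> to \<open>y\<close>: \<open>w1\<close> keeps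
        the factors \<open>x0\<close> of \<open>x\<close>, \<open>w2\<close> contains both
        \<open>Y\<close> and \<open>v\<close>. Consecutive factorizations share a factor.\<close>
      have w1: "add_mset Y (f + x0) \<in> facs A"
      proof -
        have "Y + (u1 + u2 - Y + R) = A" using subset_mset.add_diff_inverse[OF YU] by (simp add: A flip: union_assoc)
        then show ?thesis using facs_add_mset[OF Y(1) facs_union[OF f u12(3)]] by simp
      qed
      have w2: "add_mset Y (add_mset v g) \<in> facs A"
        using facs_add_mset[OF Y(1) facs_add_mset[OF vb g]] AY by simp
      \<comment> \<open>This is where three factors of \<open>x\<close> are required: a third one
        must survive in \<open>w1\<close>.\<close>
      have "x0 \<noteq> {#}" using sx x0 by auto
      then obtain u3 where "u3 \<in># x0" by auto
      then have "conn N x (add_mset Y (f + x0))" using shared[OF x w1, of u3] by (simp add: x0)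
      moreover have "conn N (add_mset Y (f + x0)) (add_mset Y (add_mset v g))"
        using shared[OF w1 w2, of Y] by simp
      moreover have "conn N (add_mset Y (add_mset v g)) y" using shared[OF w2 y _ v] by simp
      ultimately show ?thesis by (meson rtrancl_trans)
    qed
  qed
  have one_long: "conn N x y" if x: "x \<in> facs A" and y: "y \<in> facs A" and sy: "N < size y" for x y
  proof (cases "3 \<le> size x")
    case True
    then show ?thesis using long x y sy by blast
  next
    case False
    then consider "size x = 0" | "size x = 1" | "size x = 2" by linarith
    then show ?thesis
    proof cases
      case 1
      then have "A = {#}" using facs_sum[OF x] by auto
      then show ?thesis using facs_size_le[OF y] sy by simp
    next
      case 2
      then obtain u where "x = {#u#}" by (metis One_nat_def size_1_singleton_mset)
      then have "batom A" using x by (auto simp: facs_def)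
      then show ?thesis using batom_facs_unique x y by blast
    next
      case 3
      then have "2 \<le> size x" by simp
      then obtain U V r where r: "x = r + {#U, V#}" by (rule two_le_sizeE)
      then have x: "x = {#U, V#}" using 3 by simp
      \<comment> \<open>With only two factors no third one is left for \<open>long\<close>. The
        chain first moves to a shortest factorization \<open>w\<close> of length above two; this is
        one step, since that length lies in \<open>dal\<close>.\<close>
      have UV: "batom U" "batom V" "A = U + V" using \<open>x \<in> facs A\<close> by (auto simp: facs_def x)
      have "size y \<in> size ` facs A" "size y \<noteq> 2" using y sy N(1) by auto
      then obtain k where k: "min_long A k" using min_long_exists by blast
      then obtain w where w: "w \<in> facs A" "size w = k" "k \<noteq> 2" by (auto simp: min_long_def)
      have kN: "k \<le> N" using dalI UV k N(2) by blast
      have k3: "3 \<le> k" using long_ge_3[OF UV(1,2)] k UV(3) by (auto simp: min_long_def)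
      have "fdist x w \<le> N" using fdist_le_size[of x w] w(2) kN N(1) by (simp add: x)
      then have "conn N x w" using conn_step \<open>x \<in> facs A\<close> w(1) by blast
      moreover have "conn N w y" using long w y k3 sy by blast
      ultimately show ?thesis by (rule rtrancl_trans)
    qed
  qed
  show ?case
  proof (cases "size z \<le> N \<and> size z' \<le> N")
    case True
    then have "fdist z z' \<le> N" using fdist_le_size[of z z'] by (meson max.boundedI order_trans)
    then show ?thesis using conn_step less.prems by blast
  next
    case False
    then show ?thesis using one_long less.prems conn_sym not_le by blast
  qed
qed

text \<open>Steps of distance less than \<open>k\<close> cannot leave the factorizations of length two.\<close>
lemma dal_not_conn:
  assumes "k \<in> dal"
  shows "\<exists>m z z'. z \<in> facs m \<and> z' \<in> facs m \<and> z \<noteq> z' \<and> fdist z z' = k \<and> \<not> conn (k - 1) z z'"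
proof -
  obtain U V where UV: "batom U" "batom V" "min_long (U + V) k" using assms by (auto simp: dal_def)
  have k3: "3 \<le> k" using dal_ge_3 assms .
  obtain z' where z': "z' \<in> facs (U + V)" "size z' = k" using UV by (auto simp: min_long_def)
  \<comment> \<open>\<open>long_factors_split\<close> applies to the two members of \<open>x\<close>
    in place of \<open>U\<close>, \<open>V\<close>: none of them can occur in
    \<open>y\<close>.\<close>
  have disj: "x \<inter># y = {#}" if x: "x \<in> facs (U + V)" "size x = 2" and y: "y \<in> facs (U + V)" "size y \<noteq> 2" for x y
  proof (rule ccontr)
    assume "x \<inter># y \<noteq> {#}"
    then obtain w where "w \<in># x \<inter># y" by auto
    then have w: "w \<in># x" "w \<in># y" by auto
    obtain B where B: "x = {#w, B#}"
    proof -
      have "size (x - {#w#}) = 1" using w x(2) by (simp add: size_Diff_singleton)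
      then obtain B where "x - {#w#} = {#B#}" by (metis One_nat_def size_1_singleton_mset)
      then show ?thesis using that w(1) by (metis insert_DiffM)
    qed
    then have *: "batom w" "batom B" "w + B = U + V" using x(1) by (auto simp: facs_def)
    show False using long_factors_split(1)[OF *(1,2), of y w] y w *(3) by simp
  qed
  have z: "{#U, V#} \<in> facs (U + V)" using UV by (auto simp: facs_def)
  have dist: "k \<le> fdist x y" if x: "x \<in> facs (U + V)" "size x = 2" and y: "y \<in> facs (U + V)" "size y \<noteq> 2" for x y
  proof -
    have "k \<le> size y" using UV(3) y by (auto simp: min_long_def)
    then show ?thesis using fdist_disjoint[OF disj[OF x y]] by simp
  qed
  have stay: "size y = 2" if "conn (k - 1) {#U, V#} y" for y
    using that
  proof (induction rule: rtrancl_induct)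
    case (step y w)
    then have y: "y \<in> facs (U + V)" using conn_facs z by blast
    have w: "w \<in> facs (U + V)" using conn_facs z step.hyps rtrancl.rtrancl_into_rtrancl by meson
    have "fdist y w \<le> k - 1" using step.hyps(2) by (auto simp: chain_step_def)
    then show ?case using dist[OF y step.IH w] k3 by linarith
  qed simp
  have d: "fdist {#U, V#} z' = k"
    using fdist_disjoint[OF disj[OF z _ z'(1)]] z'(2) k3 by simp
  show ?thesis
  proof (rule exI[of _ "U + V"], rule exI[of _ "{#U, V#}"], rule exI[of _ z'], intro conjI z z'(1) d)
    show "{#U, V#} \<noteq> z'" using z'(2) k3 by auto
    show "\<not> conn (k - 1) {#U, V#} z'" using stay[of z'] z'(2) k3 by linarith
  qed
qed

text \<open>After cancellation of common factors the shorter factorization still has at least two factors.\<close>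
lemma fdist_ge_length_gap:
  assumes x: "x \<in> facs m" and y: "y \<in> facs m" and l: "size x < size y"
  shows "size y - size x + 2 \<le> fdist x y"
proof -
  define c x' y' where "c = x \<inter># y" and "x' = x - y" and "y' = y - x"
  have d: "x = c + x'" "y = c + y'"
    by (auto simp: c_def x'_def y'_def multiset_eq_iff)
  have s: "\<Sum>\<^sub># x' = \<Sum>\<^sub># y'" using facs_sum[OF x] facs_sum[OF y] by (auto simp: d)
  have xf: "x' \<in> facs (\<Sum>\<^sub># y')" "y' \<in> facs (\<Sum>\<^sub># y')" using x y s by (auto simp: facs_def d)
  have l': "size x' < size y'" using l by (simp add: d)
  have "2 \<le> size x'"
  proof (rule ccontr)
    assume "\<not> 2 \<le> size x'"
    then consider "size x' = 0" | "size x' = 1" by linarith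
    then show False
    proof cases
      case 1
      then have x': "x' = {#}" by simp
      have "y' \<in> facs (\<Sum>\<^sub># x')" using xf(2) s by metis
      then have "y' \<in> facs {#}" by (simp add: x')
      then show False using facs_size_le[of y' "{#}"] l' by simp
    next
      case 2
      then obtain u where u: "x' = {#u#}" by (metis One_nat_def size_1_singleton_mset)
      then have "batom u" "y' \<in> facs u" using xf s by (auto simp: facs_def)
      then show False using batom_facs_unique l' u by auto
    qed
  qed
  moreover have "size y' \<le> fdist x y" by (simp add: fdist_def y'_def)
  ultimately show ?thesis using l' by (simp add: d)
qed

section \<open>Constructions of atoms and distances\<close>

text \<open>A chosen prime in the inverse class. It depends only on the class of \<open>p\<close>,
  so it is in general neither injective nor an involution.\<close>

definition neg :: "'p \<Rightarrow> 'p" where "neg p = (SOME q. cls q = inv (cls p))"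

lemma cls_neg [simp]: "cls (neg p) = inv (cls p)"
  unfolding neg_def by (rule someI_ex) (simp add: cls_surj)

lemma sg_neg [simp]: "sg (image_mset neg m) = inv (sg m)"
  by (induction m) (auto simp: inv_mult)

lemma zs_union_neg: "zs (m + image_mset neg n) \<longleftrightarrow> sg m = sg n"
  by (simp add: zs_def) (metis inv_inv inv_solve_right r_inv sg_closed inv_closed inv_equality)

lemma zs_neg: "zs (image_mset neg n) \<longleftrightarrow> zs n"
  using zs_union_neg[of "{#}" n] by (auto simp: zs_def)

text \<open>Without primes of trivial class every factor has at least two primes, so three primes
  leave room for one factor only.\<close>

lemma small_batom:
  assumes "zs m" "m \<noteq> {#}" "size m \<le> 3" "\<And>p. p \<in># m \<Longrightarrow> cls p \<noteq> \<one>"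
  shows "batom m"
proof -
  obtain z where z: "z \<in> facs m" using facs_nonempty assms(1) by blast
  have "2 \<le> size u" if u: "u \<in># z" for u
  proof (rule ccontr)
    assume "\<not> 2 \<le> size u"
    moreover have "0 < size u" using facs_batom[OF z u] batom_nonempty nonempty_has_size by blast
    ultimately have "size u = 1" by linarith
    then obtain p where p: "u = {#p#}" by (metis One_nat_def size_1_singleton_mset)
    then have "cls p = \<one>" using batom_zs[OF facs_batom[OF z u]] by (simp add: zs_def)
    moreover have "p \<in># m" using facs_subset[OF z u] p by simp
    ultimately show False using assms(4) by blast
  qed
  from sum_mset_image_ge[of z 2 size, OF this] have "2 * size z \<le> size m"
    using facs_sum[OF z] by (simp add: size_sum_mset[symmetric])
  then have "size z \<le> 1" using assms(3) by linarith
  moreover have "z \<noteq> {#}" using facs_sum[OF z] assms(2) by auto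
  ultimately have "size z = 1" by (simp add: le_Suc_eq)
  then obtain u where "z = {#u#}" by (metis One_nat_def size_1_singleton_mset)
  then show ?thesis using z by (auto simp: facs_def)
qed

lemma batom_pair: "cls p \<noteq> \<one> \<Longrightarrow> batom {#p, neg p#}"
  by (rule small_batom) (auto simp: zs_def)

lemma batom_contains_pair:
  assumes "batom u" "{#p, neg p#} \<subseteq># u" shows "u = {#p, neg p#}"
  using batom_minimal[OF assms] by (auto simp: zs_def)

lemma batom_no_unit:
  assumes "batom u" "2 \<le> size u" "p \<in># u" shows "cls p \<noteq> \<one>"
proof
  assume "cls p = \<one>"
  then have "{#p#} = u" using batom_minimal[OF assms(1), of "{#p#}"] assms(3) by (simp add: zs_def)
  then show False using assms(2) by auto
qed

lemma facs_pairs: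
  assumes "\<And>p. p \<in># M \<Longrightarrow> cls p \<noteq> \<one>"
  shows "image_mset (\<lambda>p. {#p, neg p#}) M \<in> facs (M + image_mset neg M)"
proof (rule facsI)
  show "batom u" if "u \<in># image_mset (\<lambda>p. {#p, neg p#}) M" for u
    using that batom_pair assms by auto
  show "\<Sum>\<^sub># (image_mset (\<lambda>p. {#p, neg p#}) M) = M + image_mset neg M"
    by (induction M) auto
qed

text \<open>Two primes of \<open>U\<close> complete to a zero-sum triple \<open>M\<close>. Then
  \<open>M\<close> and its negative are atoms whose product also factors into three pairs, and no
  length above two is smaller than three.\<close>

lemma three_in_dal:
  assumes U: "batom U" "3 \<le> size U"
  shows "3 \<in> dal"
proof -
  have "2 \<le> size U" using U(2) by simp
  then obtain p q m where m: "U = m + {#p, q#}" by (rule two_le_sizeE)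
  define r where "r = inv_prime {#p, q#}"
  define M where "M = {#p, q, r#}"
  have zsM: "zs M" using zs_add_inv_prime[of "{#p, q#}"] by (simp add: M_def r_def add_mset_commute)
  have "\<not> zs {#p, q#}"
  proof
    assume "zs {#p, q#}"
    then have "{#p, q#} = U" using batom_minimal[OF U(1), of "{#p, q#}"] by (simp add: m)
    then show False using U(2) by auto
  qed
  then have "cls r \<noteq> \<one>" by (simp add: zs_def r_def)
  then have nz: "cls x \<noteq> \<one>" if "x \<in># M" for x
    using that batom_no_unit[OF U(1)] \<open>2 \<le> size U\<close> by (auto simp: M_def m)
  have M: "batom M" by (rule small_batom) (use zsM nz in \<open>auto simp: M_def\<close>)
  have N: "batom (image_mset neg M)"
    by (rule small_batom) (use zsM zs_neg[of M] nz in \<open>auto simp: M_def\<close>)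
  have "3 \<in> size ` facs (M + image_mset neg M)"
    by (rule image_eqI[OF _ facs_pairs]) (use nz in \<open>auto simp: M_def\<close>)
  then have "min_long (M + image_mset neg M) 3"
    using long_ge_3[OF M N] by (auto simp: min_long_def)
  then show ?thesis using dalI M N by blast
qed

text \<open>Every atom dividing the product of \<open>M\<close> and its negative has size two or \<open>size M\<close>.\<close>
lemma dal_symmetric:
  assumes zs: "zs M" and n: "3 \<le> size M"
    and Q: "\<And>A B. A \<subseteq># M \<Longrightarrow> B \<subseteq># M \<Longrightarrow> sg A = sg B \<Longrightarrow> A = B \<or> A + B = M"
  shows "batom M \<and> size M \<in> dal"
proof -
  let ?N = "image_mset neg M"
  have M: "batom M"
    unfolding batom_def
  proof (intro conjI allI impI zs)
    show "M \<noteq> {#}" using n by auto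
    fix t assume "t \<subseteq># M" "zs t"
    then show "t = {#} \<or> t = M" using Q[of t "{#}"] by (auto simp: zs_def)
  qed
  have negsub: "\<exists>B. B \<subseteq># A \<and> t = image_mset neg B" if "t \<subseteq># image_mset neg A" for t A
    using that image_mset_eq_plusD[of neg A t] by (metis mset_subset_eq_add_left subset_mset.add_diff_inverse)
  have N: "batom ?N"
    unfolding batom_def
  proof (intro conjI allI impI)
    show "?N \<noteq> {#}" using n by auto
    show "zs ?N" using zs by (simp add: zs_neg)
    fix t assume t: "t \<subseteq># ?N" "zs t"
    then obtain B where "B \<subseteq># M" "t = image_mset neg B" using negsub by blast
    then show "t = {#} \<or> t = ?N" using t(2) batom_minimal[OF M] by (auto simp: zs_neg)
  qed
  \<comment> \<open>A chosen negative may itself be a prime of \<open>A\<close>, so the cut is not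
    canonical; here \<open>t\<close> takes from \<open>A\<close> first.\<close>
  have split: "\<exists>A' B'. A' \<subseteq># A \<and> B' \<subseteq># B \<and> t = A' + image_mset neg B'"
    if "t \<subseteq># A + image_mset neg B" for t A B
  proof -
    have "t - t \<inter># A \<subseteq># image_mset neg B"
      using that by (auto simp: subseteq_mset_def) (metis add.commute diff_diff_left diff_le_self le_diff_conv min_def diff_is_0_eq le0 order.trans nat_le_linear)
    then obtain B' where "B' \<subseteq># B" "t - t \<inter># A = image_mset neg B'" using negsub by blast
    then show ?thesis by (metis subset_mset.add_diff_inverse subset_mset.inf_le1 subset_mset.inf_le2)
  qed
  have nz: "cls p \<noteq> \<one>" if "p \<in># M" for p
    using batom_no_unit[OF M _ that] n by linarith
  have pair: "size w = 2" if z: "z \<in> facs (M + ?N)" "size z \<noteq> 2" and w: "w \<in># z" for z w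
  proof -
    have wb: "batom w" using facs_batom[OF z(1) w] .
    obtain A B where AB: "A \<subseteq># M" "B \<subseteq># M" "w = A + image_mset neg B"
      using split[OF facs_subset[OF z(1) w]] by blast
    have sAB: "sg A = sg B" using batom_zs[OF wb] AB(3) zs_union_neg by blast
    have common: "size w = 2" if "p \<in># A" "p \<in># B" for p
    proof -
      have "{#p#} + image_mset neg {#p#} \<subseteq># w"
        unfolding AB(3) by (intro subset_mset.add_mono image_mset_subseteq_mono) (use that in auto)
      then show ?thesis using batom_contains_pair[OF wb, of p] by (simp add: add_mset_commute)
    qed
    \<comment> \<open>In the first case \<open>w\<close> contains a prime together with its negative
      and is that pair; in the second the cofactor of \<open>w\<close> is itself an atom, so
      \<open>z\<close> would have length two.\<close>
    consider "A = B" | "A + B = M" using Q[OF AB(1,2) sAB] by blast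
    then show ?thesis
    proof cases
      case 1
      then have "A \<noteq> {#}" using AB(3) batom_nonempty[OF wb] by auto
      then obtain p where "p \<in># A" by auto
      then show ?thesis using common 1 by blast
    next
      case 2
      have rest: "M + ?N - w = B + image_mset neg A"
        unfolding AB(3) 2[symmetric] by simp
      have sw: "size w = size M" by (simp add: AB(3) flip: 2)
      have "batom (B + image_mset neg A)"
        unfolding batom_def
      proof (intro conjI allI impI)
        have "size (B + image_mset neg A) = size M" by (simp flip: 2)
        then show "B + image_mset neg A \<noteq> {#}" using n by force
        show "zs (B + image_mset neg A)" using zs_union_neg sAB by simp
        fix t assume t: "t \<subseteq># B + image_mset neg A" "zs t"
        obtain B' A' where t': "B' \<subseteq># B" "A' \<subseteq># A" "t = B' + image_mset neg A'"
          using split[OF t(1)] by blast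
        have "B' \<subseteq># M" "A' \<subseteq># M" using t' AB(1,2) subset_mset.order_trans by blast+
        moreover have "sg B' = sg A'" using t(2) t'(3) zs_union_neg by blast
        ultimately consider "B' = A'" | "B' + A' = M" using Q by blast
        then show "t = {#} \<or> t = B + image_mset neg A"
        proof cases
          \<comment> \<open>A common prime of \<open>A\<close> and \<open>B\<close> would make
            \<open>w\<close> a pair, although it has size \<open>size M\<close>, which is at least
            three.\<close>
          case 1
          show ?thesis
          proof (cases "A' = {#}")
            case False
            then obtain p where "p \<in># A'" by auto
            then have "p \<in># A" "p \<in># B" using t'(1,2) 1 by (auto dest: mset_subset_eqD)
            then show ?thesis using common sw n by force
          qed (use 1 t'(3) in simp)
        next
          case a: 2
          have "size B' \<le> size B" "size A' \<le> size A" using t'(1,2) size_mset_mono by blast+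
          moreover have "size B' + size A' = size A + size B" using a 2 by (metis size_union)
          ultimately have "size B' = size B" "size A' = size A" by linarith+
          then have "B' = B" "A' = A" using t'(1,2) mset_subset_size subset_mset.le_imp_less_or_eq by (metis nat_neq_iff)+
          then show ?thesis using t'(3) by simp
        qed
      qed
      then have "z - {#w#} = {#B + image_mset neg A#}"
        using facs_remove[OF z(1) w] batom_facs_unique rest by simp
      then have "size z = 2" using w by (metis insert_DiffM size_add_mset size_single Suc_1 One_nat_def)
      then show ?thesis using z(2) by simp
    qed
  qed
  have len: "size z = size M" if z: "z \<in> facs (M + ?N)" "size z \<noteq> 2" for z
  proof -
    have "(\<Sum>u\<in>#z. size u) = (\<Sum>u\<in>#z. 2)" using pair[OF z] by (intro arg_cong[where f = sum_mset] image_mset_cong) auto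
    then have "size (M + ?N) = 2 * size z"
      using facs_sum[OF z(1)] by (simp add: size_sum_mset[symmetric])
    then show ?thesis by simp
  qed
  have "size M \<in> size ` facs (M + ?N)"
    by (rule image_eqI[OF _ facs_pairs]) (use nz in auto)
  then have "min_long (M + ?N) (size M)"
    unfolding min_long_def using len n by auto
  then show ?thesis using M N dalI by blast
qed

text \<open>The hypothesis says that a relation with coefficients bounded by twice the multiplicities of
  \<open>K\<close> has all its coefficients equal to zero or extremal; completing \<open>K\<close> by one prime to a zero-sum
  multiset then yields the criterion \<open>dal_symmetric\<close>.\<close>
lemma dal_quasi_independent:
  assumes n: "2 \<le> size K"
    and P: "\<And>A B p. A \<subseteq># K + K \<Longrightarrow> B \<subseteq># K + K \<Longrightarrow> sg A = sg B \<Longrightarrow>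
      count A p = count B p \<or> count A p = count B p + 2 * count K p \<or> count B p = count A p + 2 * count K p"
  shows "\<exists>U. batom U \<and> size U = Suc (size K) \<and> Suc (size K) \<in> dal"
proof -
  let ?q = "inv_prime K"
  let ?M = "add_mset ?q K"
  have KK: "A \<subseteq># K + K" if "A \<subseteq># K" for A
    using that by (simp add: subset_mset.add_increasing2)
  have form: "A \<subseteq># K \<or> (\<exists>A0. A = add_mset ?q A0 \<and> A0 \<subseteq># K)" if "A \<subseteq># ?M" for A
  proof (cases "A \<subseteq># K")
    case False
    then have "?q \<in># A" using that
      by (metis add_mset_add_single subset_eq_diff_conv diff_single_trivial)
    then obtain s where s: "A = add_mset ?q s" by (metis insert_DiffM)
    then show ?thesis using that by auto
  qed simp
  \<comment> \<open>Inside \<open>K\<close> two multiplicities differ by at most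
    \<open>count K p\<close>; a difference of twice that amount is possible only if it is
    zero.\<close>
  have same: "A = B" if "A \<subseteq># K" "B \<subseteq># K" "sg A = sg B" for A B
  proof (rule multiset_eqI)
    fix p
    have "count A p \<le> count K p" "count B p \<le> count K p" using that by (auto simp: subseteq_mset_def)
    then show "count A p = count B p" using P[OF KK KK, of A B p] that by linarith
  qed
  \<comment> \<open>The class of \<open>?q\<close> is the inverse of that of \<open>K\<close>, so
    \<open>A\<close> and \<open>B + K\<close> have equal class. This is why the hypothesis covers
    \<open>K + K\<close>. Each of its alternatives forces one of \<open>A\<close>, \<open>B\<close>
    to have multiplicity \<open>count K p\<close> and the other zero.\<close>
  have mixed: "add_mset ?q A + B = ?M" if A: "A \<subseteq># K" and B: "B \<subseteq># K" and s: "sg (add_mset ?q A) = sg B" for A B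
  proof -
    have "sg A = sg (B + K)"
      using s by simp (metis inv_solve_left sg_closed m_comm inv_closed)
    moreover have "B + K \<subseteq># K + K" using B by simp
    ultimately have c: "count A p = count (B + K) p \<or> count A p = count (B + K) p + 2 * count K p
       \<or> count (B + K) p = count A p + 2 * count K p" for p
      using P[OF KK[OF A]] by blast
    have "A + B = K"
    proof (rule multiset_eqI)
      fix p
      have "count A p \<le> count K p" "count B p \<le> count K p" using A B by (auto simp: subseteq_mset_def)
      then show "count (A + B) p = count K p" using c[of p] by auto
    qed
    then show ?thesis by simp
  qed
  have "A = B \<or> A + B = ?M" if A: "A \<subseteq># ?M" and B: "B \<subseteq># ?M" and sAB: "sg A = sg B" for A B
  proof -
    consider "A \<subseteq># K" "B \<subseteq># K"
      | A0 where "A = add_mset ?q A0" "A0 \<subseteq># K" "B \<subseteq># K"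
      | B0 where "B = add_mset ?q B0" "B0 \<subseteq># K" "A \<subseteq># K"
      | A0 B0 where "A = add_mset ?q A0" "A0 \<subseteq># K" "B = add_mset ?q B0" "B0 \<subseteq># K"
      using form[OF A] form[OF B] by blast
    then show ?thesis
    proof cases
      case 1 then show ?thesis using same sAB by blast
    next
      case 2 then show ?thesis using mixed sAB by blast
    next
      case 3 then show ?thesis using mixed[of B0 A] sAB by (simp add: add.commute)
    next
      case 4
      then have "sg A0 = sg B0" using sAB by simp
      then show ?thesis using same 4 by blast
    qed
  qed
  moreover have "3 \<le> size ?M" using n by simp
  ultimately have "batom ?M \<and> size ?M \<in> dal" using dal_symmetric[OF zs_add_inv_prime] by blast
  then show ?thesis by (metis size_add_mset)
qed

section \<open>Distances that no chain of smaller steps can bridge, and the distance two\<close>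

definition rel_degrees :: "nat set" where
  "rel_degrees = {d. 2 \<le> d \<and> (\<exists>m z z'. z \<in> facs m \<and> z' \<in> facs m \<and> z \<noteq> z' \<and> fdist z z' = d
     \<and> \<not> conn (d - 1) z z')}"

lemma dal_subset_rel_degrees: "dal \<subseteq> rel_degrees"
  using dal_not_conn dal_ge_3 unfolding rel_degrees_def by fastforce

text \<open>Different lengths force distance at least three. For equal lengths at most one factor on
  each side survives cancellation, and it is determined by the product.\<close>

lemma fdist_le_1_eq:
  assumes x: "x \<in> facs m" and y: "y \<in> facs m" and d: "fdist x y \<le> 1"
  shows "x = y"
proof -
  have sz: "size x = size y"
  proof (rule ccontr)
    assume "size x \<noteq> size y"
    then consider "size x < size y" | "size y < size x" by linarith
    then show False
      using fdist_ge_length_gap[OF x y] fdist_ge_length_gap[OF y x] d by cases (auto simp: fdist_commute)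
  qed
  define c x' y' where "c = x \<inter># y" and "x' = x - y" and "y' = y - x"
  have xy: "x = c + x'" "y = c + y'"
    by (auto simp: c_def x'_def y'_def multiset_eq_iff)
  have s: "\<Sum>\<^sub># x' = \<Sum>\<^sub># y'" using facs_sum[OF x] facs_sum[OF y] by (auto simp: xy)
  have le: "size x' \<le> 1" using d by (simp add: fdist_def x'_def)
  have sz': "size x' = size y'" using sz by (simp add: xy)
  show ?thesis
  proof (cases "size x' = 0")
    case True
    then show ?thesis using sz' by (simp add: xy)
  next
    case False
    then have "size x' = 1" "size y' = 1" using le sz' by linarith+
    then obtain u v where "x' = {#u#}" "y' = {#v#}" by (metis One_nat_def size_1_singleton_mset)
    then show ?thesis using s by (simp add: xy)
  qed
qed

lemma conn_1_eq: "conn 1 x y \<Longrightarrow> x = y"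
  by (induction rule: rtrancl_induct) (auto simp: chain_step_def dest: fdist_le_1_eq)

lemma two_in_rel_degreesI:
  assumes "z \<in> facs m" "z' \<in> facs m" "z \<noteq> z'" "fdist z z' \<le> 2"
  shows "2 \<in> rel_degrees"
proof -
  have "fdist z z' = 2" using assms fdist_le_1_eq by (metis One_nat_def Suc_1 le_SucE)
  moreover have "\<not> conn (2 - 1) z z'" using conn_1_eq assms(3) by auto
  ultimately show ?thesis unfolding rel_degrees_def using assms by blast
qed

text \<open>With \<open>p\<close> in the class of \<open>p1\<close>, \<open>p2\<close> together, the
  atom \<open>U\<close> times the pair \<open>{#p, neg p#}\<close> is also the merged atom times
  \<open>{#p1, p2, neg p#}\<close>. As \<open>U\<close> has at least four primes, it is neither of
  the latter two.\<close>

lemma two_in_rel_degrees_long: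
  assumes U: "batom U" "4 \<le> size U"
  shows "2 \<in> rel_degrees"
proof -
  have "2 \<le> size U" using U(2) by simp
  then obtain p1 p2 m where m: "U = m + {#p1, p2#}" by (rule two_le_sizeE)
  obtain p where p: "cls p = cls p1 \<otimes> cls p2" using cls_surj by (meson cls_closed m_closed)
  have "\<not> zs {#p1, p2#}"
  proof
    assume "zs {#p1, p2#}"
    then have "{#p1, p2#} = U" using batom_minimal[OF U(1), of "{#p1, p2#}"] by (simp add: m)
    then show False using U(2) by auto
  qed
  then have nzp: "cls p \<noteq> \<one>" by (simp add: zs_def p)
  have nz: "cls p1 \<noteq> \<one>" "cls p2 \<noteq> \<one>"
    using batom_no_unit[OF U(1) \<open>2 \<le> size U\<close>] by (auto simp: m)
  have pp: "batom {#p, neg p#}" using batom_pair[OF nzp] .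
  have W: "batom (add_mset p m)" using batom_merge[OF p] U(1) m by simp
  have T: "batom {#p1, p2, neg p#}"
    by (rule small_batom) (use nz nzp in \<open>auto simp: zs_def p m_assoc[symmetric]\<close>)
  have z: "{#U, {#p, neg p#}#} \<in> facs (U + {#p, neg p#})" using U pp by (auto simp: facs_def)
  have z': "{#add_mset p m, {#p1, p2, neg p#}#} \<in> facs (U + {#p, neg p#})"
    using W T by (auto simp: facs_def m)
  have "{#U, {#p, neg p#}#} \<noteq> {#add_mset p m, {#p1, p2, neg p#}#}"
  proof
    assume "{#U, {#p, neg p#}#} = {#add_mset p m, {#p1, p2, neg p#}#}"
    then have "U \<in># {#add_mset p m, {#p1, p2, neg p#}#}" by (metis union_single_eq_member)
    then have "size U = size (add_mset p m) \<or> size U = 3" by auto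
    then show False using U(2) by (simp add: m)
  qed
  moreover have "fdist {#U, {#p, neg p#}#} {#add_mset p m, {#p1, p2, neg p#}#} \<le> 2"
    using fdist_le_size[of "{#U, {#p, neg p#}#}" "{#add_mset p m, {#p1, p2, neg p#}#}"] by simp
  ultimately show ?thesis using two_in_rel_degreesI z z' by blast
qed

text \<open>The primes \<open>p\<close> and \<open>q\<close> of one class are exchanged between a
  pair and a triple. The conditions on \<open>h\<close> keep the trivial class out of the
  triple.\<close>

lemma two_in_rel_degrees_double:
  assumes pq: "p \<noteq> q" "cls p = cls q" "cls p \<noteq> \<one>"
    and h: "h \<in> carrier G" "h \<noteq> \<one>" "cls p \<otimes> h \<noteq> \<one>"
  shows "2 \<in> rel_degrees"
proof -
  obtain r where r: "cls r = h" using cls_surj h(1) by blast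
  define k where "k = inv_prime {#p, r#}"
  have k: "cls k = inv (cls p \<otimes> h)" using h(1) by (simp add: k_def r)
  have nk: "cls k \<noteq> \<one>" using h by (simp add: k)
  have T: "batom {#x, r, k#}" if "cls x = cls p" for x
    by (rule small_batom) (use that pq h nk r in \<open>auto simp: zs_def k m_assoc[symmetric]\<close>)
  have P: "batom {#x, neg p#}" if "cls x = cls p" for x
    by (rule small_batom) (use that pq in \<open>auto simp: zs_def\<close>)
  let ?z = "{#{#p, neg p#}, {#q, r, k#}#}" and ?z' = "{#{#q, neg p#}, {#p, r, k#}#}"
  let ?m = "{#p, neg p, q, r, k#}"
  have "?z \<in> facs ?m" "?z' \<in> facs ?m"
    using T[of p] T[of q] P[of p] P[of q] pq by (auto simp: facs_def add_mset_commute)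
  moreover have "?z \<noteq> ?z'"
  proof
    assume "?z = ?z'"
    then have "{#p, neg p#} \<in># ?z'" by (metis union_single_eq_member)
    then have "{#p, neg p#} = {#q, neg p#} \<or> {#p, neg p#} = {#p, r, k#}" by auto
    then show False using pq(1) by (auto dest: arg_cong[of _ _ size])
  qed
  moreover have "fdist ?z ?z' \<le> 2" using fdist_le_size[of ?z ?z'] by simp
  ultimately show ?thesis using two_in_rel_degreesI by blast
qed

text \<open>A greedy choice: \<open>p\<close> must avoid the finitely many quotients of products over \<open>K + K\<close>,
  and so must its square unless it is trivial.\<close>
lemma infinite_quasi_independent:
  assumes inf: "infinite (carrier G)"
  shows "\<exists>K. size K = t \<and> (\<forall>A B p. A \<subseteq># K + K \<longrightarrow> B \<subseteq># K + K \<longrightarrow> sg A = sg B \<longrightarrow>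
      count A p = count B p \<or> count A p = count B p + 2 * count K p \<or> count B p = count A p + 2 * count K p)"
proof (induction t)
  case 0
  show ?case by (rule exI[of _ "{#}"]) auto
next
  case (Suc t)
  then obtain K where K: "size K = t" and P: "\<And>A B p. A \<subseteq># K + K \<Longrightarrow> B \<subseteq># K + K \<Longrightarrow> sg A = sg B \<Longrightarrow>
      count A p = count B p \<or> count A p = count B p + 2 * count K p \<or> count B p = count A p + 2 * count K p"
    by blast
  have fin: "finite {A. A \<subseteq># K + K}"
  proof (rule finite_subset)
    let ?s = "set_mset K" 
    show "{A. A \<subseteq># K + K} \<subseteq> (\<Union>n\<le>size (K + K). {A. set_mset A \<subseteq> ?s \<and> size A = n})"
      using set_mset_mono[of _ "K + K"] size_mset_mono[of _ "K + K"] by fastforce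
    have "finite {A. set_mset A \<subseteq> ?s \<and> size A = n}" for n
    proof -
      have "{A. set_mset A \<subseteq> ?s \<and> size A = n} \<subseteq> mset ` {xs. set xs \<subseteq> ?s \<and> length xs = n}"
      proof
        fix A assume "A \<in> {A. set_mset A \<subseteq> ?s \<and> size A = n}"
        moreover obtain xs where "A = mset xs" using ex_mset by metis
        ultimately show "A \<in> mset ` {xs. set xs \<subseteq> ?s \<and> length xs = n}" by auto
      qed
      then show ?thesis using finite_lists_length_eq[of ?s n] finite_surj by blast
    qed
    then show "finite (\<Union>n\<le>size (K + K). {A. set_mset A \<subseteq> ?s \<and> size A = n})" by blast
  qed
  define S where "S = {sg A \<otimes> inv (sg B) | A B. A \<subseteq># K + K \<and> B \<subseteq># K + K}"
  have "S = (\<lambda>(A, B). sg A \<otimes> inv (sg B)) ` ({A. A \<subseteq># K + K} \<times> {A. A \<subseteq># K + K})"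
    by (auto simp: S_def)
  then have finS: "finite S" using fin by simp
  have S_I: "sg A \<otimes> inv (sg B) \<in> S" if "A \<subseteq># K + K" "B \<subseteq># K + K" for A B
    using that unfolding S_def by blast
  \<comment> \<open>If infinitely many elements have trivial square, one of them avoids
    \<open>S\<close>. Otherwise squaring has finite fibres, being cosets of its finite kernel, so
    only finitely many squares fall into \<open>S\<close>.\<close>
  obtain g where g: "g \<in> carrier G" "g \<notin> S" "g \<otimes> g = \<one> \<or> g \<otimes> g \<notin> S"
  proof (cases "infinite {g \<in> carrier G. g \<otimes> g = \<one>}")
    case True
    then have "infinite ({g \<in> carrier G. g \<otimes> g = \<one>} - S)" using finS by simp
    then obtain g where "g \<in> {g \<in> carrier G. g \<otimes> g = \<one>} - S" using infinite_imp_nonempty by blast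
    then show ?thesis using that by blast
  next
    case False
    have "finite {g \<in> carrier G. g \<otimes> g = s}" for s
    proof (cases "\<exists>g0\<in>carrier G. g0 \<otimes> g0 = s")
      case True
      then obtain g0 where g0: "g0 \<in> carrier G" "g0 \<otimes> g0 = s" by blast
      have "{g \<in> carrier G. g \<otimes> g = s} \<subseteq> (\<lambda>g. g0 \<otimes> g) ` {g \<in> carrier G. g \<otimes> g = \<one>}"
      proof
        fix g assume "g \<in> {g \<in> carrier G. g \<otimes> g = s}"
        then have g: "g \<in> carrier G" "g \<otimes> g = g0 \<otimes> g0" using g0 by auto
        have "(inv g0 \<otimes> g) \<otimes> (inv g0 \<otimes> g) = (inv g0 \<otimes> inv g0) \<otimes> (g \<otimes> g)"
          using g(1) g0(1) by (simp add: m_ac)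
        also have "\<dots> = inv (g0 \<otimes> g0) \<otimes> (g0 \<otimes> g0)" using g(2) g0(1) by (simp add: inv_mult)
        also have "\<dots> = \<one>" using g0(1) by (simp only: l_inv m_closed)
        finally have "inv g0 \<otimes> g \<in> {g \<in> carrier G. g \<otimes> g = \<one>}" using g g0 by simp
        moreover have "g = g0 \<otimes> (inv g0 \<otimes> g)" using g g0 by (simp add: m_assoc[symmetric])
        ultimately show "g \<in> (\<lambda>g. g0 \<otimes> g) ` {g \<in> carrier G. g \<otimes> g = \<one>}" by blast
      qed
      then show ?thesis using False finite_surj by blast
    next
      case False
      then have "{g \<in> carrier G. g \<otimes> g = s} = {}" by auto
      then show ?thesis by (metis finite.emptyI)
    qed
    then have "finite (\<Union>s\<in>S. {g \<in> carrier G. g \<otimes> g = s})" using finS by blast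
    then have "infinite (carrier G - (S \<union> (\<Union>s\<in>S. {g \<in> carrier G. g \<otimes> g = s})))"
      using inf finS by simp
    then obtain g where "g \<in> carrier G - (S \<union> (\<Union>s\<in>S. {g \<in> carrier G. g \<otimes> g = s}))"
      using infinite_imp_nonempty by blast
    then show ?thesis using that by blast
  qed
  obtain p where p: "cls p = g" using cls_surj g(1) by blast
  have notin: "p \<notin># K"
  proof
    assume "p \<in># K"
    then have "{#p#} \<subseteq># K + K" by simp
    then have "sg {#p#} \<otimes> inv (sg {#}) \<in> S" using S_I[of "{#p#}" "{#}"] by simp
    then show False using g(1,2) p by simp
  qed
  have sgr: "sg (replicate_mset n p) = g [^] n" for n
    by (induction n) (use g p in \<open>auto simp: m_comm\<close>)
  have main: "count A x = count B x \<or> count A x = count B x + 2 * count (add_mset p K) x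
      \<or> count B x = count A x + 2 * count (add_mset p K) x"
    if AB: "A \<subseteq># add_mset p K + add_mset p K" "B \<subseteq># add_mset p K + add_mset p K" "sg A = sg B"
      and le: "count B p \<le> count A p" for A B x
  proof -
    \<comment> \<open>Separating the new prime turns the relation into an equation for
      \<open>g [^] d\<close> with \<open>d\<close> at most two, whose solution is a quotient from
      \<open>S\<close>.\<close>
    define A0 B0 d where "A0 = filter_mset (\<lambda>x. x \<noteq> p) A" and "B0 = filter_mset (\<lambda>x. x \<noteq> p) B"
      and "d = count A p - count B p"
    have dec: "C = filter_mset (\<lambda>x. x \<noteq> p) C + replicate_mset (count C p) p" for C
      by (rule multiset_eqI) auto
    have cnt: "count C x \<le> 2 * count K x + (if x = p then 2 else 0)"
      if "C \<subseteq># add_mset p K + add_mset p K" for C x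
      using mset_subset_eq_count[OF that, of x] by (cases "x = p") simp_all
    have sub: "filter_mset (\<lambda>x. x \<noteq> p) C \<subseteq># K + K"
      if "C \<subseteq># add_mset p K + add_mset p K" for C
      unfolding subseteq_mset_def
    proof
      show "count (filter_mset (\<lambda>x. x \<noteq> p) C) x \<le> count (K + K) x" for x
        using cnt[OF that, of x] by (cases "x = p") simp_all
    qed
    have A0: "A0 \<subseteq># K + K" and B0: "B0 \<subseteq># K + K"
      using sub AB by (auto simp: A0_def B0_def)
    have kp: "count K p = 0" using notin by (simp add: not_in_iff)
    have d2: "d \<le> 2" using cnt[OF AB(1), of p] by (simp add: d_def kp)
    have "sg A = sg A0 \<otimes> g [^] count A p" using dec[of A] sg_union sgr unfolding A0_def by metis
    also have "\<dots> = sg A0 \<otimes> g [^] d \<otimes> g [^] count B p"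
      using le g by (simp add: d_def m_assoc nat_pow_mult)
    finally have "sg A0 \<otimes> g [^] d \<otimes> g [^] count B p = sg B0 \<otimes> g [^] count B p"
      using dec[of B] sg_union sgr AB(3) unfolding B0_def by metis
    then have eq: "sg A0 \<otimes> g [^] d = sg B0" using g by simp
    then have gd: "g [^] d = sg B0 \<otimes> inv (sg A0)" using g by (metis inv_solve_right' m_comm nat_pow_closed sg_closed)
    then have gS: "g [^] d \<in> S" using S_I[OF B0 A0] by simp
    \<comment> \<open>The value one would put \<open>g\<close> into \<open>S\<close>. The value two
      is twice the multiplicity of \<open>p\<close>, so extremal, and it forces the square of
      \<open>g\<close> to be trivial; in both cases \<open>A0\<close> and \<open>B0\<close> have
      equal class.\<close>
    have d02: "d = 0 \<or> d = 2"
    proof (rule ccontr)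
      assume "\<not> (d = 0 \<or> d = 2)"
      then have "d = 1" using d2 by auto
      then show False using gS g by simp
    qed
    then have "g [^] d = \<one>"
    proof
      assume "d = 2"
      then have "g [^] d = g \<otimes> g" using g by (simp add: numeral_2_eq_2)
      then show ?thesis using g(3) gS by auto
    qed simp
    then have "sg A0 = sg B0" using eq g by simp
    from P[OF A0 B0 this, of x] show ?thesis
      using d02 le by (cases "x = p") (auto simp: A0_def B0_def d_def kp)
  qed
  have "\<forall>A B x. A \<subseteq># add_mset p K + add_mset p K \<longrightarrow> B \<subseteq># add_mset p K + add_mset p K \<longrightarrow> sg A = sg B \<longrightarrow>
      count A x = count B x \<or> count A x = count B x + 2 * count (add_mset p K) x
      \<or> count B x = count A x + 2 * count (add_mset p K) x"
  proof (intro allI impI)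
    fix A B x
    assume "A \<subseteq># add_mset p K + add_mset p K" "B \<subseteq># add_mset p K + add_mset p K" "sg A = sg B"
    then show "count A x = count B x \<or> count A x = count B x + 2 * count (add_mset p K) x
      \<or> count B x = count A x + 2 * count (add_mset p K) x"
      using main[of A B x] main[of B A x] by (metis nat_le_linear)
  qed
  moreover have "size (add_mset p K) = Suc t" using K by simp
  ultimately show ?case by blast
qed

lemma dal_infinite:
  assumes "infinite (carrier G)" "3 \<le> n" shows "n \<in> dal" "\<exists>U. batom U \<and> size U = n"
proof -
  have n: "Suc (n - 1) = n" using assms(2) by simp
  obtain K where K: "size K = n - 1" and P: "\<And>A B p. A \<subseteq># K + K \<Longrightarrow> B \<subseteq># K + K \<Longrightarrow> sg A = sg B \<Longrightarrow>
      count A p = count B p \<or> count A p = count B p + 2 * count K p \<or> count B p = count A p + 2 * count K p"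
    using infinite_quasi_independent[OF assms(1), of "n - 1"] by blast
  have "2 \<le> size K" using K assms(2) by simp
  from dal_quasi_independent[OF this P] show "n \<in> dal" "\<exists>U. batom U \<and> size U = n"
    unfolding K n by blast+
qed

lemma rel_degrees_infinite:
  assumes "infinite (carrier G)" shows "rel_degrees = {d. 2 \<le> d}"
proof
  show "rel_degrees \<subseteq> {d. 2 \<le> d}" by (auto simp: rel_degrees_def)
  have "2 \<in> rel_degrees" using dal_infinite(2)[OF assms, of 4] two_in_rel_degrees_long by auto
  moreover have "d \<in> rel_degrees" if "3 \<le> d" for d
    using dal_infinite(1)[OF assms that] dal_subset_rel_degrees by blast
  ultimately show "{d. 2 \<le> d} \<subseteq> rel_degrees"
    by (metis (no_types, lifting) Suc_1 eval_nat_numeral(3) le_SucE le_antisym mem_Collect_eq not_less_eq_eq subsetI)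
qed

text \<open>The functions \<open>f i\<close> act as coordinates modulo \<open>n i\<close>, and the
  primes \<open>p i\<close> as a basis. Multiplicities \<open>n i div 2\<close> are the largest for
  which relations over \<open>K + K\<close> stay within one period in each coordinate.\<close>

lemma dal_coordinates:
  fixes r :: nat and n :: "nat \<Rightarrow> nat" and f :: "nat \<Rightarrow> 'g \<Rightarrow> int" and p :: "nat \<Rightarrow> 'p"
  assumes n: "\<And>i. i < r \<Longrightarrow> 1 < n i"
    and hom: "\<And>i x y. i < r \<Longrightarrow> x \<in> carrier G \<Longrightarrow> y \<in> carrier G \<Longrightarrow> f i (x \<otimes> y) = (f i x + f i y) mod int (n i)"
    and unit: "\<And>i j. i < r \<Longrightarrow> j < r \<Longrightarrow> f i (cls (p j)) = (if i = j then 1 else 0)"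
    and two: "2 \<le> (\<Sum>i<r. n i div 2)"
  shows "Suc (\<Sum>i<r. n i div 2) \<in> dal"
proof -
  define K where "K = (\<Sum>i<r. replicate_mset (n i div 2) (p i))"
  have inj: "p i = p j \<longleftrightarrow> i = j" if "i < r" "j < r" for i j
    using unit[OF that] unit[OF that(1) that(1)] by (auto split: if_splits)
  have size: "size K = (\<Sum>i<r. n i div 2)" by (simp add: K_def size_multiset_sum)
  have cK: "count K (p i) = n i div 2" if "i < r" for i
  proof -
    have "count K (p i) = (\<Sum>j<r. if j = i then n i div 2 else 0)"
      unfolding K_def count_sum by (rule sum.cong) (use inj that in auto)
    then show ?thesis using that by simp
  qed
  have setK: "set_mset K \<subseteq> p ` {..<r}"
  proof -
    have "q \<in> p ` {..<r}" if "0 < count K q" for q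
    proof (rule ccontr)
      assume "q \<notin> p ` {..<r}"
      then have "count K q = 0" unfolding K_def count_sum by (auto intro!: sum.neutral)
      then show False using that by simp
    qed
    then show ?thesis by auto
  qed
  have f1: "f i \<one> mod int (n i) = 0" if "i < r" for i
  proof -
    have "f i \<one> = (f i \<one> + f i \<one>) mod int (n i)" using hom[OF that, of \<one> \<one>] by simp
    then have "(f i \<one>) mod int (n i) = (f i \<one> + f i \<one>) mod int (n i)" by (metis mod_mod_trivial)
    then have "int (n i) dvd f i \<one>" by (simp add: mod_eq_dvd_iff)
    then show ?thesis by simp
  qed
  have count_mod: "f i (sg A) mod int (n i) = int (count A (p i)) mod int (n i)"
    if "set_mset A \<subseteq> p ` {..<r}" "i < r" for A i
    using that(1)
  proof (induction A)
    case empty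
    then show ?case using f1 that(2) by simp
  next
    case (add q A)
    then obtain j where j: "j < r" "q = p j" by auto
    have IH: "f i (sg A) mod int (n i) = int (count A (p i)) mod int (n i)" using add by simp
    have "f i (sg (add_mset q A)) mod int (n i) = (f i (cls q) + f i (sg A)) mod int (n i)"
      by (simp add: hom[OF that(2)])
    also have "\<dots> = (f i (cls q) + int (count A (p i))) mod int (n i)"
      using IH by (metis mod_add_right_eq)
    also have "f i (cls q) + int (count A (p i)) = int (count (add_mset q A) (p i))"
      using unit[OF that(2) j(1)] inj[OF that(2) j(1)] j by auto
    finally show ?case .
  qed
  have "count A q = count B q \<or> count A q = count B q + 2 * count K q \<or> count B q = count A q + 2 * count K q"
    if AB: "A \<subseteq># K + K" "B \<subseteq># K + K" "sg A = sg B" for A B q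
  proof (cases "q \<in># K")
    case False
    then have "count A q = 0" "count B q = 0" using AB(1,2)
      by (auto simp: subseteq_mset_def not_in_iff dest!: spec[of _ q])
    then show ?thesis by simp
  next
    case True
    then obtain i where i: "i < r" "q = p i" using setK by auto
    have sets: "set_mset A \<subseteq> p ` {..<r}" "set_mset B \<subseteq> p ` {..<r}"
      using order_trans[OF set_mset_mono[OF AB(1)]] order_trans[OF set_mset_mono[OF AB(2)]] setK by simp_all
    have le: "count A q \<le> 2 * (n i div 2)" "count B q \<le> 2 * (n i div 2)"
      using AB(1,2) cK[OF i(1)] i(2) by (auto simp: subseteq_mset_def dest!: spec[of _ q])
    have "int (count A q) mod int (n i) = int (count B q) mod int (n i)"
      using count_mod[OF sets(1) i(1)] count_mod[OF sets(2) i(1)] AB(3) i(2) by simp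
    then obtain k where k: "int (count A q) - int (count B q) = int (n i) * k"
      by (metis mod_eq_dvd_iff dvdE)
    \<comment> \<open>The difference of multiplicities is a multiple of \<open>n i\<close> of
      absolute value at most \<open>n i\<close>. If it is not zero, \<open>n i\<close> must be even,
      and the difference is the extremal one.\<close>
    have n2: "2 * (n i div 2) \<le> n i" by simp
    have ni: "int (n i) > 0" using n[OF i(1)] by simp
    have "int (n i) * k \<le> int (n i) * 1" "int (n i) * (-1) \<le> int (n i) * k"
      using k le n2 by linarith+
    then have "k \<le> 1" "-1 \<le> k" using ni by (simp_all only: mult_le_cancel_left_pos)
    then consider "k = 0" | "k = 1" | "k = -1" by linarith
    then show ?thesis
    proof cases
      case 1 then show ?thesis using k by simp
    next
      case 2
      then have "int (count A q) = int (count B q + n i)" using k by simp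
      then have c: "count A q = count B q + n i" by (simp only: of_nat_eq_iff)
      then have "2 * (n i div 2) = n i" using le n2 by linarith
      then show ?thesis using c cK[OF i(1)] i(2) by simp
    next
      case 3
      then have "int (count B q) = int (count A q + n i)" using k by simp
      then have c: "count B q = count A q + n i" by (simp only: of_nat_eq_iff)
      then have "2 * (n i div 2) = n i" using le n2 by linarith
      then show ?thesis using c cK[OF i(1)] i(2) by simp
    qed
  qed
  note P = this
  have "2 \<le> size K" using two size by simp
  from dal_quasi_independent[OF this P] show ?thesis unfolding size by blast
qed

end

section \<open>Invariant factors of finite abelian groups\<close>

context comm_group
begin

text \<open>A power of \<open>u \<otimes> v\<close> that is trivial becomes a trivial power of
  \<open>u\<close> after raising it to \<open>ord v\<close>; coprimality then removes the factor
  \<open>ord v\<close>.\<close>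

lemma ord_mult_coprime:
  assumes x: "x \<in> carrier G" and y: "y \<in> carrier G" and c: "coprime (ord x) (ord y)"
  shows "ord (x \<otimes> y) = ord x * ord y"
proof (rule dvd_antisym)
  show "ord (x \<otimes> y) dvd ord x * ord y" using abelian_ord_mul_divides x y .
  have *: "ord u dvd ord (u \<otimes> v)" if u: "u \<in> carrier G" and v: "v \<in> carrier G" and c: "coprime (ord u) (ord v)" for u v
  proof -
    let ?n = "ord (u \<otimes> v)"
    have "(u \<otimes> v) [^] (?n * ord v) = \<one>" using u v by (simp add: pow_eq_id)
    then have "u [^] (?n * ord v) \<otimes> v [^] (?n * ord v) = \<one>" using u v by (simp add: pow_mult_distrib m_comm)
    moreover have "v [^] (?n * ord v) = \<one>" using v by (simp add: pow_eq_id)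
    ultimately have "u [^] (?n * ord v) = \<one>" using u by simp
    then have "ord u dvd ?n * ord v" using u by (simp add: pow_eq_id)
    then show ?thesis using c by (simp add: coprime_dvd_mult_left_iff)
  qed
  show "ord x * ord y dvd ord (x \<otimes> y)"
    using *[OF x y c] *[OF y x] c x y by (intro divides_mult) (auto simp: m_comm coprime_commute)
qed

text \<open>An element \<open>e\<close> of largest order works. If a prime \<open>p\<close> occurred
  to a higher power in \<open>ord x\<close>, the part of \<open>e\<close> of order prime to
  \<open>p\<close>, times the part of \<open>x\<close> of \<open>p\<close>-power order, would have
  larger order than \<open>e\<close>.\<close>

lemma ex_exponent_element:
  assumes K: "subgroup K G" "finite K"
  shows "\<exists>e\<in>K. 0 < ord e \<and> (\<forall>x\<in>K. ord x dvd ord e)"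
proof -
  have Kc: "x \<in> carrier G" if "x \<in> K" for x using subgroup.mem_carrier[OF K(1)] that .
  have pow: "x [^] (n::nat) \<in> K" if "x \<in> K" for x n
    using K(1) that by (induction n) (auto simp: subgroup.one_closed subgroup.m_closed)
  have pos: "0 < ord x" if x: "x \<in> K" for x
  proof (rule ccontr)
    assume "\<not> 0 < ord x"
    then have "x [^] n \<noteq> \<one>" if "n \<noteq> 0" for n :: nat using that Kc[OF x] ord_eq_0 by auto
    then have "inj (\<lambda>n::nat. x [^] n)"
      unfolding inj_def by (metis Kc[OF x] diff_is_0_eq pow_eq_div2 le_antisym)
    moreover have "range (\<lambda>n::nat. x [^] n) \<subseteq> K" using pow[OF x] by auto
    ultimately show False using K(2) finite_subset finite_imageD infinite_UNIV_nat by metis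
  qed
  have "K \<noteq> {}" using K(1) subgroup.one_closed by blast
  then have "Max (ord ` K) \<in> ord ` K" using K(2) by (intro Max_in) auto
  then obtain e where e: "e \<in> K" and "ord e = Max (ord ` K)" by auto
  then have max: "\<And>x. x \<in> K \<Longrightarrow> ord x \<le> ord e" using K(2) by simp
  have "ord x dvd ord e" if x: "x \<in> K" for x
  proof (rule ccontr)
    assume "\<not> ord x dvd ord e"
    then obtain p where p: "Factorial_Ring.prime p" "multiplicity p (ord e) < multiplicity p (ord x)"
      using multiplicity_le_imp_dvd[of "ord x" "ord e"] pos[OF x] by (metis not_le gr_implies_not0)
    let ?a = "multiplicity p (ord e)" and ?b = "multiplicity p (ord x)"
    have pp: "0 < p" "1 < p" using p(1) prime_gt_0_nat prime_gt_1_nat by auto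
    have da: "p ^ ?a dvd ord e" and db: "p ^ ?b dvd ord x" by (rule multiplicity_dvd)+
    define k where "k = ord x div p ^ ?b"
    have k: "ord x = k * p ^ ?b" using db by (simp add: k_def)
    then have "k \<noteq> 0" using pos[OF x] by (metis less_irrefl mult_0)
    have o1: "ord (e [^] (p ^ ?a)) = ord e div p ^ ?a" using ord_pow[OF Kc[OF e] da] pp by simp
    have o2: "ord (x [^] k) = p ^ ?b" 
      using ord_pow[OF Kc[OF x], of k] k \<open>k \<noteq> 0\<close> by (metis dvd_triv_left nonzero_mult_div_cancel_left)
    have "\<not> p dvd ord e div p ^ ?a"
    proof -
      obtain c where c: "ord e = p ^ ?a * c" "\<not> p dvd c"
        using multiplicity_decompose'[of "ord e" p] pos[OF e] pp(2) by auto
      have "ord e div p ^ ?a = p ^ ?a * c div p ^ ?a"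
        by (rule arg_cong[OF c(1), of "\<lambda>t. t div p ^ ?a"])
      also have "\<dots> = c" using pp(1) by simp
      finally have "ord e div p ^ ?a = c" .
      then show ?thesis using c(2) by simp
    qed
    then have "coprime (p ^ ?b) (ord e div p ^ ?a)"
      using p(1) by (simp add: prime_imp_coprime)
    then have "ord (e [^] (p ^ ?a) \<otimes> x [^] k) = (ord e div p ^ ?a) * p ^ ?b"
      using ord_mult_coprime[of "e [^] (p ^ ?a)" "x [^] k"] o1 o2 Kc e x by (simp add: coprime_commute)
    moreover have "e [^] (p ^ ?a) \<otimes> x [^] k \<in> K" using pow e x subgroup.m_closed[OF K(1)] by blast
    ultimately have "(ord e div p ^ ?a) * p ^ ?b \<le> ord e" using max by metis
    moreover have "ord e = (ord e div p ^ ?a) * p ^ ?a" using da by simp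
    moreover have "0 < ord e div p ^ ?a" using da pos[OF e] pp by (simp add: div_greater_zero_iff dvd_imp_le)
    ultimately have "p ^ ?b \<le> p ^ ?a" by (metis mult_le_cancel1)
    then have "?b \<le> ?a" by (rule power_le_imp_le_exp[OF pp(2)])
    then show False using p(2) by linarith
  qed
  then show ?thesis using e pos by blast
qed

lemma span_subgroup:
  assumes L: "subgroup L G" and y: "y \<in> carrier G"
  shows "subgroup {l \<otimes> y [^] j | l (j::int). l \<in> L} G"
proof -
  have Lc: "x \<in> carrier G" if "x \<in> L" for x using subgroup.mem_carrier[OF L] that .
  show ?thesis
  proof (rule subgroupI)
    show "{l \<otimes> y [^] j | l (j::int). l \<in> L} \<subseteq> carrier G" using Lc y by auto
    show "{l \<otimes> y [^] j | l (j::int). l \<in> L} \<noteq> {}" using subgroup.one_closed[OF L] by blast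
  next
    fix a assume "a \<in> {l \<otimes> y [^] j | l (j::int). l \<in> L}"
    then obtain l and j :: int where a: "l \<in> L" "a = l \<otimes> y [^] j" by blast
    have "inv a = inv l \<otimes> y [^] (- j)" using a Lc y by (simp add: inv_mult int_pow_neg)
    then show "inv a \<in> {l \<otimes> y [^] j | l (j::int). l \<in> L}" using subgroup.m_inv_closed[OF L a(1)] by blast
  next
    fix a b assume "a \<in> {l \<otimes> y [^] j | l (j::int). l \<in> L}" "b \<in> {l \<otimes> y [^] j | l (j::int). l \<in> L}"
    then obtain l l' and j j' :: int where ab: "l \<in> L" "a = l \<otimes> y [^] j" "l' \<in> L" "b = l' \<otimes> y [^] j'" by blast
    have "a \<otimes> b = (l \<otimes> l') \<otimes> y [^] (j + j')" using ab Lc y by (simp add: int_pow_mult m_ac)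
    then show "a \<otimes> b \<in> {l \<otimes> y [^] j | l (j::int). l \<in> L}" using subgroup.m_closed[OF L ab(1,3)] by blast
  qed
qed

text \<open>By a Bezout identity \<open>y\<close> is a product of powers of the two given
  powers.\<close>

lemma coprime_powers_mem:
  fixes a b :: int
  assumes T: "subgroup T G" and y: "y \<in> carrier G" and ab: "y [^] a \<in> T" "y [^] b \<in> T" and c: "coprime a b"
  shows "y \<in> T"
proof -
  obtain u v where uv: "u * a + v * b = 1" using c bezout_int[of a b] by auto
  have pow: "t [^] (k::int) \<in> T" if "t \<in> T" for t k using subgroup_int_pow_closed[OF T that] .
  have "y = y [^] (a * u + b * v)" using uv y by (simp add: mult.commute)
  also have "\<dots> = (y [^] a) [^] u \<otimes> (y [^] b) [^] v" using y by (simp add: int_pow_mult int_pow_pow)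
  also have "\<dots> \<in> T" using subgroup.m_closed[OF T pow[OF ab(1)] pow[OF ab(2)]] .
  finally show ?thesis .
qed

text \<open>A maximal subgroup meeting the powers of an element of maximal order trivially is a complement.\<close>
lemma ex_complement:
  assumes K: "subgroup K G" "finite K" and e: "e \<in> K" "0 < ord e" "\<And>x. x \<in> K \<Longrightarrow> ord x dvd ord e"
  shows "\<exists>L. subgroup L G \<and> L \<subseteq> K \<and> (\<forall>i::int. e [^] i \<in> L \<longrightarrow> e [^] i = \<one>)
    \<and> (\<forall>x\<in>K. \<exists>l\<in>L. \<exists>i::int. x = l \<otimes> e [^] i)"
proof -
  have Kc: "x \<in> carrier G" if "x \<in> K" for x using subgroup.mem_carrier[OF K(1)] that .
  define P where "P L \<longleftrightarrow> subgroup L G \<and> L \<subseteq> K \<and> (\<forall>i::int. e [^] i \<in> L \<longrightarrow> e [^] i = \<one>)" for L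
  have "P {\<one>}" using triv_subgroup subgroup.one_closed[OF K(1)] by (auto simp: P_def)
  moreover have "finite {L. P L}" using K(2) by (auto intro: finite_subset[of _ "Pow K"] simp: P_def)
  ultimately obtain L where L: "P L" and max: "\<And>L'. P L' \<Longrightarrow> L \<subseteq> L' \<Longrightarrow> L' = L"
    using finite_has_maximal[of "{L. P L}"] by blast
  have LG: "subgroup L G" and LK: "L \<subseteq> K" and Le: "\<And>i::int. e [^] i \<in> L \<Longrightarrow> e [^] i = \<one>"
    using L by (auto simp: P_def)
  define T where "T = {l \<otimes> e [^] j | l (j::int). l \<in> L}"
  have T: "subgroup T G" unfolding T_def using span_subgroup[OF LG Kc[OF e(1)]] .
  have ec: "e \<in> carrier G" using Kc e(1) .
  have Lc: "x \<in> carrier G" if "x \<in> L" for x using Kc LK that by blast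
  have self_span: "L \<subseteq> {l \<otimes> y [^] j | l (j::int). l \<in> L}" for y
  proof
    fix x assume x: "x \<in> L"
    then have "x = x \<otimes> y [^] (0::int)" using Lc by simp
    then show "x \<in> {l \<otimes> y [^] j | l (j::int). l \<in> L}" using x by blast
  qed
  then have LT: "L \<subseteq> T" unfolding T_def .
  have eT: "e [^] (i::int) \<in> T" for i unfolding T_def using subgroup.one_closed[OF LG] ec by force
  have powK: "x [^] (n::int) \<in> K" if "x \<in> K" for x n using subgroup_int_pow_closed[OF K(1) that] .
  have "x \<in> T" if x: "x \<in> K" for x
  proof (rule ccontr)
    assume xT: "x \<notin> T"
    have "\<exists>m>0. x [^] (m::nat) \<in> T"
      using Kc[OF x] subgroup.one_closed[OF T] e(2) e(3)[OF x] by (metis pow_eq_id)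
    define m where "m = (LEAST m. 0 < m \<and> x [^] (m::nat) \<in> T)"
    have m: "0 < m" "x [^] m \<in> T"
      using LeastI_ex[OF \<open>\<exists>m>0. x [^] (m::nat) \<in> T\<close>] by (auto simp: m_def)
    have "m \<noteq> 1" using m(2) xT Kc[OF x] by auto
    then obtain p where p: "Factorial_Ring.prime p" "p dvd m" using prime_factor_nat by blast
    \<comment> \<open>By minimality of \<open>m\<close>, the element \<open>y0\<close> is outside
      \<open>T\<close>, while its power with the prime exponent \<open>p\<close> is inside.\<close>
    define y0 where "y0 = x [^] (m div p)"
    have y0K: "y0 \<in> K" using powK[OF x, of "int (m div p)"] by (simp add: y0_def int_pow_int)
    have y0c: "y0 \<in> carrier G" using Kc y0K .
    have y0T: "y0 \<notin> T"
    proof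
      assume "y0 \<in> T"
      moreover have "0 < m div p"
        using p m(1) by (simp add: div_greater_zero_iff dvd_imp_le prime_gt_0_nat)
      ultimately have "m \<le> m div p" unfolding m_def y0_def by (simp add: Least_le)
      then show False using m(1) prime_gt_1_nat[OF p(1)] by (metis div_less_dividend leD)
    qed
    have "y0 [^] p = x [^] m" using p(2) Kc[OF x] by (simp add: y0_def nat_pow_pow)
    then have y0p: "y0 [^] int p \<in> T" using m(2) by (simp add: int_pow_int)
    have y0n: "y0 [^] int (ord e) = \<one>" using e(3)[OF y0K] y0c by (simp add: int_pow_eq_id)
    \<comment> \<open>Otherwise \<open>p\<close> and \<open>ord e\<close> are coprime exponents that
      both send \<open>y0\<close> into \<open>T\<close>.\<close>
    have "p dvd ord e"
    proof (rule ccontr)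
      assume "\<not> p dvd ord e"
      then have "coprime (int p) (int (ord e))" using p(1) by (simp add: prime_imp_coprime)
      then show False using coprime_powers_mem[OF T y0c y0p] y0n subgroup.one_closed[OF T] y0T by metis
    qed
    then obtain n' where n': "ord e = p * n'" by (auto elim: dvdE)
    obtain l and k :: int where lk: "l \<in> L" "y0 [^] int p = l \<otimes> e [^] k" using y0p unfolding T_def by blast
    \<comment> \<open>The exponent \<open>n' * p\<close> annihilates \<open>y0\<close>, so a power
      of \<open>e\<close> with exponent \<open>k * int n'\<close> lies in \<open>L\<close> and is
      trivial. This shows that \<open>p\<close> divides \<open>k\<close>.\<close>
    have "\<one> = (y0 [^] int p) [^] int n'" using y0n y0c by (simp add: int_pow_pow n')
    also have "\<dots> = l [^] int n' \<otimes> e [^] (k * int n')"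
      unfolding lk(2) using Lc[OF lk(1)] ec by (simp add: int_pow_distrib int_pow_pow)
    finally have "e [^] (k * int n') = inv (l [^] int n')"
      using Lc[OF lk(1)] ec by (metis inv_equality inv_inv int_pow_closed m_comm inv_closed)
    also have "\<dots> \<in> L" using subgroup.m_inv_closed[OF LG] subgroup_int_pow_closed[OF LG lk(1)] by blast
    finally have "e [^] (k * int n') = \<one>" using Le by blast
    then have "int p * int n' dvd k * int n'" using ec by (simp add: int_pow_eq_id n')
    moreover have "n' \<noteq> 0" using n' e(2) by auto
    ultimately have "int p dvd k" by simp
    then obtain k' where k': "k = int p * k'" by (auto elim: dvdE)
    \<comment> \<open>Correcting \<open>y0\<close> by a power of \<open>e\<close> moves its
      \<open>p\<close>-th power from \<open>T\<close> into \<open>L\<close> and leaves it outside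
      \<open>T\<close>.\<close>
    define y where "y = y0 \<otimes> e [^] (- k')"
    have yK: "y \<in> K" unfolding y_def using subgroup.m_closed[OF K(1) y0K powK[OF e(1)]] .
    have yc: "y \<in> carrier G" using Kc yK .
    have y0y: "y0 = y \<otimes> e [^] k'" using y0c ec by (simp add: y_def m_assoc int_pow_mult[symmetric])
    have yT: "y \<notin> T" using y0T y0y eT subgroup.m_closed[OF T] by blast
    have "y [^] int p = y0 [^] int p \<otimes> e [^] (- k)"
      unfolding y_def using y0c ec by (simp add: int_pow_distrib int_pow_pow k' mult.commute)
    also have "\<dots> = l" unfolding lk(2) using Lc[OF lk(1)] ec by (simp add: m_assoc int_pow_mult[symmetric])
    finally have yp: "y [^] int p \<in> L" using lk(1) by simp
    let ?L' = "{l \<otimes> y [^] j | l (j::int). l \<in> L}"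
    have L'G: "subgroup ?L' G" using span_subgroup[OF LG yc] .
    have L'K: "?L' \<subseteq> K" using subgroup.m_closed[OF K(1)] powK[OF yK] LK by blast
    have "L \<subseteq> ?L'" by (rule self_span)
    moreover have "y \<in> ?L'"
      using subgroup.one_closed[OF LG] yc by (auto intro!: exI[of _ "1::int"] exI[of _ \<one>])
    \<comment> \<open>The span of \<open>L\<close> and \<open>y\<close> is strictly larger than
      \<open>L\<close>, so by maximality it contains a nontrivial power of \<open>e\<close>.\<close>
    ultimately have "\<not> P ?L'" using max yT LT by blast
    then obtain i :: int where i: "e [^] i \<in> ?L'" "e [^] i \<noteq> \<one>" using L'G L'K by (auto simp: P_def)
    then obtain l' and j :: int where lj: "l' \<in> L" "e [^] i = l' \<otimes> y [^] j" by blast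
    \<comment> \<open>If \<open>p\<close> divided \<open>j\<close>, that power of \<open>e\<close>
      would lie in \<open>L\<close>. So \<open>j\<close> is prime to \<open>p\<close>, and since the
      powers of \<open>y\<close> with exponents \<open>p\<close> and \<open>j\<close> are in
      \<open>T\<close>, so is \<open>y\<close>, a contradiction.\<close>
    have "\<not> int p dvd j"
    proof
      assume "int p dvd j"
      then obtain j' where "j = int p * j'" by (auto elim: dvdE)
      then have "y [^] j \<in> L" using subgroup_int_pow_closed[OF LG yp, of j'] yc by (simp add: int_pow_pow)
      then show False using lj subgroup.m_closed[OF LG] Le i(2) by metis
    qed
    then have "coprime (int p) j" using p(1) by (simp add: prime_imp_coprime)
    moreover have "y [^] j = inv l' \<otimes> e [^] i" unfolding lj(2) using Lc[OF lj(1)] yc by (simp add: m_assoc[symmetric])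
    then have "y [^] j \<in> T" using subgroup.m_closed[OF T] subgroup.m_inv_closed[OF T] LT lj(1) eT by auto
    ultimately show False using coprime_powers_mem[OF T yc _ _, of "int p" j] yp LT yT by blast
  qed
  then show ?thesis using LG LK Le unfolding T_def by (intro exI[of _ L]) blast
qed

text \<open>An element of order equal to the exponent splits off with a complement \<open>L\<close>,
  which is treated by induction. It is placed last, because all orders in \<open>L\<close> divide
  its order; this gives the divisibility chain.\<close>

lemma ex_invariant_basis:
  assumes "subgroup K G" "finite K"
  shows "\<exists>(r::nat) e. (\<forall>i<r. e i \<in> K \<and> 1 < ord (e i)) \<and> (\<forall>i. Suc i < r \<longrightarrow> ord (e i) dvd ord (e (Suc i)))
    \<and> (\<forall>x\<in>K. \<exists>f::nat \<Rightarrow> int. x = (\<Otimes>i\<in>{..<r}. e i [^] f i))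
    \<and> (\<forall>f::nat \<Rightarrow> int. (\<Otimes>i\<in>{..<r}. e i [^] f i) = \<one> \<longrightarrow> (\<forall>i<r. int (ord (e i)) dvd f i))"
  using assms
proof (induction "card K" arbitrary: K rule: less_induct)
  case less
  note K = less.prems
  have Kc: "x \<in> carrier G" if "x \<in> K" for x using subgroup.mem_carrier[OF K(1)] that .
  show ?case
  proof (cases "K = {\<one>}")
    case True
    then show ?thesis by (intro exI[of _ 0]) auto
  next
    case False
    obtain e where e: "e \<in> K" "0 < ord e" "\<And>x. x \<in> K \<Longrightarrow> ord x dvd ord e"
      using ex_exponent_element[OF K] by blast
    have e1: "1 < ord e"
    proof (rule ccontr)
      assume "\<not> 1 < ord e"
      then have "ord e = 1" using e(2) by simp
      then have "x = \<one>" if "x \<in> K" for x using e(3)[OF that] ord_eq_1[OF Kc[OF that]] by simp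
      then show False using False subgroup.one_closed[OF K(1)] by blast
    qed
    obtain L where L: "subgroup L G" "L \<subseteq> K" and Le: "\<And>i::int. e [^] i \<in> L \<Longrightarrow> e [^] i = \<one>"
      and span: "\<And>x. x \<in> K \<Longrightarrow> \<exists>l\<in>L. \<exists>i::int. x = l \<otimes> e [^] i"
      using ex_complement[OF K e] by blast
    have ec: "e \<in> carrier G" using Kc e(1) .
    have "e \<notin> L" using Le[of 1] ec e1 by auto
    then have "card L < card K" using L(2) e(1) K(2) by (intro psubset_card_mono) auto
    then obtain r e' where IH: "\<And>i. i < r \<Longrightarrow> e' i \<in> L \<and> 1 < ord (e' i)"
      "\<And>i. Suc i < r \<Longrightarrow> ord (e' i) dvd ord (e' (Suc i))"
      "\<And>x. x \<in> L \<Longrightarrow> \<exists>f::nat \<Rightarrow> int. x = (\<Otimes>i\<in>{..<r}. e' i [^] f i)"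
      "\<And>(f::nat \<Rightarrow> int) i. (\<Otimes>i\<in>{..<r}. e' i [^] f i) = \<one> \<Longrightarrow> i < r \<Longrightarrow> int (ord (e' i)) dvd f i"
      using less.hyps[OF _ L(1) finite_subset[OF L(2) K(2)]] by blast
    define b where "b = e'(r := e)"
    have e'c: "e' i \<in> carrier G" if "i < r" for i using IH(1)[OF that] L(2) Kc by blast
    have inL: "(\<Otimes>i\<in>{..<m}. e' i [^] (f i :: int)) \<in> L" if "m \<le> r" for f m
      using that
    proof (induction m)
      case 0 then show ?case using subgroup.one_closed[OF L(1)] by simp
    next
      case (Suc m)
      have "(\<Otimes>i\<in>{..<Suc m}. e' i [^] f i) = e' m [^] f m \<otimes> (\<Otimes>i\<in>{..<m}. e' i [^] f i)"
        unfolding lessThan_Suc by (rule finprod_insert) (use Suc.prems e'c in auto)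
      moreover have "e' m [^] f m \<in> L" using IH(1)[of m] Suc.prems subgroup_int_pow_closed[OF L(1)] by simp
      ultimately show ?case using Suc subgroup.m_closed[OF L(1)] by simp
    qed
    have prod: "(\<Otimes>i\<in>{..<Suc r}. b i [^] (f i :: int)) = e [^] f r \<otimes> (\<Otimes>i\<in>{..<r}. e' i [^] f i)" for f
    proof -
      have "(\<Otimes>i\<in>{..<Suc r}. b i [^] f i) = b r [^] f r \<otimes> (\<Otimes>i\<in>{..<r}. b i [^] f i)"
        unfolding lessThan_Suc by (rule finprod_insert) (use e'c ec in \<open>auto simp: b_def\<close>)
      also have "(\<Otimes>i\<in>{..<r}. b i [^] f i) = (\<Otimes>i\<in>{..<r}. e' i [^] f i)"
        by (rule finprod_cong') (use e'c in \<open>auto simp: b_def\<close>)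
      finally show ?thesis by (simp add: b_def)
    qed
    show ?thesis
    proof (intro exI[of _ "Suc r"] exI[of _ b] conjI allI impI ballI)
      show "b i \<in> K" if "i < Suc r" for i using that IH(1)[of i] L(2) e(1) by (auto simp: b_def less_Suc_eq)
      show "1 < ord (b i)" if "i < Suc r" for i using that IH(1)[of i] e1 by (auto simp: b_def less_Suc_eq)
      show "ord (b i) dvd ord (b (Suc i))" if "Suc i < Suc r" for i
        using that IH(1)[of i] IH(2)[of i] L(2) e(3) by (cases "Suc i = r") (auto simp: b_def)
    next
      fix x assume "x \<in> K"
      then obtain l and j :: int where lj: "l \<in> L" "x = l \<otimes> e [^] j" using span by blast
      obtain f :: "nat \<Rightarrow> int" where f: "l = (\<Otimes>i\<in>{..<r}. e' i [^] f i)" using IH(3)[OF lj(1)] by blast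
      have "(\<Otimes>i\<in>{..<Suc r}. b i [^] (f(r := j)) i) = e [^] j \<otimes> (\<Otimes>i\<in>{..<r}. e' i [^] (f(r := j)) i)"
        using prod[of "f(r := j)"] by simp
      also have "(\<Otimes>i\<in>{..<r}. e' i [^] (f(r := j)) i) = l"
        unfolding f by (rule finprod_cong') (use e'c in auto)
      also have "e [^] j \<otimes> l = x" using lj ec subgroup.mem_carrier[OF L(1)] by (simp add: m_comm)
      finally show "\<exists>f::nat \<Rightarrow> int. x = (\<Otimes>i\<in>{..<Suc r}. b i [^] f i)" by metis
    next
      fix f :: "nat \<Rightarrow> int" and i
      assume 1: "(\<Otimes>i\<in>{..<Suc r}. b i [^] f i) = \<one>" and i: "i < Suc r"
      let ?l = "(\<Otimes>i\<in>{..<r}. e' i [^] f i)"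
      have l: "?l \<in> L" using inL by blast
      have eq: "e [^] f r \<otimes> ?l = \<one>" using 1 prod by simp
      \<comment> \<open>A relation puts a power of \<open>e\<close> into the complement, so this
        power and the remaining product are both trivial.\<close>
      then have "e [^] f r = inv ?l"
        using ec subgroup.mem_carrier[OF L(1) l] by (metis inv_equality int_pow_closed m_comm inv_inv)
      then have er: "e [^] f r = \<one>" using Le subgroup.m_inv_closed[OF L(1) l] by metis
      then have "?l = \<one>" using eq subgroup.mem_carrier[OF L(1) l] by simp
      moreover have "int (ord e) dvd f r" using er ec int_pow_eq_id by blast
      ultimately show "int (ord (b i)) dvd f i"
        using IH(4)[of f i] i by (auto simp: b_def less_Suc_eq)
    qed
  qed
qed

text \<open>For finite groups this shows that the choice in \<open>davenport_star\<close> has a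
  witness.\<close>

lemma ex_invariant_factors:
  assumes fin: "finite (carrier G)"
  shows "\<exists>ns::nat list. (\<forall>i<length ns. 1 < ns ! i) \<and> (\<forall>i. Suc i < length ns \<longrightarrow> ns ! i dvd ns ! Suc i) \<and>
    G \<cong> product_group {..<length ns} (\<lambda>i. integer_mod_group (ns ! i))"
proof -
  obtain r e where e: "\<And>i. i < r \<Longrightarrow> e i \<in> carrier G \<and> 1 < ord (e i)"
    "\<And>i. Suc i < r \<Longrightarrow> ord (e i) dvd ord (e (Suc i))"
    "\<And>x. x \<in> carrier G \<Longrightarrow> \<exists>f::nat \<Rightarrow> int. x = (\<Otimes>i\<in>{..<r}. e i [^] f i)"
    "\<And>(f::nat \<Rightarrow> int) i. (\<Otimes>i\<in>{..<r}. e i [^] f i) = \<one> \<Longrightarrow> i < r \<Longrightarrow> int (ord (e i)) dvd f i"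
    using ex_invariant_basis[OF subgroup_self fin] by blast
  define ns where "ns = map (\<lambda>i. ord (e i)) [0..<r]"
  have ns: "length ns = r" "\<And>i. i < r \<Longrightarrow> ns ! i = ord (e i)" by (auto simp: ns_def)
  have ec: "\<And>i. i < r \<Longrightarrow> e i \<in> carrier G" using e(1) by blast
  let ?P = "product_group {..<r} (\<lambda>i. integer_mod_group (ns ! i))"
  define h where "h f = (\<Otimes>i\<in>{..<r}. e i [^] (f i :: int))" for f
  have hc: "h f \<in> carrier G" for f unfolding h_def by (rule finprod_closed) (use ec in auto)
  have hmult: "h (\<lambda>i. f i + g i) = h f \<otimes> h g" for f g
  proof -
    have "h (\<lambda>i. f i + g i) = (\<Otimes>i\<in>{..<r}. e i [^] f i \<otimes> e i [^] g i)"
      unfolding h_def by (rule finprod_cong') (use ec in \<open>auto simp: int_pow_mult\<close>)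
    also have "\<dots> = h f \<otimes> h g" unfolding h_def by (rule finprod_multf) (use ec in auto)
    finally show ?thesis .
  qed
  \<comment> \<open>Exponents matter only modulo the orders; this reconciles reduced addition in
    \<open>?P\<close> with addition of integers, and also ignores values outside the index
    range.\<close>
  have hcong: "h f = h g" if "\<And>i. i < r \<Longrightarrow> f i mod int (ord (e i)) = g i mod int (ord (e i))" for f g
    unfolding h_def
  proof (rule finprod_cong')
    show "e i [^] f i = e i [^] g i" if "i \<in> {..<r}" for i
      using that \<open>\<And>i. i < r \<Longrightarrow> f i mod int (ord (e i)) = g i mod int (ord (e i))\<close>[of i] ec
      by (simp add: int_pow_eq mod_eq_dvd_iff) (metis dvd_minus_iff minus_diff_eq)
  qed (use ec in auto)
  have carrP: "carrier ?P = (\<Pi>\<^sub>E i\<in>{..<r}. {0..<int (ord (e i))})"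
    unfolding carrier_product_group
    by (rule PiE_cong) (use e(1) ns in \<open>force simp: carrier_integer_mod_group\<close>)
  have "h \<in> iso ?P G"
    unfolding iso_def
  proof (intro CollectI conjI)
    show "h \<in> hom ?P G"
      unfolding hom_def
    proof (intro CollectI conjI ballI)
      show "h \<in> carrier ?P \<rightarrow> carrier G" using hc by simp
      fix f g
      have "h (f \<otimes>\<^bsub>?P\<^esub> g) = h (\<lambda>i. f i + g i)" by (rule hcong) (simp add: ns)
      then show "h (f \<otimes>\<^bsub>?P\<^esub> g) = h f \<otimes> h g" using hmult by simp
    qed
    show "bij_betw h (carrier ?P) (carrier G)"
      unfolding bij_betw_def
    proof
      show "inj_on h (carrier ?P)"
      proof (rule inj_onI)
        fix f g assume fg: "f \<in> carrier ?P" "g \<in> carrier ?P" "h f = h g"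
        have "h (\<lambda>i. f i + - g i) \<otimes> h g = h f" unfolding hmult[symmetric] by (rule hcong) simp
        then have "h (\<lambda>i. f i + - g i) = \<one>" using fg(3) hc by (metis r_cancel_one')
        then have d: "int (ord (e i)) dvd f i - g i" if "i < r" for i
          using e(4)[of "\<lambda>i. f i + - g i" i] that by (simp add: h_def)
        have "f i = g i" if "i < r" for i
        proof -
          have "f i \<in> {0..<int (ord (e i))}" "g i \<in> {0..<int (ord (e i))}"
            using PiE_mem[OF fg(1)[unfolded carrP], of i] PiE_mem[OF fg(2)[unfolded carrP], of i] that by simp_all
          then show ?thesis using d[OF that] by (metis mod_eq_dvd_iff mod_pos_pos_trivial atLeastLessThan_iff)
        qed
        then show "f = g" using fg(1,2) unfolding carrP by (intro PiE_ext) auto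
      qed
      have "x \<in> h ` carrier ?P" if x: "x \<in> carrier G" for x
      proof -
        obtain f where f: "x = h f" using e(3)[OF x] by (auto simp: h_def)
        let ?g = "\<lambda>i\<in>{..<r}. f i mod int (ord (e i))"
        have "f i mod int (ord (e i)) \<in> {0..<int (ord (e i))}" if "i < r" for i
          using e(1)[OF that] by simp
        then have "?g \<in> carrier ?P" unfolding carrP by (intro PiE_I) simp_all
        moreover have "h f = h ?g" by (rule hcong) simp
        ultimately have "h f \<in> h ` carrier ?P" by (intro image_eqI[of "h f" h ?g])
        then show ?thesis by (simp only: f)
      qed
      then show "h ` carrier ?P = carrier G" using hc by auto
    qed
  qed
  then have "?P \<cong> G" by (rule is_isoI)
  then have "G \<cong> ?P" using group.iso_sym[of ?P G] by simp
  then show ?thesis using e(1,2) ns by (intro exI[of _ ns]) auto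
qed

end

section \<open>Small class groups and the Davenport constant\<close>

context block_monoid
begin

lemma rel_degrees_le:
  assumes "\<And>m z z'. z \<in> facs m \<Longrightarrow> z' \<in> facs m \<Longrightarrow> conn N z z'" "d \<in> rel_degrees"
  shows "d \<le> N"
proof (rule ccontr)
  assume "\<not> d \<le> N"
  then have "N \<le> d - 1" by simp
  then show False using assms conn_mono unfolding rel_degrees_def by blast
qed

text \<open>All primes are zero-sum, so the atoms are the single primes and factorization is
  unique.\<close>

lemma rel_degrees_trivial:
  assumes "card (carrier G) = 1"
  shows "rel_degrees = {}"
proof -
  have "carrier G = {\<one>}" using assms one_closed by (metis card_1_singletonE singletonD)
  then have unit: "cls p = \<one>" for p using cls_closed by blast
  have at: "\<exists>p. u = {#p#}" if u: "batom u" for u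
  proof -
    obtain p where "p \<in># u" using batom_nonempty[OF u] by blast
    then have "{#p#} = u" using batom_minimal[OF u, of "{#p#}"] unit by (simp add: zs_def)
    then show ?thesis by metis
  qed
  have uniq: "z = image_mset (\<lambda>p. {#p#}) (\<Sum>\<^sub># z)" if "\<And>u. u \<in># z \<Longrightarrow> batom u" for z
    using that
  proof (induction z)
    case (add u z)
    then have "z = image_mset (\<lambda>p. {#p#}) (\<Sum>\<^sub># z)" by simp
    moreover obtain p where "u = {#p#}" using at add.prems by force
    ultimately show ?case by simp
  qed simp
  have "z = z'" if "z \<in> facs m" "z' \<in> facs m" for z z' m
    using uniq[of z] uniq[of z'] facs_batom[OF that(1)] facs_batom[OF that(2)]
      facs_sum[OF that(1)] facs_sum[OF that(2)] by metis
  then show ?thesis unfolding rel_degrees_def by blast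
qed

text \<open>Two nontrivial primes are inverse to each other, so atoms have size at most two and
  \<open>catenary_bound\<close> applies with both bounds equal to two. The distance two comes from
  \<open>pp\<close> times \<open>qq\<close> being \<open>pq\<close> times \<open>pq\<close>.\<close>

lemma rel_degrees_order_two:
  assumes card: "card (carrier G) = 2" and pq: "p \<noteq> q" "cls p = cls q" "cls p \<noteq> \<one>"
  shows "rel_degrees = {2}"
proof -
  obtain a b where ab: "carrier G = {a, b}" "a \<noteq> b" using card by (auto simp: card_2_iff)
  have two: "x = y" if "x \<in> carrier G" "y \<in> carrier G" "x \<noteq> \<one>" "y \<noteq> \<one>" for x y
    using that ab one_closed by auto
  have sq: "x \<otimes> x = \<one>" if x: "x \<in> carrier G" for x
  proof (rule ccontr)
    assume 1: "x \<otimes> x \<noteq> \<one>"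
    then have "x \<noteq> \<one>" by auto
    then have "x \<otimes> x = x" using two[of "x \<otimes> x" x] x 1 by simp
    then show False using x \<open>x \<noteq> \<one>\<close> by (metis r_cancel_one)
  qed
  have D: "size u \<le> 2" if u: "batom u" for u
  proof (rule ccontr)
    assume u3: "\<not> size u \<le> 2"
    then have "2 \<le> size u" by simp
    then obtain p1 p2 m where m: "u = m + {#p1, p2#}" by (rule two_le_sizeE)
    have "cls p1 \<noteq> \<one>" "cls p2 \<noteq> \<one>" using batom_no_unit[OF u \<open>2 \<le> size u\<close>] by (auto simp: m)
    then have "zs {#p1, p2#}" using two[of "cls p1" "cls p2"] sq by (simp add: zs_def)
    then have "{#p1, p2#} = u" using batom_minimal[OF u, of "{#p1, p2#}"] by (simp add: m)
    then show False using u3 by auto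
  qed
  have "k \<le> 2" if "k \<in> dal" for k using dal_le_bound[OF D that] .
  then have "conn 2 z z'" if "z \<in> facs m" "z' \<in> facs m" for z z' m
    using catenary_bound[OF _ _ D _ that, of 2] by simp
  then have "d \<le> 2" if "d \<in> rel_degrees" for d using rel_degrees_le[OF _ that] by blast
  moreover have "2 \<le> d" if "d \<in> rel_degrees" for d using that by (simp add: rel_degrees_def)
  ultimately have "rel_degrees \<subseteq> {2}" using le_antisym by blast
  moreover have "2 \<in> rel_degrees"
  proof -
    have b: "batom {#x, y#}" if "cls x = cls p" "cls y = cls p" for x y
      by (rule small_batom) (use that pq sq in \<open>auto simp: zs_def\<close>)
    let ?z = "{#{#p, p#}, {#q, q#}#}" and ?z' = "{#{#p, q#}, {#p, q#}#}"
    have "?z \<in> facs {#p, p, q, q#}" "?z' \<in> facs {#p, p, q, q#}"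
      using b pq by (auto simp: facs_def)
    moreover have "?z \<noteq> ?z'"
    proof
      assume "?z = ?z'"
      then have "{#p, p#} \<in># ?z'" by (metis union_single_eq_member)
      then have "{#p, p#} = {#p, q#}" by simp
      then show False using pq(1) by simp
    qed
    moreover have "fdist ?z ?z' \<le> 2" using fdist_le_size[of ?z ?z'] by simp
    ultimately show ?thesis using two_in_rel_degreesI by blast
  qed
  ultimately show ?thesis by blast
qed

text \<open>After cancellation a distance of two is an exchange of the form \<open>a + b\<close>,
  \<open>e + f\<close> against \<open>a + e\<close>, \<open>b + f\<close>. Then \<open>a\<close>,
  \<open>f\<close> have equal class, and so have \<open>b\<close>, \<open>e\<close>; with atoms this
  short one of these pairs consists of single primes, which then coincide and create a common
  factor.\<close>

lemma two_notin_rel_degrees: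
  assumes D: "\<And>u. batom u \<Longrightarrow> size u \<le> 3"
    and uniq: "\<And>p q. cls p = cls q \<Longrightarrow> cls p \<noteq> \<one> \<Longrightarrow> p = q"
  shows "2 \<notin> rel_degrees"
proof
  assume "2 \<in> rel_degrees"
  then obtain m x y where x: "x \<in> facs m" and y: "y \<in> facs m" and ne: "x \<noteq> y" and d: "fdist x y = 2"
    unfolding rel_degrees_def by blast
  have sz: "size x = size y"
  proof (rule ccontr)
    assume "size x \<noteq> size y"
    then consider "size x < size y" | "size y < size x" by linarith
    then show False
      using fdist_ge_length_gap[OF x y] fdist_ge_length_gap[OF y x] d by cases (auto simp: fdist_commute)
  qed
  define c x' y' where "c = x \<inter># y" and "x' = x - y" and "y' = y - x"
  have xy: "x = c + x'" "y = c + y'"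
    by (auto simp: c_def x'_def y'_def multiset_eq_iff)
  have "size x' = size y'" using sz by (simp add: xy)
  then have sz2: "size x' = 2" "size y' = 2" using d by (auto simp: fdist_def x'_def[symmetric] y'_def[symmetric])
  have disj: "u \<noteq> s" if "u \<in># x'" "s \<in># y'" for u s
    using that by (auto simp: x'_def y'_def in_diff_count)
  have xb: "batom u" if "u \<in># x'" for u using facs_batom[OF x] that by (simp add: xy)
  have yb: "batom s" if "s \<in># y'" for s using facs_batom[OF y] that by (simp add: xy)
  have "2 \<le> size x'" using sz2 by simp
  then obtain u v r where "x' = r + {#u, v#}" by (rule two_le_sizeE)
  then have x': "x' = {#u, v#}" using sz2 by simp
  have "\<Sum>\<^sub># x' = \<Sum>\<^sub># y'" using facs_sum[OF x] facs_sum[OF y] by (auto simp: xy)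
  then have "\<Sum>\<^sub># y' = u + v" by (simp add: x')
  from sum_mset_allocate[OF this] obtain zz where zz: "image_mset (\<lambda>(x, y). x + y) zz = y'"
    "(\<Sum>t\<in>#zz. fst t) = u" "(\<Sum>t\<in>#zz. snd t) = v" by blast
  have szz: "size zz = 2" using zz(1) sz2 by (metis size_image_mset)
  then have "2 \<le> size zz" by simp
  then obtain t1 t2 r' where "zz = r' + {#t1, t2#}" by (rule two_le_sizeE)
  then have z12: "zz = {#t1, t2#}" using szz by simp
  obtain a e b f where t: "t1 = (a, e)" "t2 = (b, f)" by (cases t1, cases t2)
  have u: "u = a + b" and v: "v = e + f" and y': "y' = {#a + e, b + f#}"
    using zz by (auto simp: z12 t)
  have ub: "batom (a + b)" "batom (e + f)" using xb by (auto simp: x' u v)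
  have sb: "batom (a + e)" "batom (b + f)" using yb by (auto simp: y')
  have neq: "a + b \<noteq> a + e" "a + b \<noteq> b + f" "e + f \<noteq> a + e" "e + f \<noteq> b + f"
    using disj[of u "a + e"] disj[of u "b + f"] disj[of v "a + e"] disj[of v "b + f"]
    unfolding x' y' by (simp_all add: u v)
  have le3: "size a + size b \<le> 3" "size e + size f \<le> 3" "size a + size e \<le> 3" "size b + size f \<le> 3"
    using D ub sb by fastforce+
  have emp: "\<not> s \<subseteq># s'" if "batom s" "batom s'" "s \<noteq> s'" for s s'
    using that batom_minimal batom_zs batom_nonempty by metis
  have "a \<noteq> {#}" using emp[OF sb(1) ub(2)] neq by auto
  moreover have "b \<noteq> {#}" using emp[OF sb(2) ub(2)] neq by auto
  moreover have "e \<noteq> {#}" using emp[OF sb(1) ub(1)] neq by auto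
  moreover have "f \<noteq> {#}" using emp[OF sb(2) ub(1)] neq by auto
  ultimately have pos: "0 < size a" "0 < size b" "0 < size e" "0 < size f"
    by (auto simp: nonempty_has_size)
  have zab: "zs (b + a)" "zs (b + f)" "zs (a + b)" "zs (a + e)"
    using batom_zs ub sb by (auto simp: add.commute)
  have af: "sg a = sg f" using zab(1,2) by (simp add: zs_def) (metis l_cancel sg_closed)
  have be: "sg b = sg e" using zab(3,4) by (simp add: zs_def) (metis l_cancel sg_closed)
  have single: "s = s'" if s: "size s = 1" "size s' = 1" "sg s = sg s'" and w: "batom w" "s \<subseteq># w" "2 \<le> size w" for s s' w
  proof -
    obtain p q where pq: "s = {#p#}" "s' = {#q#}" using s by (metis One_nat_def size_1_singleton_mset)
    have "cls p = cls q" using s(3) by (simp add: pq)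
    moreover have "cls p \<noteq> \<one>" using batom_no_unit[OF w(1,3)] w(2) by (simp add: pq)
    ultimately show ?thesis using uniq pq by blast
  qed
  have "\<not> (size a = 1 \<and> size f = 1)"
  proof
    assume "size a = 1 \<and> size f = 1"
    then have "a = f" using single[OF _ _ af ub(1)] pos by simp
    then show False using neq(3) by (simp add: add.commute)
  qed
  moreover have "\<not> (size b = 1 \<and> size e = 1)"
  proof
    assume "size b = 1 \<and> size e = 1"
    then have "b = e" using single[OF _ _ be ub(1)] pos by simp
    then show False using neq(1) by simp
  qed
  \<comment> \<open>If \<open>a\<close> or \<open>f\<close> has two primes, the bound three leaves
    only one for each of \<open>b\<close> and \<open>e\<close>.\<close>
  ultimately show False using le3 pos by linarith
qed

section \<open>Minimal zero-sum sequences, the Davenport constant and length gaps\<close>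

lemma seq_prod_union:
  assumes "set_mset S \<subseteq> carrier G" "set_mset T \<subseteq> carrier G"
  shows "seq_prod G (S + T) = seq_prod G S \<otimes> seq_prod G T"
proof -
  let ?A = "set_mset S \<union> set_mset T"
  have ext: "seq_prod G M = finprod G (\<lambda>g. g [^] count M g) ?A" if "set_mset M \<subseteq> ?A" for M
    unfolding seq_prod_def
    by (rule finprod_mono_neutral_cong_left) (use assms that in \<open>auto simp: not_in_iff\<close>)
  have "seq_prod G (S + T) = finprod G (\<lambda>g. g [^] count S g \<otimes> g [^] count T g) ?A"
    unfolding ext[of "S + T", simplified] by (rule finprod_cong') (use assms in \<open>auto simp: nat_pow_mult\<close>)
  also have "\<dots> = seq_prod G S \<otimes> seq_prod G T"
    unfolding ext[of S, simplified] ext[of T, simplified]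
    by (rule finprod_multf) (use assms in auto)
  finally show ?thesis .
qed

lemma seq_prod_image_cls: "seq_prod G (image_mset cls m) = sg m"
proof (induction m)
  case empty
  then show ?case by (simp add: seq_prod_def)
next
  case (add p m)
  have "seq_prod G ({#cls p#} + image_mset cls m) = seq_prod G {#cls p#} \<otimes> seq_prod G (image_mset cls m)"
    by (rule seq_prod_union) auto
  then show ?case using add by (simp add: seq_prod_def)
qed

lemma minimal_zero_sum_image_cls: "minimal_zero_sum G (image_mset cls u) \<longleftrightarrow> batom u"
proof
  assume m: "minimal_zero_sum G (image_mset cls u)"
  show "batom u"
    unfolding batom_def
  proof (intro conjI allI impI)
    show "u \<noteq> {#}" "zs u" using m by (auto simp: minimal_zero_sum_def seq_prod_image_cls zs_def)
    fix t assume t: "t \<subseteq># u" "zs t"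
    show "t = {#} \<or> t = u"
    proof (rule ccontr)
      assume ne: "\<not> (t = {#} \<or> t = u)"
      \<comment> \<open>The class map may identify primes, so the images are told apart by their
        sizes.\<close>
      then have "size t \<noteq> size u"
        using t(1) mset_subset_size subset_mset.le_neq_trans by (metis nat_neq_iff)
      then have "image_mset cls t \<noteq> image_mset cls u" by (metis size_image_mset)
      moreover have "image_mset cls t \<subseteq># image_mset cls u" using t(1) by (rule image_mset_subseteq_mono)
      ultimately show False
        using m ne t(2) by (auto simp: minimal_zero_sum_def seq_prod_image_cls zs_def)
    qed
  qed
next
  assume u: "batom u"
  show "minimal_zero_sum G (image_mset cls u)"
    unfolding minimal_zero_sum_def
  proof (intro conjI allI impI)
    show "image_mset cls u \<noteq> {#}" using batom_nonempty[OF u] by simp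
    show "set_mset (image_mset cls u) \<subseteq> carrier G" by auto
    show "seq_prod G (image_mset cls u) = \<one>" using batom_zs[OF u] by (simp add: seq_prod_image_cls zs_def)
    fix T assume T: "T \<subseteq># image_mset cls u \<and> T \<noteq> {#} \<and> T \<noteq> image_mset cls u"
    then have "image_mset cls u = T + (image_mset cls u - T)" by simp
    from image_mset_eq_plusD[OF this] obtain t s where t: "u = t + s" "T = image_mset cls t" by blast
    then have "t \<noteq> {#}" "t \<noteq> u" using T by auto
    then have "\<not> zs t" using batom_minimal[OF u, of t] t(1) by auto
    then show "seq_prod G T \<noteq> \<one>" by (simp add: t(2) seq_prod_image_cls zs_def)
  qed
qed

text \<open>Choosing a prime in every class lifts each minimal zero-sum sequence to an atom of the
  same size.\<close>

lemma davenport_eq: "davenport G = (SUP u\<in>{u. batom u}. enat (size u))"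
proof -
  have "{S. minimal_zero_sum G S} = image_mset cls ` {u. batom u}"
  proof (intro equalityI subsetI)
    fix S assume "S \<in> {S. minimal_zero_sum G S}"
    then have S: "minimal_zero_sum G S" by simp
    define pr where "pr g = (SOME p. cls p = g)" for g
    have "cls (pr g) = g" if "g \<in> carrier G" for g
      unfolding pr_def by (rule someI_ex) (use cls_surj that in blast)
    then have "image_mset cls (image_mset pr S) = image_mset id S"
      unfolding multiset.map_comp using S by (intro image_mset_cong) (auto simp: minimal_zero_sum_def)
    then have "S = image_mset cls (image_mset pr S)" by simp
    then show "S \<in> image_mset cls ` {u. batom u}" using S minimal_zero_sum_image_cls by (metis imageI mem_Collect_eq)
  qed (auto simp: minimal_zero_sum_image_cls)
  then show ?thesis unfolding davenport_def by (simp add: image_image)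
qed

lemma batom_size_le_davenport: "davenport G = enat D \<Longrightarrow> batom u \<Longrightarrow> size u \<le> D"
  unfolding davenport_eq by (metis SUP_upper enat_ord_simps(1) mem_Collect_eq)

lemma ex_batom_davenport:
  assumes "enat (Suc n) \<le> davenport G" shows "\<exists>u. batom u \<and> Suc n \<le> size u"
proof (rule ccontr)
  assume "\<not> ?thesis"
  then have "davenport G \<le> enat n"
    unfolding davenport_eq by (intro SUP_least) (auto simp: not_less_eq_eq)
  then show False using assms by (metis enat_ord_simps(1) not_less_eq_eq order_refl order_trans)
qed

text \<open>Since \<open>n - 1\<close> is at most \<open>2 * (n div 2)\<close>, the element of
  \<open>dal\<close> built from coordinates reaches half of \<open>davenport_star G\<close>, as
  \<open>catenary_bound\<close> demands.\<close>

lemma dal_invariant_factors: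
  assumes fin: "finite (carrier G)" and ds: "4 \<le> davenport_star G"
  shows "\<exists>k\<in>dal. davenport_star G \<le> 2 * k"
proof -
  have "\<exists>d. \<exists>ns::nat list. (\<forall>i<length ns. 1 < ns ! i) \<and> (\<forall>i. Suc i < length ns \<longrightarrow> ns ! i dvd ns ! Suc i) \<and>
      G \<cong> product_group {..<length ns} (\<lambda>i. integer_mod_group (ns ! i)) \<and>
      d = 1 + (\<Sum>i<length ns. ns ! i - 1)"
    using ex_invariant_factors[OF fin] by blast
  from someI_ex[OF this] obtain ns :: "nat list" where ns: "\<And>i. i < length ns \<Longrightarrow> 1 < ns ! i"
    and iso: "G \<cong> product_group {..<length ns} (\<lambda>i. integer_mod_group (ns ! i))"
    and dst: "davenport_star G = 1 + (\<Sum>i<length ns. ns ! i - 1)"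
    unfolding davenport_star_def by blast
  let ?r = "length ns"
  let ?P = "product_group {..<?r} (\<lambda>i. integer_mod_group (ns ! i))"
  obtain h where h: "h \<in> iso G ?P" using iso unfolding is_iso_def by blast
  \<comment> \<open>Standard basis vectors of the product; primes in the classes mapped to them are
    the basis for \<open>dal_coordinates\<close>.\<close>
  define unit where "unit j = (\<lambda>i\<in>{..<?r}. if i = j then 1 else 0 :: int)" for j
  have unitP: "unit j \<in> carrier ?P" for j
    unfolding unit_def carrier_product_group
    by (rule PiE_I) (auto simp: carrier_integer_mod_group dest: ns)
  have "\<exists>p. h (cls p) = unit j" for j
  proof -
    have "unit j \<in> h ` carrier G" using h unitP unfolding iso_def bij_betw_def by blast
    then show ?thesis using cls_surj by (metis imageE)
  qed
  then obtain p where p: "\<And>j. h (cls (p j)) = unit j" by metis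
  have "Suc (\<Sum>i<?r. ns ! i div 2) \<in> dal"
  proof (rule dal_coordinates[where f = "\<lambda>i x. h x i" and p = p])
    show "1 < ns ! i" if "i < ?r" for i using ns that .
    show "h (x \<otimes> y) i = (h x i + h y i) mod int (ns ! i)"
      if "i < ?r" "x \<in> carrier G" "y \<in> carrier G" for i x y
    proof -
      have "h (x \<otimes> y) = h x \<otimes>\<^bsub>?P\<^esub> h y" using h that by (auto simp: iso_def hom_def)
      then show ?thesis using that(1) by simp
    qed
    show "h (cls (p j)) i = (if i = j then 1 else 0)" if "i < ?r" "j < ?r" for i j
      using that by (simp add: p unit_def)
    have "(\<Sum>i<?r. ns ! i - 1) \<le> (\<Sum>i<?r. 2 * (ns ! i div 2))" by (rule sum_mono) simp
    then show "2 \<le> (\<Sum>i<?r. ns ! i div 2)" using ds dst by (simp add: sum_distrib_left[symmetric])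
  qed
  moreover have "davenport_star G \<le> 2 * Suc (\<Sum>i<?r. ns ! i div 2)"
  proof -
    have "(\<Sum>i<?r. ns ! i - 1) \<le> (\<Sum>i<?r. 2 * (ns ! i div 2))" by (rule sum_mono) simp
    then show ?thesis using dst by (simp add: sum_distrib_left[symmetric])
  qed
  ultimately show ?thesis by blast
qed

text \<open>A chain has to jump over the gap in the lengths in a single step, and by
  \<open>fdist_ge_length_gap\<close> such a step has distance at least the gap plus two.\<close>

lemma length_gap_not_conn:
  assumes x: "x \<in> facs m" and y: "y \<in> facs m" and l: "size x < size y"
    and gap: "\<And>w. w \<in> facs m \<Longrightarrow> \<not> (size x < size w \<and> size w < size y)"
  shows "\<not> conn (size y - size x + 1) x y"
proof
  assume "conn (size y - size x + 1) x y"
  moreover have "size w \<le> size x" if "conn (size y - size x + 1) x w" for w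
    using that
  proof (induction rule: rtrancl_induct)
    case (step v w)
    have v: "v \<in> facs m" using conn_facs x step.hyps(1) by blast
    have w: "w \<in> facs m" using conn_facs x step.hyps rtrancl.rtrancl_into_rtrancl by meson
    have d: "fdist v w \<le> size y - size x + 1" using step.hyps(2) by (auto simp: chain_step_def)
    show ?case
    proof (rule ccontr)
      assume "\<not> size w \<le> size x"
      then have "size y \<le> size w" using gap[OF w] by linarith
      moreover have "size w - size v + 2 \<le> fdist v w"
        using fdist_ge_length_gap[OF v w] step.IH \<open>\<not> size w \<le> size x\<close> by linarith
      ultimately show False using d step.IH l by linarith
    qed
  qed simp
  ultimately show False using l by force
qed

end

section \<open>Transfer to Krull monoids\<close>

locale krull_monoid = block_monoid G cls for G :: "'g monoid" (structure) and cls :: "'p \<Rightarrow> 'g" +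
  fixes H :: "'a monoid" and \<phi> :: "'a \<Rightarrow> 'p multiset"
  assumes krull: "krull_with_class_group H \<phi> G cls"
begin

sublocale H: comm_monoid H
  using krull by (simp add: krull_with_class_group_def cancel_comm_monoid_def)

lemma phi_one [simp]: "\<phi> \<one>\<^bsub>H\<^esub> = {#}"
  and phi_mult [simp]: "a \<in> carrier H \<Longrightarrow> b \<in> carrier H \<Longrightarrow> \<phi> (a \<otimes>\<^bsub>H\<^esub> b) = \<phi> a + \<phi> b"
  and phi_eq_iff: "a \<in> carrier H \<Longrightarrow> b \<in> carrier H \<Longrightarrow> \<phi> a = \<phi> b \<longleftrightarrow> a \<sim>\<^bsub>H\<^esub> b"
  and phi_subset_imp: "a \<in> carrier H \<Longrightarrow> b \<in> carrier H \<Longrightarrow> \<phi> a \<subseteq># \<phi> b \<Longrightarrow> a divides\<^bsub>H\<^esub> b"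
  and phi_gcd: "\<exists>S. finite S \<and> S \<noteq> {} \<and> S \<subseteq> \<phi> ` carrier H \<and> is_gcd_mset S m"
  and principal_iff: "sg m1 \<otimes> inv (sg m2) = \<one> \<longleftrightarrow> (\<exists>a\<in>carrier H. \<exists>b\<in>carrier H. m1 + \<phi> b = m2 + \<phi> a)"
  using krull unfolding krull_with_class_group_def divisor_theory_def is_class_group_def by blast+

lemma divides_iff: "a \<in> carrier H \<Longrightarrow> b \<in> carrier H \<Longrightarrow> a divides\<^bsub>H\<^esub> b \<longleftrightarrow> \<phi> a \<subseteq># \<phi> b"
  using phi_subset_imp by (auto simp: factor_def)

lemma zs_phi: "a \<in> carrier H \<Longrightarrow> zs (\<phi> a)"
proof -
  assume a: "a \<in> carrier H"
  have "\<phi> a + \<phi> \<one>\<^bsub>H\<^esub> = {#} + \<phi> a" by simp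
  then have "sg (\<phi> a) \<otimes> inv (sg {#}) = \<one>" using principal_iff a H.one_closed by blast
  then show ?thesis by (simp add: zs_def)
qed

text \<open>Trivial class makes \<open>m\<close> a quotient of two images; the divisor homomorphism
  property realizes this quotient inside \<open>H\<close>.\<close>

lemma phi_surj: assumes "zs m" obtains a where "a \<in> carrier H" "\<phi> a = m"
proof -
  have "sg m \<otimes> inv (sg {#}) = \<one>" using assms by (simp add: zs_def)
  then obtain a b where ab: "a \<in> carrier H" "b \<in> carrier H" "m + \<phi> b = {#} + \<phi> a"
    using principal_iff by blast
  then have "\<phi> b \<subseteq># \<phi> a" by (metis empty_neutral(1) mset_subset_eq_add_right)
  then obtain c where c: "c \<in> carrier H" "a = b \<otimes>\<^bsub>H\<^esub> c"
    using phi_subset_imp ab by (auto simp: factor_def)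
  then have "\<phi> c = m" using ab by simp
  then show ?thesis using that c by blast
qed

lemma Units_iff: "a \<in> carrier H \<Longrightarrow> a \<in> Units H \<longleftrightarrow> \<phi> a = {#}"
proof
  assume a: "a \<in> carrier H"
  show "\<phi> a = {#}" if u: "a \<in> Units H"
  proof -
    obtain b where "b \<in> carrier H" "a \<otimes>\<^bsub>H\<^esub> b = \<one>\<^bsub>H\<^esub>" using u unfolding Units_def by blast
    then have "\<phi> a + \<phi> b = {#}" using phi_mult[OF a] by (metis phi_one)
    then show ?thesis by simp
  qed
  assume "\<phi> a = {#}"
  then have "a divides\<^bsub>H\<^esub> \<one>\<^bsub>H\<^esub>" using a by (simp add: divides_iff)
  then obtain c where "c \<in> carrier H" "\<one>\<^bsub>H\<^esub> = a \<otimes>\<^bsub>H\<^esub> c" by (auto simp: factor_def)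
  then show "a \<in> Units H" using a H.m_comm by (auto simp: Units_def)
qed

lemma atoms_iff: "u \<in> atoms H \<longleftrightarrow> u \<in> carrier H \<and> batom (\<phi> u)"
proof
  assume "u \<in> atoms H"
  then have u: "u \<in> carrier H" "u \<notin> Units H"
    and irr: "\<And>b. b \<in> carrier H \<Longrightarrow> properfactor H b u \<Longrightarrow> b \<in> Units H"
    by (auto simp: atoms_def irreducible_def)
  have "batom (\<phi> u)"
    unfolding batom_def
  proof (intro conjI allI impI)
    show "\<phi> u \<noteq> {#}" "zs (\<phi> u)" using u Units_iff zs_phi by auto
    fix t assume t: "t \<subseteq># \<phi> u" "zs t"
    obtain b where b: "b \<in> carrier H" "\<phi> b = t" using phi_surj t(2) .
    show "t = {#} \<or> t = \<phi> u"
    proof (cases "\<phi> u \<subseteq># t")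
      case False
      then have "properfactor H b u" using b t(1) u(1) by (simp add: properfactor_def divides_iff)
      then show ?thesis using irr b Units_iff by blast
    qed (use t in auto)
  qed
  then show "u \<in> carrier H \<and> batom (\<phi> u)" using u by blast
next
  assume u: "u \<in> carrier H \<and> batom (\<phi> u)"
  have "irreducible H u"
    unfolding irreducible_def
  proof (intro conjI ballI impI)
    show "u \<notin> Units H" using u Units_iff batom_nonempty by blast
    fix b assume b: "b \<in> carrier H" "properfactor H b u"
    then have "\<phi> b \<subseteq># \<phi> u" "\<not> \<phi> u \<subseteq># \<phi> b" using u by (auto simp: properfactor_def divides_iff)
    then have "\<phi> b = {#}" using u zs_phi[OF b(1)] by (auto simp: batom_def)
    then show "b \<in> Units H" using b Units_iff by blast
  qed
  then show "u \<in> atoms H" using u by (auto simp: atoms_def)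
qed

text \<open>For zero-sum \<open>m\<close> this is an associate class, that is, an element of the
  reduced monoid; for all other \<open>m\<close> it is empty.\<close>

definition fib :: "'p multiset \<Rightarrow> 'a set" where "fib m = {a \<in> carrier H. \<phi> a = m}"

lemma red_class_fib: "a \<in> carrier H \<Longrightarrow> red_class H a = fib (\<phi> a)"
  by (auto simp: red_class_def fib_def phi_eq_iff)

lemma fib_inj: "zs m \<Longrightarrow> fib m = fib m' \<Longrightarrow> m = m'"
proof -
  assume m: "zs m" "fib m = fib m'"
  obtain a where a: "a \<in> carrier H" "\<phi> a = m" using phi_surj m(1) .
  then have "a \<in> fib m" by (simp add: fib_def)
  then have "a \<in> fib m'" by (simp only: m(2))
  then show "m = m'" using a(2) by (simp add: fib_def)
qed

text \<open>On zero-sum multisets \<open>fib\<close> has the left inverse \<open>un\<close>, which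
  reads off the divisor of any representative.\<close>

lemma image_fib_inj:
  assumes "\<And>u. u \<in># x \<Longrightarrow> zs u" "\<And>u. u \<in># y \<Longrightarrow> zs u" "image_mset fib x = image_mset fib y"
  shows "x = y"
proof -
  define un where "un S = \<phi> (SOME a. a \<in> S)" for S
  have un: "un (fib m) = m" if m: "zs m" for m
  proof -
    obtain a where "a \<in> carrier H" "\<phi> a = m" using phi_surj m .
    then have "a \<in> fib m" by (simp add: fib_def)
    then have "(SOME a. a \<in> fib m) \<in> fib m" by (rule someI)
    then show ?thesis by (simp add: un_def fib_def)
  qed
  have *: "image_mset un (image_mset fib z) = z" if "\<And>u. u \<in># z \<Longrightarrow> zs u" for z
  proof -
    have "image_mset un (image_mset fib z) = image_mset id z"
      unfolding multiset.map_comp by (intro image_mset_cong) (use that un in auto)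
    then show ?thesis by simp
  qed
  show ?thesis using *[of x, OF assms(1)] *[of y, OF assms(2)] assms(3) by metis
qed

lemma facs_fib_inj: "x \<in> facs m \<Longrightarrow> y \<in> facs m' \<Longrightarrow> image_mset fib x = image_mset fib y \<Longrightarrow> x = y"
  using image_fib_inj facs_batom batom_zs by meson

lemma foldr_phi:
  "set us \<subseteq> carrier H \<Longrightarrow> foldr (\<otimes>\<^bsub>H\<^esub>) us \<one>\<^bsub>H\<^esub> \<in> carrier H \<and> \<phi> (foldr (\<otimes>\<^bsub>H\<^esub>) us \<one>\<^bsub>H\<^esub>) = \<Sum>\<^sub># (mset (map \<phi> us))"
  by (induction us) auto

lemma factorizations_eq:
  assumes a: "a \<in> carrier H"
  shows "factorizations H a = image_mset fib ` facs (\<phi> a)"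
proof (intro equalityI subsetI)
  fix z assume "z \<in> factorizations H a"
  then obtain us where us: "set us \<subseteq> atoms H" "mset (map (red_class H) us) = z"
    "foldr (\<otimes>\<^bsub>H\<^esub>) us \<one>\<^bsub>H\<^esub> \<sim>\<^bsub>H\<^esub> a" by (auto simp: factorizations_def)
  have c: "set us \<subseteq> carrier H" using us(1) atoms_iff by blast
  have "\<Sum>\<^sub># (mset (map \<phi> us)) = \<phi> a" using foldr_phi[OF c] us(3) phi_eq_iff a by metis
  moreover have "batom u" if "u \<in># mset (map \<phi> us)" for u using that us(1) atoms_iff by auto
  ultimately have "mset (map \<phi> us) \<in> facs (\<phi> a)" by (intro facsI)
  moreover have "z = image_mset fib (mset (map \<phi> us))"
    unfolding us(2)[symmetric] using c red_class_fib by (auto simp: multiset.map_comp intro!: image_mset_cong)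
  ultimately show "z \<in> image_mset fib ` facs (\<phi> a)" by blast
next
  fix z assume "z \<in> image_mset fib ` facs (\<phi> a)"
  then obtain w where w: "w \<in> facs (\<phi> a)" "z = image_mset fib w" by blast
  obtain ms where ms: "mset ms = w" using ex_mset by blast
  define pre where "pre m = (SOME a. a \<in> carrier H \<and> \<phi> a = m)" for m
  have pre: "pre m \<in> carrier H \<and> \<phi> (pre m) = m" if "m \<in> set ms" for m
  proof -
    have "zs m" using that ms facs_batom[OF w(1)] batom_zs by auto
    then have "\<exists>a. a \<in> carrier H \<and> \<phi> a = m" using phi_surj by metis
    then show ?thesis unfolding pre_def by (rule someI_ex)
  qed
  let ?us = "map pre ms"
  have 1: "set ?us \<subseteq> atoms H" using pre facs_batom[OF w(1)] ms by (auto simp: atoms_iff)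
  have 2: "mset (map (red_class H) ?us) = z"
    unfolding w(2) ms[symmetric] using pre red_class_fib by (auto simp: multiset.map_comp intro!: image_mset_cong)
  have c: "set ?us \<subseteq> carrier H" using pre by auto
  have "mset (map \<phi> ?us) = w" unfolding ms[symmetric]
    using pre by (simp add: multiset.map_comp) (metis (mono_tags, lifting) image_mset_cong multiset.map_ident set_mset_mset comp_apply)
  then have "\<phi> (foldr (\<otimes>\<^bsub>H\<^esub>) ?us \<one>\<^bsub>H\<^esub>) = \<phi> a" using foldr_phi[OF c] facs_sum[OF w(1)] by metis
  then have "foldr (\<otimes>\<^bsub>H\<^esub>) ?us \<one>\<^bsub>H\<^esub> \<sim>\<^bsub>H\<^esub> a" using phi_eq_iff foldr_phi[OF c] a by metis
  then show "z \<in> factorizations H a" unfolding factorizations_def using 1 2 by blast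
qed

lemma lengths_eq: "a \<in> carrier H \<Longrightarrow> lengths H a = size ` facs (\<phi> a)"
  by (simp add: lengths_def factorizations_eq image_image)

text \<open>Once the common part is cancelled, injectivity of \<open>fib\<close> on atoms keeps the
  two remainders disjoint.\<close>

lemma fdist_fib:
  assumes x: "x \<in> facs m" and y: "y \<in> facs m'"
  shows "fdist (image_mset fib x) (image_mset fib y) = fdist x y"
proof -
  define c x' y' where "c = x \<inter># y" and "x' = x - y" and "y' = y - x"
  have xy: "x = c + x'" "y = c + y'" and disj: "x' \<inter># y' = {#}"
    by (auto simp: c_def x'_def y'_def multiset_eq_iff)
  have "image_mset fib x' \<inter># image_mset fib y' = {#}"
  proof (rule ccontr)
    assume "image_mset fib x' \<inter># image_mset fib y' \<noteq> {#}"
    then obtain S where "S \<in># image_mset fib x' \<inter># image_mset fib y'" by auto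
    then obtain u v where uv: "u \<in># x'" "v \<in># y'" "fib u = fib v" by auto
    have "zs u" using uv(1) facs_batom[OF x] batom_zs by (simp add: xy)
    then have "u = v" using uv fib_inj by blast
    then have "u \<in># x' \<inter># y'" using uv by simp
    then show False using disj by simp
  qed
  then show ?thesis using disj by (simp add: xy fdist_disjoint)
qed

text \<open>Lists of factorizations are matched with the transitive closure: one direction lifts the
  list entry by entry, the other appends one entry per step.\<close>

lemma has_chain_iff:
  assumes a: "a \<in> carrier H" and x: "x \<in> facs (\<phi> a)" and y: "y \<in> facs (\<phi> a)"
  shows "has_chain H a (enat N) (image_mset fib x) (image_mset fib y) \<longleftrightarrow> conn N x y"
proof
  assume "has_chain H a (enat N) (image_mset fib x) (image_mset fib y)"
  then obtain zl where zl: "zl \<noteq> []" "hd zl = image_mset fib x" "last zl = image_mset fib y"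
    "set zl \<subseteq> factorizations H a" "\<And>i. Suc i < length zl \<Longrightarrow> fdist (zl ! i) (zl ! Suc i) \<le> N"
    by (auto simp: has_chain_def)
  have reach: "\<exists>w\<in>facs (\<phi> a). zl ! i = image_mset fib w \<and> conn N x w" if "i < length zl" for i
    using that
  proof (induction i)
    case 0
    then show ?case using x zl(1,2) by (auto simp: hd_conv_nth)
  next
    case (Suc i)
    then obtain w where w: "w \<in> facs (\<phi> a)" "zl ! i = image_mset fib w" "conn N x w" by auto
    have "zl ! Suc i \<in> factorizations H a" using Suc.prems zl(4) nth_mem by blast
    then obtain v where v: "v \<in> facs (\<phi> a)" "zl ! Suc i = image_mset fib v"
      using factorizations_eq[OF a] by blast
    have "fdist w v \<le> N" using zl(5)[OF Suc.prems] w(2) v(2) fdist_fib[OF w(1) v(1)] by simp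
    then have "conn N w v" using conn_step w(1) v(1) by blast
    then have "conn N x v" by (rule rtrancl_trans[OF w(3)])
    then show ?case using v by blast
  qed
  have "length zl - 1 < length zl" using zl(1) by simp
  from reach[OF this] obtain w where w: "w \<in> facs (\<phi> a)"
    and last: "zl ! (length zl - 1) = image_mset fib w \<and> conn N x w" by (rule bexE)
  have "w = y" using facs_fib_inj[OF w y] last zl(3) last_conv_nth[OF zl(1)] by metis
  then show "conn N x y" using last by simp
next
  assume "conn N x y"
  then show "has_chain H a (enat N) (image_mset fib x) (image_mset fib y)"
  proof (induction rule: rtrancl_induct)
    case base
    show ?case unfolding has_chain_def
      by (rule exI[of _ "[image_mset fib x]"]) (use x factorizations_eq[OF a] in auto)
  next
    case (step v w)
    then obtain zl where zl: "zl \<noteq> []" "hd zl = image_mset fib x" "last zl = image_mset fib v"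
      "set zl \<subseteq> factorizations H a" "\<And>i. Suc i < length zl \<Longrightarrow> enat (fdist (zl ! i) (zl ! Suc i)) \<le> enat N"
      by (auto simp: has_chain_def)
    have v: "v \<in> facs (\<phi> a)" using conn_facs x step.hyps(1) by blast
    have w: "w \<in> facs (\<phi> a)" using conn_facs x step.hyps rtrancl.rtrancl_into_rtrancl by meson
    have d: "fdist (image_mset fib v) (image_mset fib w) \<le> N"
      using step.hyps(2) fdist_fib[OF v w] by (auto simp: chain_step_def)
    show ?case unfolding has_chain_def
    proof (intro exI[of _ "zl @ [image_mset fib w]"] conjI allI impI)
      fix i assume i: "Suc i < length (zl @ [image_mset fib w])"
      show "enat (fdist ((zl @ [image_mset fib w]) ! i) ((zl @ [image_mset fib w]) ! Suc i)) \<le> enat N"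
      proof (cases "Suc i < length zl")
        case True
        then show ?thesis using zl(5)[OF True] by (simp add: nth_append)
      next
        case False
        then have "i = length zl - 1" "Suc i = length zl" using i zl(1) by auto
        then show ?thesis using zl(1,3) d by (simp add: nth_append last_conv_nth)
      qed
    qed (use zl w factorizations_eq[OF a] in auto)
  qed
qed

section \<open>The invariants of \<open>H\<close> in terms of multisets of prime divisors\<close>

lemma R_set_eq: "R_set H = rel_degrees"
proof (intro equalityI subsetI)
  fix d assume "d \<in> R_set H"
  then obtain a z z' where d: "2 \<le> d" "a \<in> carrier H" "z \<in> factorizations H a" "z' \<in> factorizations H a"
    "z \<noteq> z'" "fdist z z' = d" "\<not> has_chain H a (enat (d - 1)) z z'"
    by (auto simp: R_set_def)
  obtain x y where xy: "x \<in> facs (\<phi> a)" "y \<in> facs (\<phi> a)" "z = image_mset fib x" "z' = image_mset fib y"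
    using d(3,4) factorizations_eq[OF d(2)] by blast
  have "x \<noteq> y" "fdist x y = d" "\<not> conn (d - 1) x y"
    using d xy fdist_fib has_chain_iff[OF d(2) xy(1,2)] by auto
  then show "d \<in> rel_degrees" using d(1) xy(1,2) unfolding rel_degrees_def by blast
next
  fix d assume "d \<in> rel_degrees"
  then obtain m x y where d: "2 \<le> d" "x \<in> facs m" "y \<in> facs m" "x \<noteq> y" "fdist x y = d" "\<not> conn (d - 1) x y"
    by (auto simp: rel_degrees_def)
  obtain a where a: "a \<in> carrier H" "\<phi> a = m" using phi_surj facs_zs d(2) by metis
  have xy: "x \<in> facs (\<phi> a)" "y \<in> facs (\<phi> a)" using d a by auto
  have "image_mset fib x \<in> factorizations H a" "image_mset fib y \<in> factorizations H a"
    using xy factorizations_eq[OF a(1)] by auto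
  moreover have "image_mset fib x \<noteq> image_mset fib y" using facs_fib_inj[OF xy] d(4) by blast
  moreover have "fdist (image_mset fib x) (image_mset fib y) = d" using fdist_fib[OF xy] d(5) by simp
  moreover have "\<not> has_chain H a (enat (d - 1)) (image_mset fib x) (image_mset fib y)"
    using has_chain_iff[OF a(1) xy] d(6) by simp
  ultimately show "d \<in> R_set H" using d(1) a(1) unfolding R_set_def by blast
qed

lemma daleth_star_eq: "daleth_star H = dal"
proof (intro equalityI subsetI)
  fix k assume "k \<in> daleth_star H"
  then obtain u v where uv: "u \<in> atoms H" "v \<in> atoms H"
    and k: "k = (LEAST k. k \<in> lengths H (u \<otimes>\<^bsub>H\<^esub> v) - {2})"
    and two: "\<exists>k l. k \<in> lengths H (u \<otimes>\<^bsub>H\<^esub> v) \<and> l \<in> lengths H (u \<otimes>\<^bsub>H\<^esub> v) \<and> k \<noteq> l"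
    by (auto simp: daleth_star_def)
  have c: "u \<in> carrier H" "v \<in> carrier H" "batom (\<phi> u)" "batom (\<phi> v)" using uv atoms_iff by auto
  have L: "lengths H (u \<otimes>\<^bsub>H\<^esub> v) = size ` facs (\<phi> u + \<phi> v)" using lengths_eq c by simp
  \<comment> \<open>Of two different lengths at least one is not two, so the least element is taken
    over a nonempty set.\<close>
  have "\<exists>j. j \<in> size ` facs (\<phi> u + \<phi> v) - {2}" using two unfolding L by (metis DiffI singletonD)
  then obtain j where j: "j \<in> size ` facs (\<phi> u + \<phi> v) - {2}" ..
  have "min_long (\<phi> u + \<phi> v) k"
    unfolding min_long_def k L
    using LeastI[of "\<lambda>k. k \<in> size ` facs (\<phi> u + \<phi> v) - {2}", OF j]
      Least_le[of "\<lambda>k. k \<in> size ` facs (\<phi> u + \<phi> v) - {2}"] by auto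
  then show "k \<in> dal" using dalI c by blast
next
  fix k assume "k \<in> dal"
  then obtain U V where UV: "batom U" "batom V" "min_long (U + V) k" by (auto simp: dal_def)
  obtain u where u: "u \<in> carrier H" "\<phi> u = U" using phi_surj batom_zs UV(1) by metis
  obtain v where v: "v \<in> carrier H" "\<phi> v = V" using phi_surj batom_zs UV(2) by metis
  have L: "lengths H (u \<otimes>\<^bsub>H\<^esub> v) = size ` facs (U + V)" using lengths_eq u v by simp
  have "{#U, V#} \<in> facs (U + V)" using UV by (auto simp: facs_def)
  then have "2 \<in> lengths H (u \<otimes>\<^bsub>H\<^esub> v)" unfolding L by force
  moreover have "k \<in> lengths H (u \<otimes>\<^bsub>H\<^esub> v)" "k \<noteq> 2" using UV(3) by (auto simp: L min_long_def)
  moreover have "(LEAST k. k \<in> lengths H (u \<otimes>\<^bsub>H\<^esub> v) - {2}) = k"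
    by (rule Least_equality) (use UV(3) in \<open>auto simp: L min_long_def\<close>)
  moreover have "u \<in> atoms H" "v \<in> atoms H" using u v UV atoms_iff by auto
  ultimately show "k \<in> daleth_star H" unfolding daleth_star_def by blast
qed

lemma catenary_gt:
  assumes "x \<in> facs m" "y \<in> facs m" "\<not> conn k x y"
  shows "enat (Suc k) \<le> catenary H"
proof -
  obtain a where a: "a \<in> carrier H" "\<phi> a = m" using phi_surj facs_zs assms(1) by metis
  have xy: "x \<in> facs (\<phi> a)" "y \<in> facs (\<phi> a)" using assms a by auto
  have f: "image_mset fib x \<in> factorizations H a" "image_mset fib y \<in> factorizations H a"
    using xy factorizations_eq[OF a(1)] by auto
  have "enat (Suc k) \<le> catenary_elem H a"
    unfolding catenary_elem_def
  proof (rule Inf_greatest)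
    fix N assume "N \<in> {N. \<forall>z\<in>factorizations H a. \<forall>z'\<in>factorizations H a. has_chain H a N z z'}"
    then have N: "has_chain H a N (image_mset fib x) (image_mset fib y)" using f by blast
    show "enat (Suc k) \<le> N"
    proof (cases N)
      case (enat n)
      then have "conn n x y" using N has_chain_iff[OF a(1) xy] by simp
      then have "\<not> n \<le> k" using conn_mono assms(3) by blast
      then show ?thesis by (simp add: enat)
    qed simp
  qed
  also have "\<dots> \<le> catenary H" unfolding catenary_def using a(1) by (intro SUP_upper)
  finally show ?thesis .
qed

lemma catenary_le:
  assumes "\<And>m x y. x \<in> facs m \<Longrightarrow> y \<in> facs m \<Longrightarrow> conn N x y"
  shows "catenary H \<le> enat N"
  unfolding catenary_def
proof (rule SUP_least)
  fix a assume a: "a \<in> carrier H"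
  show "catenary_elem H a \<le> enat N"
    unfolding catenary_elem_def
  proof (rule Inf_lower, intro CollectI ballI)
    fix z z' assume "z \<in> factorizations H a" "z' \<in> factorizations H a"
    then obtain x y where "x \<in> facs (\<phi> a)" "y \<in> facs (\<phi> a)" "z = image_mset fib x" "z' = image_mset fib y"
      using factorizations_eq[OF a] by blast
    then show "has_chain H a (enat N) z z'" using has_chain_iff[OF a] assms by blast
  qed
qed

lemma rel_degrees_le_catenary: "rel_degrees \<subseteq> {d. 2 \<le> d \<and> enat d \<le> catenary H}"
proof
  fix d assume "d \<in> rel_degrees"
  then obtain m x y where d: "2 \<le> d" "x \<in> facs m" "y \<in> facs m" "\<not> conn (d - 1) x y"
    by (auto simp: rel_degrees_def)
  have "Suc (d - 1) = d" using d(1) by simp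
  then show "d \<in> {d. 2 \<le> d \<and> enat d \<le> catenary H}" using catenary_gt[OF d(2-4)] d(1) by simp
qed

text \<open>Two and \<open>k\<close> are consecutive lengths of the product of the two
  atoms.\<close>

lemma dal_subset_Delta: "dal \<subseteq> (+) 2 ` Delta H"
proof
  fix k assume k: "k \<in> dal"
  then obtain U V where UV: "batom U" "batom V" "min_long (U + V) k" by (auto simp: dal_def)
  have k3: "3 \<le> k" using dal_ge_3 k .
  obtain a where a: "a \<in> carrier H" "\<phi> a = U + V" using phi_surj zs_union batom_zs UV(1,2) by metis
  have L: "lengths H a = size ` facs (U + V)" using lengths_eq a by simp
  have "{#U, V#} \<in> facs (U + V)" using UV by (auto simp: facs_def)
  then have "2 \<in> lengths H a" unfolding L by force
  moreover have "k \<in> lengths H a" using UV(3) by (auto simp: L min_long_def)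
  moreover have "\<not> (\<exists>c\<in>lengths H a. 2 < c \<and> c < k)" using UV(3) unfolding L min_long_def by fastforce
  ultimately have "k - 2 \<in> delta_set (lengths H a)"
    unfolding delta_set_def using k3 by (intro CollectI exI[of _ 2] exI[of _ k]) simp
  then have "k - 2 \<in> Delta H" unfolding Delta_def using a(1) by blast
  then show "k \<in> (+) 2 ` Delta H" using k3 by (intro image_eqI[of _ _ "k - 2"]) auto
qed

lemma Delta_le_catenary: "(+) 2 ` Delta H \<subseteq> {d. 2 \<le> d \<and> enat d \<le> catenary H}"
proof
  fix e assume "e \<in> (+) 2 ` Delta H"
  then obtain a d where a: "a \<in> carrier H" "d \<in> delta_set (lengths H a)" "e = 2 + d"
    by (auto simp: Delta_def)
  then obtain k l where kl: "d = l - k" "k \<in> lengths H a" "l \<in> lengths H a" "k < l"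
    "\<not> (\<exists>c\<in>lengths H a. k < c \<and> c < l)" by (auto simp: delta_set_def)
  note L = lengths_eq[OF a(1)]
  obtain x y where xy: "x \<in> facs (\<phi> a)" "size x = k" "y \<in> facs (\<phi> a)" "size y = l"
    using kl(2,3) unfolding L by blast
  have "\<not> conn (size y - size x + 1) x y"
    using length_gap_not_conn[OF xy(1,3)] kl(4,5) xy(2,4) unfolding L by blast
  from catenary_gt[OF xy(1,3) this] show "e \<in> {d. 2 \<le> d \<and> enat d \<le> catenary H}"
    by (simp add: a(3) kl(1) xy)
qed

text \<open>Here the gcd condition of a divisor theory enters. If only one prime \<open>p\<close>
  had nontrivial class, every principal multiple of \<open>p\<close> would contain it twice, and
  \<open>{#p#}\<close> could not be a gcd of principal elements.\<close>

lemma ex_two_primes: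
  assumes card: "card (carrier G) = 2"
  shows "\<exists>p q. p \<noteq> q \<and> cls p = cls q \<and> cls p \<noteq> \<one>"
proof (rule ccontr)
  assume no: "\<not> ?thesis"
  obtain a b where ab: "carrier G = {a, b}" "a \<noteq> b" using card by (auto simp: card_2_iff)
  have two: "x = y" if "x \<in> carrier G" "y \<in> carrier G" "x \<noteq> \<one>" "y \<noteq> \<one>" for x y
    using that ab one_closed by auto
  obtain g where "g \<in> carrier G" "g \<noteq> \<one>" using ab by (metis insertCI)
  then obtain p where p: "cls p \<noteq> \<one>" using cls_surj by blast
  have only: "cls q = \<one>" if "q \<noteq> p" for q
    using no two[of "cls p" "cls q"] p that by fastforce
  obtain S where S: "S \<noteq> {}" "S \<subseteq> \<phi> ` carrier H" "is_gcd_mset S {#p#}"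
    using phi_gcd by blast
  have "{#p, p#} \<subseteq># x" if x: "x \<in> S" for x
  proof -
    have "{#p#} \<subseteq># x" using S(3) x by (auto simp: is_gcd_mset_def)
    then obtain x' where x': "x = add_mset p x'" by (metis insert_DiffM single_subset_iff)
    have "zs x" using S(2) x zs_phi by blast
    have "p \<in># x'"
    proof (rule ccontr)
      assume "p \<notin># x'"
      then have "sg x' = \<one>" by (induction x') (auto simp: only)
      then show False using \<open>zs x\<close> p by (simp add: x' zs_def)
    qed
    then show ?thesis by (simp add: x')
  qed
  then have "{#p, p#} \<subseteq># {#p#}" using S(3) unfolding is_gcd_mset_def by blast
  then show False by simp
qed

end

section \<open>Davenport constant three and larger\<close>

context block_monoid
begin

lemma ex_batom_davenport_numeral:
  "davenport G = 3 \<Longrightarrow> \<exists>u. batom u \<and> 3 \<le> size u"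
  "4 \<le> davenport G \<Longrightarrow> \<exists>u. batom u \<and> 4 \<le> size u"
  using ex_batom_davenport[of 2] ex_batom_davenport[of 3]
  by (auto simp: numeral_eq_enat)

text \<open>Atoms have size at most three, so \<open>catenary_bound\<close> with
  \<open>N = 3\<close> leaves only two and three as candidates; unique primes exclude two.\<close>

lemma rel_degrees_unique_primes:
  assumes D: "davenport G = 3" and uniq: "\<And>p q. cls p = cls q \<Longrightarrow> cls p \<noteq> \<one> \<Longrightarrow> p = q"
  shows "rel_degrees = {3}" "dal = {3}"
proof -
  have le: "size u \<le> 3" if "batom u" for u
    using batom_size_le_davenport[OF _ that, of 3] D by (simp add: numeral_eq_enat)
  have "3 \<in> dal" using ex_batom_davenport_numeral(1)[OF D] three_in_dal by blast
  moreover have d3: "k \<le> 3" if "k \<in> dal" for k using dal_le_bound[OF le that] .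
  ultimately show dal: "dal = {3}" using dal_ge_3 le_antisym by blast
  have "conn 3 z z'" if "z \<in> facs m" "z' \<in> facs m" for z z' m
    using catenary_bound[OF _ d3 le _ that] by simp
  then have "d \<le> 3" if "d \<in> rel_degrees" for d using rel_degrees_le[OF _ that] by blast
  moreover have "2 \<le> d" if "d \<in> rel_degrees" for d using that by (simp add: rel_degrees_def)
  moreover have "2 \<notin> rel_degrees" using two_notin_rel_degrees le uniq by blast
  ultimately have "d = 3" if "d \<in> rel_degrees" for d
    using that by (metis eval_nat_numeral(3) le_SucE le_antisym)
  then show "rel_degrees = {3}" using dal dal_subset_rel_degrees by blast
qed

lemma is_min_rel_degrees_dal:
  assumes "(davenport G = 3 \<and> (\<exists>p q. p \<noteq> q \<and> cls p = cls q \<and> cls p \<noteq> \<one>)) \<or> 4 \<le> davenport G"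
  shows "is_min rel_degrees 2" "is_min dal 3"
proof -
  obtain u where u: "batom u" "3 \<le> size u" and u4: "4 \<le> davenport G \<Longrightarrow> 4 \<le> size u"
    using assms ex_batom_davenport_numeral by (cases "4 \<le> davenport G") force+
  show "is_min dal 3" using three_in_dal[OF u] dal_ge_3 by (simp add: is_min_def)
  have "2 \<in> rel_degrees"
  proof (cases "4 \<le> davenport G")
    case True
    then show ?thesis using two_in_rel_degrees_long u(1) u4 by blast
  next
    case False
    then obtain p q where pq: "p \<noteq> q" "cls p = cls q" "cls p \<noteq> \<one>" using assms by blast
    have "2 \<le> size u" using u(2) by simp
    then obtain a b m where m: "u = m + {#a, b#}" by (rule two_le_sizeE)
    have ab: "cls a \<noteq> \<one>" "cls b \<noteq> \<one>" using batom_no_unit[OF u(1) \<open>2 \<le> size u\<close>] by (auto simp: m)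
    have nz: "cls a \<otimes> cls b \<noteq> \<one>"
    proof
      assume "cls a \<otimes> cls b = \<one>"
      then have "zs {#a, b#}" by (simp add: zs_def)
      then have "{#a, b#} = u" using batom_minimal[OF u(1), of "{#a, b#}"] by (simp add: m)
      then show False using u(2) by auto
    qed
    \<comment> \<open>The class of \<open>p\<close> cannot be inverse to both \<open>cls a\<close>
      and \<open>cls a \<otimes> cls b\<close>, since \<open>cls b\<close> is nontrivial.\<close>
    have "\<exists>h\<in>carrier G. h \<noteq> \<one> \<and> cls p \<otimes> h \<noteq> \<one>"
    proof (rule ccontr)
      assume "\<not> ?thesis"
      then have *: "cls p \<otimes> h = \<one>" if "h \<in> carrier G" "h \<noteq> \<one>" for h using that by blast
      have "cls p \<otimes> cls a = \<one>" using * ab by simp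
      moreover have "cls p \<otimes> (cls a \<otimes> cls b) = \<one>" using * nz by simp
      ultimately show False using ab(2) by (metis cls_closed l_one m_assoc)
    qed
    then show ?thesis using two_in_rel_degrees_double[OF pq] by blast
  qed
  then show "is_min rel_degrees 2" by (simp add: is_min_def rel_degrees_def)
qed

end

context krull_monoid
begin

text \<open>With \<open>N\<close> the maximum of \<open>dal\<close>, twice \<open>N\<close> reaches
  the Davenport constant, so the catenary degree is at most \<open>N\<close>. As \<open>dal\<close>
  is an interval starting at three, \<open>dal \<union> {2}\<close> contains everything from two to
  the catenary degree, and all the sets are squeezed in between.\<close>

lemma finite_davenport_star:
  assumes fin: "finite (carrier G)" and D: "davenport G = enat (davenport_star G)" and D4: "4 \<le> davenport_star G"
  shows "rel_degrees = dal \<union> {2}" "dal \<union> {2} = (+) 2 ` Delta H \<union> {2}"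
    "(+) 2 ` Delta H \<union> {2} = {d. 2 \<le> d \<and> enat d \<le> catenary H}"
proof -
  let ?C = "{d. 2 \<le> d \<and> enat d \<le> catenary H}"
  have le: "size u \<le> davenport_star G" if "batom u" for u using batom_size_le_davenport[OF D that] .
  have dle: "k \<le> davenport_star G" if "k \<in> dal" for k using dal_le_bound[OF le that] .
  then have fd: "finite dal" by (meson atMost_iff finite_atMost finite_subset subsetI)
  obtain k where k: "k \<in> dal" "davenport_star G \<le> 2 * k" using dal_invariant_factors[OF fin D4] by blast
  define N where "N = Max dal"
  have N: "N \<in> dal" unfolding N_def using fd k(1) by (intro Max_in) auto
  have Nmax: "j \<le> N" if "j \<in> dal" for j unfolding N_def using fd that by simp
  have DN: "davenport_star G \<le> 2 * N" using Nmax[OF k(1)] k(2) by linarith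
  have N2: "2 \<le> N" using dal_ge_3[OF N] by simp
  have "4 \<le> davenport G" using D D4 by (simp add: numeral_eq_enat)
  then have min: "is_min rel_degrees 2" "is_min dal 3" using is_min_rel_degrees_dal by auto
  have "catenary H \<le> enat N" by (rule catenary_le) (rule catenary_bound[OF N2 Nmax le DN])
  have "d \<in> dal \<union> {2}" if "d \<in> ?C" for d
  proof (cases "d = 2")
    case False
    then have "3 \<le> d" using that by simp
    moreover have "enat d \<le> enat N" using that order_trans[OF _ \<open>catenary H \<le> enat N\<close>] by blast
    moreover have "3 \<in> dal" using min(2) by (simp add: is_min_def)
    \<comment> \<open>Both ends, three and \<open>N\<close>, belong to \<open>dal\<close>, so the
      interval property fills in \<open>d\<close>.\<close>
    ultimately have "d \<in> dal" using dal_interval[unfolded interval_nat_def] N by (metis enat_ord_simps(1))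
    then show ?thesis ..
  qed simp
  then have C: "?C \<subseteq> dal \<union> {2}" by blast
  have two: "2 \<in> rel_degrees" using min(1) by (simp add: is_min_def)
  have R: "dal \<union> {2} \<subseteq> rel_degrees" using dal_subset_rel_degrees two by blast
  show "rel_degrees = dal \<union> {2}" using R C rel_degrees_le_catenary by blast
  have 2: "2 \<in> ?C" using two rel_degrees_le_catenary by blast
  show "dal \<union> {2} = (+) 2 ` Delta H \<union> {2}" using dal_subset_Delta Delta_le_catenary C by blast
  show "(+) 2 ` Delta H \<union> {2} = ?C" using dal_subset_Delta Delta_le_catenary C 2 by blast
qed

end

theorem theorem1p1:
  fixes H :: "'a monoid" and \<phi> :: "'a \<Rightarrow> 'p multiset" and G :: "'g monoid" and cls :: "'p \<Rightarrow> 'g"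
  assumes krull: "krull_with_class_group H \<phi> G cls"
    and every_class: "\<forall>g\<in>carrier G. \<exists>p. cls p = g"
  shows "interval_nat (daleth_star H) \<and> daleth_star H \<subseteq> R_set H
    \<and> ((finite (carrier G) \<and> davenport G = enat (davenport_star G) \<and> davenport_star G \<ge> 4) \<longrightarrow>
         (R_set H = daleth_star H \<union> {2} \<and>
          daleth_star H \<union> {2} = ((+) 2 ` Delta H) \<union> {2} \<and>
          ((+) 2 ` Delta H) \<union> {2} = {d. 2 \<le> d \<and> enat d \<le> catenary H}))
    \<and> (card (carrier G) = 1 \<longrightarrow> R_set H = {})
    \<and> (card (carrier G) = 2 \<longrightarrow> R_set H = {2})
    \<and> (infinite (carrier G) \<longrightarrow> R_set H = {d. 2 \<le> d})
    \<and> ((davenport G = 3 \<and> (\<forall>g\<in>carrier G. g \<noteq> \<one>\<^bsub>G\<^esub> \<longrightarrow> (\<exists>!p. cls p = g))) \<longrightarrow>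
         (R_set H = daleth_star H \<and> daleth_star H = {3}))
    \<and> (((davenport G = 3 \<and> (\<exists>g\<in>carrier G. g \<noteq> \<one>\<^bsub>G\<^esub> \<and> (\<exists>p q. p \<noteq> q \<and> cls p = g \<and> cls q = g)))
          \<or> davenport G \<ge> 4) \<longrightarrow>
         (is_min (R_set H) 2 \<and> is_min (daleth_star H) 3))"
proof -
  have cg: "comm_group G" "\<And>p. cls p \<in> carrier G"
    using krull by (auto simp: krull_with_class_group_def is_class_group_def)
  interpret K: krull_monoid G cls H \<phi>
    by (intro krull_monoid.intro block_monoid.intro block_monoid_axioms.intro krull_monoid_axioms.intro)
      (use cg every_class krull in auto)
  note eqs = K.R_set_eq K.daleth_star_eq
  show ?thesis
  proof (intro conjI impI)
    show "interval_nat (daleth_star H)" using K.dal_interval by (simp add: eqs)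
    show "daleth_star H \<subseteq> R_set H" using K.dal_subset_rel_degrees by (simp add: eqs)
  next
    assume *: "finite (carrier G) \<and> davenport G = enat (davenport_star G) \<and> 4 \<le> davenport_star G"
    show "R_set H = daleth_star H \<union> {2}" "daleth_star H \<union> {2} = (+) 2 ` Delta H \<union> {2}"
      "(+) 2 ` Delta H \<union> {2} = {d. 2 \<le> d \<and> enat d \<le> catenary H}"
      unfolding eqs using * K.finite_davenport_star by simp_all
  next
    assume "card (carrier G) = 1"
    then show "R_set H = {}" using K.rel_degrees_trivial by (simp add: eqs)
  next
    assume c: "card (carrier G) = 2"
    then show "R_set H = {2}" using K.ex_two_primes K.rel_degrees_order_two unfolding eqs by blast
  next
    assume "infinite (carrier G)"
    then show "R_set H = {d. 2 \<le> d}" using K.rel_degrees_infinite by (simp add: eqs)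
  next
    assume *: "davenport G = 3 \<and> (\<forall>g\<in>carrier G. g \<noteq> \<one>\<^bsub>G\<^esub> \<longrightarrow> (\<exists>!p. cls p = g))"
    have uniq: "p = q" if "cls p = cls q" "cls p \<noteq> \<one>\<^bsub>G\<^esub>" for p q
      using * that cg(2)[of p] by metis
    have D: "davenport G = 3" using * by blast
    show "R_set H = daleth_star H" "daleth_star H = {3}"
      unfolding eqs using K.rel_degrees_unique_primes[OF D uniq] by simp_all
  next
    assume "davenport G = 3 \<and> (\<exists>g\<in>carrier G. g \<noteq> \<one>\<^bsub>G\<^esub> \<and> (\<exists>p q. p \<noteq> q \<and> cls p = g \<and> cls q = g))
          \<or> 4 \<le> davenport G"
    then have "(davenport G = 3 \<and> (\<exists>p q. p \<noteq> q \<and> cls p = cls q \<and> cls p \<noteq> \<one>\<^bsub>G\<^esub>)) \<or> 4 \<le> davenport G"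
    proof (elim disjE conjE bexE exE)
      fix g p q
      assume "davenport G = 3" "g \<noteq> \<one>\<^bsub>G\<^esub>" "p \<noteq> q" "cls p = g" "cls q = g"
      then show ?thesis by (intro disjI1 conjI exI[of _ p] exI[of _ q]) simp_all
    qed (rule disjI2)
    then show "is_min (R_set H) 2" "is_min (daleth_star H) 3"
      unfolding eqs by (rule K.is_min_rel_degrees_dal)+
  qed
qed

end
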